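(* Let $g(t)=\sum_{k=1}^N \frac{a_k}{t-iw_k}$ with $a_k,w_k\in\mathbb{C}$, $a_k\neq 0$, $\Re w_k\neq 0$, and assume $\Re w_k\neq \Re w_l$ for $k\neq l$ and $$m_0(\xi):=\sum_{k=1}^N a_k e^{2\pi \xi w_k}\neq 0\quad\text{for all }\xi>0.$$ Then the Gabor system $\mathcal{G}(g;\alpha,\beta)$ is a frame in $L^2(\mathbb{R})$ for every $\alpha,\beta>0$ with $\alpha\beta<1$ and $\alpha\beta\notin\mathbb{Q}$.
   Context: For $g\in L^2(\mathbb{R})$ and $\alpha,\beta>0$, $\mathcal{G}(g;\alpha,\beta)=\{e^{2\pi i\beta n t}g(t-\alpha m)\}_{m,n\in\mathbb{Z}}$. It is a frame in $L^2(\mathbb{R})$ if there are $0<A\le B<\infty$ with $A\|f\|^2\le\sum_{m,n}|\langle f, e^{2\pi i\beta n\cdot}g(\cdot-\alpha m)\rangle|^2\le B\|f\|^2$ for all $f\in L^2(\mathbb{R})$. *)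

theory Defs
  imports "HOL-Analysis.Analysis"
begin

definition L2 :: "(real \<Rightarrow> complex) set" where
  "L2 = {f. f \<in> borel_measurable lborel \<and> integrable lborel (\<lambda>t. (cmod (f t))^2)}"

definition L2_inner :: "(real \<Rightarrow> complex) \<Rightarrow> (real \<Rightarrow> complex) \<Rightarrow> complex" where
  "L2_inner f h = integral\<^sup>L lborel (\<lambda>t. f t * cnj (h t))"

definition L2_normsq :: "(real \<Rightarrow> complex) \<Rightarrow> real" where
  "L2_normsq f = integral\<^sup>L lborel (\<lambda>t. (cmod (f t))^2)"

definition gabor_atom :: "(real \<Rightarrow> complex) \<Rightarrow> real \<Rightarrow> real \<Rightarrow> int \<Rightarrow> int \<Rightarrow> real \<Rightarrow> complex" where
  "gabor_atom g \<alpha> \<beta> m n = (\<lambda>t. exp (2 * pi * \<i> * complex_of_real (\<beta> * of_int n * t)) * g (t - \<alpha> * of_int m))"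

definition gabor_frame :: "(real \<Rightarrow> complex) \<Rightarrow> real \<Rightarrow> real \<Rightarrow> bool" where
  "gabor_frame g \<alpha> \<beta> \<longleftrightarrow>
     (\<exists>A B. 0 < A \<and> A \<le> B \<and>
        (\<forall>f \<in> L2.
           (\<lambda>(m,n). (cmod (L2_inner f (gabor_atom g \<alpha> \<beta> m n)))^2) summable_on (UNIV :: (int \<times> int) set) \<and>
           A * L2_normsq f \<le> (\<Sum>\<^sub>\<infinity>(m,n)\<in>(UNIV :: (int \<times> int) set). (cmod (L2_inner f (gabor_atom g \<alpha> \<beta> m n)))^2) \<and>
           (\<Sum>\<^sub>\<infinity>(m,n)\<in>(UNIV :: (int \<times> int) set). (cmod (L2_inner f (gabor_atom g \<alpha> \<beta> m n)))^2) \<le> B * L2_normsq f))"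

end

theory Submission
  imports Defs "HOL-Complex_Analysis.Complex_Analysis" "HOL-Real_Asymp.Real_Asymp" "HOL-Probability.Sinc_Integral"
begin

text \<open>After rescaling to \<open>\<beta> = 1\<close>, put \<open>T = 1/\<alpha> > 1\<close>. Parseval's identity on an interval of length \<open>T\<close>
  turns the frame inequality into a uniform bound for the matrices \<open>\<gamma>(\<eta> + pT - n)\<close> (rows \<open>n\<close>, columns \<open>p\<close>),
  where \<open>\<gamma>\<close> is the Fourier transform of the window. It consists of one-sided exponentials, so the upper
  bound is Schur's test. For the lower bound apply the difference operator that annihilates all the
  exponentials: the matrix becomes banded, with the leading coefficient \<open>m\<^sub>0\<close> at the position of \<open>\<eta> + pT\<close>
  in its unit cell. Since \<open>m\<^sub>0\<close> does not vanish, entries of a solution propagate downwards from any window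
  on which they are controlled. As \<open>T > 1\<close>, infinitely many unit cells contain no point \<open>\<eta> + pT\<close>, and each
  of these gives an additional equation. On a long window these equations force the solution to vanish
  generically in \<open>\<eta>\<close>: the matrix is entire in \<open>\<eta>\<close>, and as \<open>\<eta> \<rightarrow> \<infinity>\<close> the dominant exponential reduces the
  claim to a constant coefficient recurrence, whose solutions are exponential sums with distinct moduli
  and cannot vanish on an infinite set. Since \<open>\<alpha>\<close> is irrational, every orbit meets a good window within
  bounded time.\<close>

section \<open>Exponential sums, recurrences and irrational rotations\<close>

text \<open>The difficulty is uniformity in \<eta>: all fibre matrices need one common lower bound,
  although the pattern of empty cells jumps whenever a point crosses an integer. The way out is a
  single small interval of positions x of a point in its cell, just above 0, on which this pattern
  is frozen, so that the matrix of a finite window depends analytically on x. Nothing is known about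
  it there directly. Its continuation, with the pattern kept frozen, is studied for x far beyond the
  range where it describes a fibre, and the identity theorem carries injectivity back to positions
  near 0. In the limit the dominant exponential is exactly the factor that disappears from the
  recurrence, so that the empty cells only have to eliminate N - 1 unknown coefficients. Two
  quantities make this uniform: a lower bound on the good interval for an entire function d, which
  replaces a minor of the window matrix, and the bounded number of descent steps between an
  arbitrary cell and a good window.\<close>

lemma irrational_rotation_hits:
  fixes \<alpha> u1 u2 :: real
  assumes irr: "\<alpha> \<notin> \<rat>" and u: "0 \<le> u1" "u1 < u2" "u2 \<le> 1"
  shows "\<exists>K. \<forall>\<theta>. \<exists>k\<le>K. frac (\<theta> + real k * \<alpha>) \<in> {u1<..<u2}"
proof -
  \<comment> \<open>The midpoint of the target interval has distance 2 \<epsilon> from its ends: one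
    \<epsilon> pays for Kronecker's approximation, the other for rounding to the grid of mesh
    1/M.\<close>
  define \<epsilon> where "\<epsilon> = (u2 - u1) / 4"
  have e: "\<epsilon> > 0" "\<epsilon> \<le> 1/4" using u by (auto simp: \<epsilon>_def)
  have "\<exists>k. \<bar>frac (real k * \<alpha>) - \<beta>\<bar> < \<epsilon>" if "0 \<le> \<beta>" "\<beta> \<le> 1" for \<beta>
    using Kronecker_approx_1_explicit[OF irr that e(1)] by metis
  then obtain k where k: "\<And>\<beta>. 0 \<le> \<beta> \<Longrightarrow> \<beta> \<le> 1 \<Longrightarrow> \<bar>frac (real (k \<beta>) * \<alpha>) - \<beta>\<bar> < \<epsilon>" by metis
  obtain M :: nat where M: "1 / \<epsilon> < real M" using reals_Archimedean2 by blast
  have M0: "M > 0" using M e by (metis gr0I divide_pos_pos of_nat_0 order_less_asym zero_less_one)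
  \<comment> \<open>Only the orbit of 0 is approximated, at finitely many grid targets. An arbitrary
    start \<theta> is absorbed by aiming at \<open>frac (c - \<theta>)\<close>, which makes K
    independent of \<theta>.\<close>
  define K where "K = Max ((\<lambda>i. k (real i / real M)) ` {..M})"
  have "\<exists>k\<le>K. frac (\<theta> + real k * \<alpha>) \<in> {u1<..<u2}" for \<theta>
  proof -
    define c where "c = (u1 + u2) / 2"
    define \<beta> where "\<beta> = frac (c - \<theta>)"
    have b: "0 \<le> \<beta>" "\<beta> < 1" by (auto simp: \<beta>_def frac_lt_1)
    define i where "i = nat \<lfloor>\<beta> * M\<rfloor>"
    have i1: "real i \<le> \<beta> * M" "\<beta> * M < real i + 1" using b by (auto simp: i_def)
    have iM: "i \<le> M" using i1 b M0
      by (smt (verit) mult_le_cancel_right1 of_nat_le_iff of_nat_0_less_iff mult_less_cancel_right1)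
    have ib: "\<bar>real i / M - \<beta>\<bar> < \<epsilon>"
    proof -
      have "\<bar>real i / M - \<beta>\<bar> = \<bar>real i - \<beta> * M\<bar> / M" using M0
        by (simp add: field_simps abs_divide flip: abs_mult)
      also have "\<dots> \<le> 1 / M" using i1 M0 by (intro divide_right_mono) auto
      also have "\<dots> < \<epsilon>" using M M0 e by (simp add: field_simps)
      finally show ?thesis .
    qed
    define q where "q = k (real i / real M)"
    have q: "\<bar>frac (real q * \<alpha>) - real i / M\<bar> < \<epsilon>" unfolding q_def
      using iM M0 by (intro k) (auto simp: field_simps)
    have "q \<le> K" unfolding q_def K_def using iM by (intro Max_ge) auto
    define s where "s = c + (frac (real q * \<alpha>) - \<beta>)"
    have qb: "\<bar>frac (real q * \<alpha>) - \<beta>\<bar> < (u2 - u1) / 2" using q ib unfolding \<epsilon>_def by linarith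
    have s: "u1 < s" "s < u2" using qb unfolding s_def c_def by argo+
    have "\<theta> + real q * \<alpha> = s + of_int (\<lfloor>real q * \<alpha>\<rfloor> - \<lfloor>c - \<theta>\<rfloor>)"
      by (simp add: s_def \<beta>_def frac_def)
    moreover have "frac (s + of_int (\<lfloor>real q * \<alpha>\<rfloor> - \<lfloor>c - \<theta>\<rfloor>)) = s"
      using s u by (simp add: frac_unique_iff)
    ultimately have "frac (\<theta> + real q * \<alpha>) = s" by simp
    thus ?thesis using \<open>q \<le> K\<close> s by auto
  qed
  thus ?thesis by blast
qed

text \<open>If the largest base has a nonzero coefficient, the vanishing at the points found for the smaller
  bases determines the coefficients up to scaling, and one further late point excludes that line.\<close>
lemma exponential_sum_zeros:
  fixes z :: "'a \<Rightarrow> complex"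
  assumes "finite L" and "inj_on (\<lambda>l. norm (z l)) L" and "\<And>l. l \<in> L \<Longrightarrow> z l \<noteq> 0" and Z: "infinite (Z :: nat set)"
  shows "\<exists>Z'\<subseteq>Z. finite Z' \<and> (\<forall>c. (\<forall>j\<in>Z'. (\<Sum>l\<in>L. c l * z l ^ j) = 0) \<longrightarrow> (\<forall>l\<in>L. c l = 0))"
  using assms(1-3)
\<comment> \<open>Ranking by modulus makes the inserted base the largest, so after division by its
  powers all other terms tend to 0.\<close>
proof (induction L rule: finite_ranking_induct[where f = "\<lambda>l. norm (z l)"])
  case empty
  then show ?case by (intro exI[of _ "{}"]) auto
next
  case (insert t L)
  show ?case
  proof (cases "t \<in> L")
    case True
    then show ?thesis using insert by (simp add: insert_absorb)
  next
    case False
    have "\<exists>Z'\<subseteq>Z. finite Z' \<and> (\<forall>c. (\<forall>j\<in>Z'. (\<Sum>l\<in>L. c l * z l ^ j) = 0) \<longrightarrow> (\<forall>l\<in>L. c l = 0))"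
      using insert.prems by (intro insert.IH) (auto simp: inj_on_def)
    then obtain Z1 where Z1: "Z1 \<subseteq> Z" "finite Z1"
      "\<And>c. (\<forall>j\<in>Z1. (\<Sum>l\<in>L. c l * z l ^ j) = 0) \<Longrightarrow> (\<forall>l\<in>L. c l = 0)" by blast
    have lt: "norm (z l) < norm (z t)" if "l \<in> L" for l
      using insert.hyps(2)[OF that] insert.prems(1) that False
      by (metis inj_on_contraD insertI1 insertI2 order_le_less)
    have zt: "z t \<noteq> 0" using insert.prems by auto
    have sum_split: "(\<Sum>l\<in>insert t L. c l * z l ^ j) = c t * z t ^ j + (\<Sum>l\<in>L. c l * z l ^ j)" for c j
      using False insert.hyps by simp
    show ?thesis
    proof (cases "\<exists>c0. c0 t = 1 \<and> (\<forall>j\<in>Z1. (\<Sum>l\<in>insert t L. c0 l * z l ^ j) = 0)")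
      case True
      then obtain c0 where c0: "c0 t = 1" "\<And>j. j \<in> Z1 \<Longrightarrow> (\<Sum>l\<in>insert t L. c0 l * z l ^ j) = 0" by blast
      have "(\<lambda>j. 1 + (\<Sum>l\<in>L. c0 l * (z l / z t) ^ j)) \<longlonglongrightarrow> 1 + (\<Sum>l\<in>L. c0 l * 0)"
        using lt zt by (intro tendsto_intros LIMSEQ_power_zero) (auto simp: norm_divide field_simps)
      hence "(\<lambda>j. 1 + (\<Sum>l\<in>L. c0 l * (z l / z t) ^ j)) \<longlonglongrightarrow> 1" by simp
      hence "eventually (\<lambda>j. 1 + (\<Sum>l\<in>L. c0 l * (z l / z t) ^ j) \<noteq> 0) sequentially"
        by (rule tendsto_imp_eventually_ne) simp
      then obtain J where J: "\<And>j. j \<ge> J \<Longrightarrow> 1 + (\<Sum>l\<in>L. c0 l * (z l / z t) ^ j) \<noteq> 0"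
        by (auto simp: eventually_sequentially)
      obtain j0 where j0: "j0 \<in> Z" "j0 \<ge> J" using Z by (metis infinite_nat_iff_unbounded_le)
      have nz: "(\<Sum>l\<in>insert t L. c0 l * z l ^ j0) \<noteq> 0"
      proof -
        have "(\<Sum>l\<in>insert t L. c0 l * z l ^ j0) = z t ^ j0 * (1 + (\<Sum>l\<in>L. c0 l * (z l / z t) ^ j0))"
          using zt by (simp add: sum_split c0 ring_distribs sum_distrib_left power_divide)
        thus ?thesis using J[OF j0(2)] zt by simp
      qed
      show ?thesis
      proof (intro exI[of _ "insert j0 Z1"] conjI allI impI)
        fix c assume c: "\<forall>j\<in>insert j0 Z1. (\<Sum>l\<in>insert t L. c l * z l ^ j) = 0"
        have "\<forall>l\<in>L. c l - c t * c0 l = 0"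
        proof (rule Z1(3), intro ballI)
          fix j assume j: "j \<in> Z1"
          have "(\<Sum>l\<in>L. (c l - c t * c0 l) * z l ^ j) =
             (\<Sum>l\<in>insert t L. c l * z l ^ j) - c t * (\<Sum>l\<in>insert t L. c0 l * z l ^ j)"
            by (simp add: sum_split c0 left_diff_distrib sum_subtractf sum_distrib_left ring_distribs mult.assoc)
          thus "(\<Sum>l\<in>L. (c l - c t * c0 l) * z l ^ j) = 0" using c c0(2) j by simp
        qed
        hence eq: "c l = c t * c0 l" if "l \<in> insert t L" for l using that c0 by auto
        have "0 = (\<Sum>l\<in>insert t L. c l * z l ^ j0)" using c by simp
        also have "\<dots> = (\<Sum>l\<in>insert t L. c t * (c0 l * z l ^ j0))"
          by (intro sum.cong refl) (metis eq mult.assoc)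
        also have "\<dots> = c t * (\<Sum>l\<in>insert t L. c0 l * z l ^ j0)" by (simp only: sum_distrib_left)
        finally have "c t = 0" using nz by simp
        thus "\<forall>l\<in>insert t L. c l = 0" by (metis eq mult_zero_left)
      qed (use Z1(1,2) j0 in auto)
    next
      \<comment> \<open>Without a normalised solution every solution has top coefficient 0, and the
        points of the smaller set already suffice.\<close>
      case none: False
      show ?thesis
      proof (intro exI[of _ Z1] conjI allI impI)
        fix c assume c: "\<forall>j\<in>Z1. (\<Sum>l\<in>insert t L. c l * z l ^ j) = 0"
        have "c t = 0"
        proof (rule ccontr)
          assume ct: "c t \<noteq> 0"
          have "(\<Sum>l\<in>insert t L. c l / c t * z l ^ j) = (\<Sum>l\<in>insert t L. c l * z l ^ j) / c t" for j
            by (simp add: sum_divide_distrib)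
          hence "\<forall>j\<in>Z1. (\<Sum>l\<in>insert t L. c l / c t * z l ^ j) = 0" using c by simp
          thus False using none ct by (metis divide_self)
        qed
        moreover from this have "\<forall>l\<in>L. c l = 0" using c by (intro Z1(3)) (simp add: sum_split)
        ultimately show "\<forall>l\<in>insert t L. c l = 0" by auto
      qed (use Z1(1,2) in auto)
    qed
  qed
qed

lemma degree_prod_linear:
  fixes z :: "'a \<Rightarrow> complex"
  assumes "finite L"
  shows "degree (\<Prod>l\<in>L. [:1, - z l:]) \<le> card L"
  using assms
proof (induction L rule: finite_induct)
  case (insert t L)
  have "degree ([:1, - z t:] * (\<Prod>l\<in>L. [:1, - z l:])) \<le> degree [:1, - z t:] + degree (\<Prod>l\<in>L. [:1, - z l:])"
    by (rule degree_mult_le)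
  moreover have "degree [:1, - z t:] \<le> 1" by simp
  ultimately show ?case using insert by simp
qed simp

text \<open>The coefficients are those of the characteristic polynomial with roots
  \<open>z l\<close>, in reversed order. One root is peeled off at a time:
  \<open>u (Suc k) - z t * u k\<close> obeys the recurrence of the other bases, and the first-order
  equation that remains has no resonance because the bases are distinct.\<close>

lemma linear_recurrence_solution:
  fixes z :: "'a \<Rightarrow> complex" and u :: "nat \<Rightarrow> complex"
  assumes "finite L" "inj_on z L"
    and "\<And>s. s \<le> J \<Longrightarrow> (\<Sum>i\<le>card L. coeff (\<Prod>l\<in>L. [:1, - z l:]) i * u (s + card L - i)) = 0"
  shows "\<exists>c. \<forall>s\<le>J + card L. u s = (\<Sum>l\<in>L. c l * z l ^ s)"
  using assms
proof (induction L arbitrary: u rule: finite_induct)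
  case empty
  then show ?case by auto
next
  case (insert t L)
  define Q where "Q = (\<Prod>l\<in>L. [:1, - z l:])"
  define n where "n = card L"
  have cn: "card (insert t L) = Suc n" using insert by (simp add: n_def)
  have dQ: "coeff Q (Suc n) = 0"
    using degree_prod_linear[OF insert.hyps(1), of z] by (intro coeff_eq_0) (simp add: Q_def n_def)
  have prodQ: "(\<Prod>l\<in>insert t L. [:1, - z l:]) = Q - smult (z t) (pCons 0 Q)"
    using insert.hyps by (simp add: Q_def)
  define u' where "u' k = u (Suc k) - z t * u k" for k
  have "\<exists>c. \<forall>s\<le>J + card L. u' s = (\<Sum>l\<in>L. c l * z l ^ s)"
  proof (rule insert.IH)
    show "inj_on z L" using insert by (auto simp: inj_on_def)
    fix s assume s: "s \<le> J"
    have "0 = (\<Sum>i\<le>Suc n. coeff (Q - smult (z t) (pCons 0 Q)) i * u (s + Suc n - i))"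
      using insert.prems(2)[OF s] by (simp only: prodQ cn)
    also have "\<dots> = (\<Sum>i\<le>Suc n. coeff Q i * u (s + Suc n - i)) - (\<Sum>i\<le>Suc n. z t * coeff (pCons 0 Q) i * u (s + Suc n - i))"
      by (simp add: left_diff_distrib sum_subtractf del: sum.atMost_Suc smult_pCons)
    also have "(\<Sum>i\<le>Suc n. coeff Q i * u (s + Suc n - i)) = (\<Sum>i\<le>n. coeff Q i * u (Suc (s + n - i)))"
      by (simp add: dQ Suc_diff_le)
    also have "(\<Sum>i\<le>Suc n. z t * coeff (pCons 0 Q) i * u (s + Suc n - i)) = (\<Sum>i\<le>n. z t * coeff Q i * u (s + n - i))"
      by (subst sum.atMost_Suc_shift) (simp del: sum.atMost_Suc)
    also have "(\<Sum>i\<le>n. coeff Q i * u (Suc (s + n - i))) - (\<Sum>i\<le>n. z t * coeff Q i * u (s + n - i))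
        = (\<Sum>i\<le>n. coeff Q i * u' (s + n - i))"
      by (simp add: u'_def right_diff_distrib sum_subtractf mult_ac)
    finally show "(\<Sum>i\<le>card L. coeff (\<Prod>l\<in>L. [:1, - z l:]) i * u' (s + card L - i)) = 0"
      by (simp add: Q_def n_def)
  qed
  then obtain c where c: "\<And>s. s \<le> J + n \<Longrightarrow> u' s = (\<Sum>l\<in>L. c l * z l ^ s)" by (auto simp: n_def)
  have ne: "z l - z t \<noteq> 0" if "l \<in> L" for l using that insert by (auto simp: inj_on_def)
  \<comment> \<open>A particular solution of the first-order equation driven by the exponential sum;
    \<open>c0\<close> then fits the initial value.\<close>
  define e where "e l = c l / (z l - z t)" for l
  define c0 where "c0 = u 0 - (\<Sum>l\<in>L. e l)"
  have main: "u s = (\<Sum>l\<in>L. e l * z l ^ s) + c0 * z t ^ s" if "s \<le> J + Suc n" for s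
    using that
  proof (induction s)
    case 0
    then show ?case by (simp add: c0_def)
  next
    case (Suc s)
    have "u (Suc s) = u' s + z t * u s" by (simp add: u'_def)
    also have "\<dots> = (\<Sum>l\<in>L. c l * z l ^ s) + z t * ((\<Sum>l\<in>L. e l * z l ^ s) + c0 * z t ^ s)"
      using Suc c[of s] by simp
    also have "(\<Sum>l\<in>L. c l * z l ^ s) = (\<Sum>l\<in>L. e l * (z l - z t) * z l ^ s)"
      using ne by (intro sum.cong) (auto simp: e_def)
    also have "\<dots> + z t * ((\<Sum>l\<in>L. e l * z l ^ s) + c0 * z t ^ s) = (\<Sum>l\<in>L. e l * z l ^ Suc s) + c0 * z t ^ Suc s"
      by (simp add: ring_distribs sum_distrib_left sum.distrib[symmetric] mult_ac)
    finally show ?case .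
  qed
  have "\<forall>s\<le>J + card (insert t L). u s = (\<Sum>l\<in>insert t L. (e(t := c0)) l * z l ^ s)"
  proof (intro allI impI)
    fix s assume "s \<le> J + card (insert t L)"
    hence "u s = (\<Sum>l\<in>L. e l * z l ^ s) + c0 * z t ^ s" by (intro main) (simp add: cn)
    also have "(\<Sum>l\<in>L. e l * z l ^ s) = (\<Sum>l\<in>L. (e(t := c0)) l * z l ^ s)"
      using insert by (intro sum.cong) auto
    finally show "u s = (\<Sum>l\<in>insert t L. (e(t := c0)) l * z l ^ s)" using insert by simp
  qed
  thus ?case by (rule exI[of _ "e(t := c0)"])
qed

text \<open>A substitute for the adjugate, in which d acts as a maximal minor that is nonzero at x0.
  Columns are added one at a time by elimination with cleared denominators, so every entry stays
  holomorphic. Injectivity at one point thus gives the left inverse L/d wherever d is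
  nonzero.\<close>

lemma holomorphic_left_inverse:
  fixes A :: "'r \<Rightarrow> 'p \<Rightarrow> complex \<Rightarrow> complex"
  assumes "finite P" "finite R"
    and "\<And>r p. r \<in> R \<Longrightarrow> p \<in> P \<Longrightarrow> A r p holomorphic_on UNIV"
    and "\<And>v. (\<And>r. r \<in> R \<Longrightarrow> (\<Sum>p\<in>P. A r p x0 * v p) = 0) \<Longrightarrow> (\<forall>p\<in>P. v p = 0)"
  shows "\<exists>L d. d holomorphic_on UNIV \<and> d x0 \<noteq> 0 \<and> (\<forall>p\<in>P. \<forall>r\<in>R. L p r holomorphic_on UNIV) \<and>
    (\<forall>x. \<forall>p\<in>P. \<forall>q\<in>P. (\<Sum>r\<in>R. L p r x * A r q x) = (if p = q then d x else 0))"
  using assms(1,3,4)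
proof (induction P rule: finite_induct)
  case empty
  show ?case by (rule exI[of _ "\<lambda>_ _ _. 0"], rule exI[of _ "\<lambda>_. 1"]) simp
next
  case (insert t P)
  have IHinj: "\<forall>p\<in>P. v p = 0" if "\<And>r. r \<in> R \<Longrightarrow> (\<Sum>p\<in>P. A r p x0 * v p) = 0" for v
  proof -
    define v' where "v' = v(t := 0)"
    have "\<forall>p\<in>insert t P. v' p = 0"
    proof (rule insert.prems(2))
      fix r assume "r \<in> R"
      have "(\<Sum>p\<in>P. A r p x0 * v' p) = (\<Sum>p\<in>P. A r p x0 * v p)"
        using insert.hyps by (intro sum.cong) (auto simp: v'_def)
      thus "(\<Sum>p\<in>insert t P. A r p x0 * v' p) = 0" using that[OF \<open>r \<in> R\<close>] insert.hyps by (simp add: v'_def)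
    qed
    thus ?thesis using insert.hyps unfolding v'_def by (metis fun_upd_other insertI2)
  qed
  have "\<exists>L d. d holomorphic_on UNIV \<and> d x0 \<noteq> 0 \<and> (\<forall>p\<in>P. \<forall>r\<in>R. L p r holomorphic_on UNIV) \<and>
    (\<forall>x. \<forall>p\<in>P. \<forall>q\<in>P. (\<Sum>r\<in>R. L p r x * A r q x) = (if p = q then d x else 0))"
    by (rule insert.IH[OF insert.prems(1) IHinj]) auto
  then obtain L d where Ld: "d holomorphic_on UNIV \<and> d x0 \<noteq> 0 \<and> (\<forall>p\<in>P. \<forall>r\<in>R. L p r holomorphic_on UNIV) \<and>
    (\<forall>x. \<forall>p\<in>P. \<forall>q\<in>P. (\<Sum>r\<in>R. L p r x * A r q x) = (if p = q then d x else 0))" by (elim exE)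
  hence d: "d holomorphic_on UNIV" "d x0 \<noteq> 0"
    and L: "\<And>p r. p \<in> P \<Longrightarrow> r \<in> R \<Longrightarrow> L p r holomorphic_on UNIV"
    and LA: "\<And>x p q. p \<in> P \<Longrightarrow> q \<in> P \<Longrightarrow> (\<Sum>r\<in>R. L p r x * A r q x) = (if p = q then d x else 0)" by simp_all
  \<comment> \<open>d times what is left of column t after eliminating the columns in P.\<close>
  define W where "W r x = d x * A r t x - (\<Sum>p\<in>P. A r p x * (\<Sum>s\<in>R. L p s x * A s t x))" for r x
  have "\<exists>r\<in>R. W r x0 \<noteq> 0"
  proof (rule ccontr)
    assume "\<not> ?thesis"
    hence W0: "W r x0 = 0" if "r \<in> R" for r using that by auto
    \<comment> \<open>If the residual vanished at x0, this would be a kernel vector with the nonzero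
      entry \<open>d x0\<close> at t.\<close>
    define v where "v p = (if p = t then d x0 else - (\<Sum>s\<in>R. L p s x0 * A s t x0))" for p
    have "\<forall>p\<in>insert t P. v p = 0"
    proof (rule insert.prems(2))
      fix r assume "r \<in> R"
      have "(\<Sum>p\<in>P. A r p x0 * v p) = - (\<Sum>p\<in>P. A r p x0 * (\<Sum>s\<in>R. L p s x0 * A s t x0))"
        unfolding sum_negf[symmetric] using insert.hyps by (intro sum.cong) (auto simp: v_def)
      thus "(\<Sum>p\<in>insert t P. A r p x0 * v p) = 0"
        using W0[OF \<open>r \<in> R\<close>] insert.hyps by (simp add: v_def W_def mult.commute)
    qed
    thus False using d by (auto simp: v_def)
  qed
  then obtain r0 where r0: "r0 \<in> R" "W r0 x0 \<noteq> 0" by blast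
  have holA: "A r p holomorphic_on UNIV" if "r \<in> R" "p \<in> insert t P" for r p
    using insert.prems(1) that by blast
  \<comment> \<open>A row functional that annihilates all columns in P and takes the value
    \<open>W r0\<close> on column t.\<close>
  define ell where "ell s x = (if s = r0 then d x else 0) - (\<Sum>p\<in>P. A r0 p x * L p s x)" for s x
  have hol_ell: "ell s holomorphic_on UNIV" if "s \<in> R" for s
    unfolding ell_def using that r0 by (cases "s = r0") (auto intro!: holomorphic_intros d holA L)
  have hol_W: "W r0 holomorphic_on UNIV"
    unfolding W_def using r0 by (auto intro!: holomorphic_intros d holA L)
  have ell_A: "(\<Sum>s\<in>R. ell s x * A s q x) = d x * A r0 q x - (\<Sum>p\<in>P. A r0 p x * (\<Sum>s\<in>R. L p s x * A s q x))" for q x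
  proof -
    have "(\<Sum>s\<in>R. ell s x * A s q x) = (\<Sum>s\<in>R. (if s = r0 then d x * A s q x else 0)) - (\<Sum>s\<in>R. \<Sum>p\<in>P. A r0 p x * L p s x * A s q x)"
      unfolding sum_subtractf[symmetric] by (intro sum.cong) (auto simp: ell_def left_diff_distrib sum_distrib_right)
    also have "(\<Sum>s\<in>R. (if s = r0 then d x * A s q x else 0)) = d x * A r0 q x" using r0 assms(2) by simp
    also have "(\<Sum>s\<in>R. \<Sum>p\<in>P. A r0 p x * L p s x * A s q x) = (\<Sum>p\<in>P. A r0 p x * (\<Sum>s\<in>R. L p s x * A s q x))"
      by (subst sum.swap) (simp add: sum_distrib_left mult.assoc)
    finally show ?thesis .
  qed
  have ell_P: "(\<Sum>s\<in>R. ell s x * A s q x) = 0" if "q \<in> P" for q x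
  proof -
    have "(\<Sum>p\<in>P. A r0 p x * (\<Sum>s\<in>R. L p s x * A s q x)) = (\<Sum>p\<in>P. if p = q then A r0 p x * d x else 0)"
      using that by (intro sum.cong) (auto simp: LA)
    also have "\<dots> = A r0 q x * d x" using that insert.hyps by simp
    finally show ?thesis by (simp add: ell_A)
  qed
  have ell_t: "(\<Sum>s\<in>R. ell s x * A s t x) = W r0 x" for x by (simp add: ell_A W_def)
  \<comment> \<open>Block elimination: the old rows are corrected by a multiple of
    \<open>ell\<close> so that they annihilate column t, and all rows are scaled to the common
    diagonal value \<open>d x * W r0 x\<close>.\<close>
  define L' where "L' p s x = (if p = t then d x * ell s x
      else W r0 x * L p s x - (\<Sum>r\<in>R. L p r x * A r t x) * ell s x)" for p s x
  have L'A: "(\<Sum>s\<in>R. L' p s x * A s q x) = (if p = t then d x * (\<Sum>s\<in>R. ell s x * A s q x) else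
     W r0 x * (\<Sum>s\<in>R. L p s x * A s q x) - (\<Sum>r\<in>R. L p r x * A r t x) * (\<Sum>s\<in>R. ell s x * A s q x))" for p q x
    by (simp add: L'_def sum_distrib_left mult.assoc left_diff_distrib sum_subtractf)
  show ?case
  proof (intro exI[of _ L'] exI[of _ "\<lambda>x. d x * W r0 x"] conjI ballI allI)
    show "(\<lambda>x. d x * W r0 x) holomorphic_on UNIV" by (intro holomorphic_intros d hol_W)
    show "d x0 * W r0 x0 \<noteq> 0" using d r0 by simp
    fix p s assume p: "p \<in> insert t P" and s: "s \<in> R"
    show "L' p s holomorphic_on UNIV"
    proof (cases "p = t")
      case True
      hence "L' p s = (\<lambda>x. d x * ell s x)" by (auto simp: L'_def)
      then show ?thesis using hol_ell[OF s] d by (auto intro!: holomorphic_intros)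
    next
      case False
      hence "L' p s = (\<lambda>x. W r0 x * L p s x - (\<Sum>r\<in>R. L p r x * A r t x) * ell s x)" by (auto simp: L'_def)
      then show ?thesis using hol_ell[OF s] d hol_W p s False by (auto intro!: holomorphic_intros L holA)
    qed
  next
    fix x p q assume "p \<in> insert t P" "q \<in> insert t P"
    thus "(\<Sum>r\<in>R. L' p r x * A r q x) = (if p = q then d x * W r0 x else 0)"
      using insert.hyps by (auto simp: L'A ell_P ell_t LA)
  qed
qed

section \<open>The recurrence along an orbit of the rotation\<close>

lemma coeff_prod_linear_0:
  fixes z :: "'a \<Rightarrow> complex"
  assumes "finite L"
  shows "coeff (\<Prod>l\<in>L. [:1, - z l:]) 0 = 1"
  using assms by (induction L rule: finite_induct) (auto simp: coeff_mult)

lemma coeff_prod_linear_1: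
  fixes z :: "'a \<Rightarrow> complex"
  assumes "finite L"
  shows "coeff (\<Prod>l\<in>L. [:1, - z l:]) (Suc 0) = - (\<Sum>l\<in>L. z l)"
  using assms
  by (induction L rule: finite_induct) (auto simp: coeff_prod_linear_0)

lemma frac_add_eq: "frac (x + y) = frac x + frac y" if "frac x + frac y < (1::real)" for x y
  using that by (simp add: frac_add)

text \<open>Switches between a band sum over the offset i and a sum over all columns p of a window;
  since g vanishes for offsets from N on, columns outside the band contribute nothing.\<close>

lemma sum_window_reindex:
  fixes g :: "nat \<Rightarrow> int \<Rightarrow> 'a :: comm_monoid_add"
  assumes "N > 0" "0 \<le> r" "r \<le> J" and "\<And>i p. i \<ge> N \<Longrightarrow> g i p = 0"
  shows "(\<Sum>p\<in>{1 - int N..J}. if p \<le> r then g (nat (r - p)) p else 0) = (\<Sum>i<N. g i (r - int i))"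
proof -
  have "(\<Sum>i<N. g i (r - int i)) = (\<Sum>p\<in>(\<lambda>i. r - int i) ` {..<N}. g (nat (r - p)) p)"
    by (subst sum.reindex) (auto simp: inj_on_def)
  also have "\<dots> = (\<Sum>p\<in>(\<lambda>i. r - int i) ` {..<N}. if p \<le> r then g (nat (r - p)) p else 0)"
    by (intro sum.cong) auto
  also have "\<dots> = (\<Sum>p\<in>{1 - int N..J}. if p \<le> r then g (nat (r - p)) p else 0)"
  proof (intro sum.mono_neutral_left ballI)
    fix p assume p: "p \<in> {1 - int N..J} - (\<lambda>i. r - int i) ` {..<N}"
    have "nat (r - p) \<ge> N" if "p \<le> r"
    proof (rule ccontr)
      assume "\<not> nat (r - p) \<ge> N"
      hence "p \<in> (\<lambda>i. r - int i) ` {..<N}" using that by (intro image_eqI[of _ _ "nat (r - p)"]) auto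
      thus False using p by simp
    qed
    thus "(if p \<le> r then g (nat (r - p)) p else 0) = 0" using assms(4) by auto
  qed (use assms in auto)
  finally show ?thesis by simp
qed

section \<open>Setup with modulation step 1: the banded matrix produced by the difference
  operator\<close>

locale rational_window =
  fixes N :: nat and a w :: "nat \<Rightarrow> complex" and \<alpha> :: real
  assumes a_nz: "\<And>k. k < N \<Longrightarrow> a k \<noteq> 0"
    and w_re: "\<And>k. k < N \<Longrightarrow> Re (w k) \<noteq> 0"
    and w_distinct: "\<And>k l. k < N \<Longrightarrow> l < N \<Longrightarrow> k \<noteq> l \<Longrightarrow> Re (w k) \<noteq> Re (w l)"
    and m0: "\<And>\<xi>::real. \<xi> > 0 \<Longrightarrow> (\<Sum>k<N. a k * exp (2 * pi * complex_of_real \<xi> * w k)) \<noteq> 0"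
    and \<alpha>: "0 < \<alpha>" "\<alpha> < 1" and irr: "\<alpha> \<notin> \<rat>"
begin

definition T :: real where "T = 1 / \<alpha>"
text \<open>The factor that the k-th exponential of the window transform gains under a shift by 1;
  difference operators annihilating these exponentials are therefore products of factors 1 - z
  X.\<close>

definition z :: "nat \<Rightarrow> complex" where "z l = exp (2 * pi * w l)"
definition q :: "nat \<Rightarrow> nat \<Rightarrow> complex" where "q k i = coeff (\<Prod>l\<in>{..<N} - {k}. [:1, - z l:]) i"
text \<open>Up to the factor -2 pi i, the value at i + x with 0 <= x < 1 of the window transform
  after the difference operator. The polynomial for k omits its own factor because the k-th
  exponential jumps at 0. \<open>M 0\<close> is the function m0 of the theorem.\<close>

definition M :: "nat \<Rightarrow> complex \<Rightarrow> complex" where "M i x = (\<Sum>k<N. a k * exp (2 * of_real pi * x * w k) * q k i)"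

text \<open>The points \<open>\<eta> + pT\<close> with integer \<open>p\<close> have spacing \<open>T > 1\<close>. The distance from the integer \<open>r\<close> to the next
  point above it is \<open>rho \<eta> r\<close>, so the cell \<open>[r, r + 1)\<close> contains a point iff \<open>rho \<eta> r < 1\<close>. A coefficient
  sequence on the points is encoded as a sequence on the cells that vanishes on the empty ones.\<close>
definition rho :: "real \<Rightarrow> int \<Rightarrow> real" where "rho \<eta> r = T * frac (\<alpha> * (\<eta> - of_int r))"
definition H :: "real \<Rightarrow> (int \<Rightarrow> complex) \<Rightarrow> int \<Rightarrow> complex" where
  "H \<eta> c n = (\<Sum>i<N. M i (of_real (rho \<eta> (n + int i))) * c (n + int i))"
definition admissible :: "real \<Rightarrow> (int \<Rightarrow> complex) \<Rightarrow> bool" where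
  "admissible \<eta> c \<longleftrightarrow> (\<forall>r. rho \<eta> r \<ge> 1 \<longrightarrow> c r = 0)"

lemma T: "T > 1" "T > 0" "\<alpha> * T = 1" "T * \<alpha> = 1"
  using \<alpha> by (auto simp: T_def field_simps)

lemma N_pos: "N > 0"
  using m0[of 1] by (cases N) auto

lemma z_nz: "z l \<noteq> 0" by (simp add: z_def)

lemma norm_z: "norm (z l) = exp (2 * pi * Re (w l))"
  by (simp add: z_def)

lemma inj_norm_z: "inj_on (\<lambda>l. norm (z l)) {..<N}"
  using w_distinct by (auto simp: inj_on_def norm_z)

lemma q_0: "q k 0 = 1"
  by (simp add: q_def coeff_prod_linear_0)

lemma q_ge: "q k i = 0" if "k < N" "i \<ge> N"
proof -
  have "degree (\<Prod>l\<in>{..<N} - {k}. [:1, - z l:]) \<le> card ({..<N} - {k})" by (rule degree_prod_linear) auto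
  also have "\<dots> < N" using that by simp
  finally show ?thesis using that unfolding q_def by (intro coeff_eq_0) simp
qed

lemma M_ge: "M i x = 0" if "i \<ge> N"
  using that by (auto simp: M_def q_ge intro!: sum.neutral)

lemma M_0: "M 0 x = (\<Sum>k<N. a k * exp (2 * of_real pi * x * w k))"
  by (simp add: M_def q_0)

lemma M_0_nz: "\<xi> > 0 \<Longrightarrow> M 0 (of_real \<xi>) \<noteq> 0"
  using m0[of \<xi>] by (simp add: M_0)

text \<open>The linear coefficient with factor k omitted is \<open>z k\<close> minus the sum of all
  \<open>z l\<close>, and the weight \<open>z k\<close> turns a value at 0 into one at 1. If m0
  vanishes at 0, this shows that \<open>M 1\<close> does not.\<close>

lemma M_1_0: "M (Suc 0) 0 = M 0 1 - M 0 0 * (\<Sum>l<N. z l)"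
proof -
  have "M (Suc 0) 0 = (\<Sum>k<N. a k * (z k - (\<Sum>l<N. z l)))"
    unfolding M_def by (intro sum.cong refl) (simp add: q_def coeff_prod_linear_1 sum_diff1)
  also have "\<dots> = (\<Sum>k<N. a k * z k) - (\<Sum>k<N. a k) * (\<Sum>l<N. z l)"
    by (simp add: right_diff_distrib sum_subtractf sum_distrib_right)
  finally show ?thesis by (simp add: M_0 z_def)
qed

lemma M_holomorphic: "(\<lambda>x. M i (f x)) holomorphic_on UNIV" if "f holomorphic_on UNIV"
  unfolding M_def using that by (intro holomorphic_intros)

lemma continuous_on_M [continuous_intros]:
  "continuous_on S f \<Longrightarrow> continuous_on S (\<lambda>x. M i (f x))"
  unfolding M_def by (intro continuous_intros)

lemma rho_bounds: "0 \<le> rho \<eta> r" "rho \<eta> r < T"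
  using T by (auto simp: rho_def frac_lt_1)

text \<open>Going down one cell raises the distance by 1 modulo T, and below T - 1 nothing wraps
  around. The new distance is at least 1, so cell r - 1 is then empty.\<close>

lemma rho_pred: "rho \<eta> (r - 1) = rho \<eta> r + 1" if "rho \<eta> r < T - 1"
proof -
  have fa: "frac \<alpha> = \<alpha>" using \<alpha> by (simp add: frac_eq)
  have "T * frac (\<alpha> * (\<eta> - of_int r)) < T * (1 - \<alpha>)" using that T by (simp add: rho_def right_diff_distrib)
  hence "frac (\<alpha> * (\<eta> - of_int r)) + frac \<alpha> < 1" using T fa by simp
  from frac_add_eq[OF this] have "frac (\<alpha> * (\<eta> - of_int (r - 1))) = frac (\<alpha> * (\<eta> - of_int r)) + \<alpha>"
    by (simp add: fa algebra_simps)
  thus ?thesis using T by (simp add: rho_def ring_distribs)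
qed

text \<open>The leading coefficient may vanish at 0. But if \<open>rho \<eta> r\<close> is small, then the cell \<open>r - 1\<close> is empty and
  row \<open>r - 1\<close> determines \<open>c r\<close> with the coefficient \<open>M 1\<close>, which is \<open>m\<^sub>0(1)\<close> at 0 if \<open>m\<^sub>0(0) = 0\<close>.\<close>
lemma descent_step:
  "\<exists>C\<ge>1. \<forall>\<eta> c r E. admissible \<eta> c \<longrightarrow> (\<forall>s\<in>{r+1..r+int N-1}. norm (c s) \<le> E) \<longrightarrow> E \<ge> 0 \<longrightarrow>
     norm (H \<eta> c r) \<le> E \<longrightarrow> norm (H \<eta> c (r-1)) \<le> E \<longrightarrow> norm (c r) \<le> C * E"
proof -
  \<comment> \<open>The cut-off factor continuously switches off the contribution of row r - 1 where
    cell r - 1 need not be empty; continuity provides a positive minimum on [0,1].\<close>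
  define \<phi> where "\<phi> \<xi> = norm (M 0 (of_real \<xi>)) + norm (M (Suc 0) (of_real \<xi>)) * max 0 (T - 1 - \<xi>)" for \<xi> :: real
  have "continuous_on {0..1} \<phi>" unfolding \<phi>_def by (intro continuous_intros)
  then obtain \<xi>0 where \<xi>0: "\<xi>0 \<in> {0..1}" "\<And>\<xi>. \<xi> \<in> {0..1} \<Longrightarrow> \<phi> \<xi>0 \<le> \<phi> \<xi>"
    using continuous_attains_inf[of "{0..1::real}" \<phi>] by auto
  define \<delta> where "\<delta> = \<phi> \<xi>0"
  have \<delta>: "\<delta> > 0"
  proof (cases "M 0 (of_real \<xi>0) = 0")
    case True
    hence "\<xi>0 = 0" using M_0_nz[of \<xi>0] \<xi>0 by force
    hence "M (Suc 0) (of_real \<xi>0) \<noteq> 0" using True M_1_0 M_0_nz[of 1] by auto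
    thus ?thesis using T(1) \<open>\<xi>0 = 0\<close> by (auto simp: \<delta>_def \<phi>_def intro!: add_nonneg_pos)
  next
    case False
    thus ?thesis by (auto simp: \<delta>_def \<phi>_def intro!: add_pos_nonneg)
  qed
  have "\<exists>B. \<forall>\<xi>\<in>{0..1}. norm (M i (of_real \<xi>)) \<le> B" for i
  proof -
    have "compact ((\<lambda>\<xi>. M i (complex_of_real \<xi>)) ` {0..1})"
      by (intro compact_continuous_image continuous_intros) auto
    from compact_imp_bounded[OF this] show ?thesis unfolding bounded_iff by auto
  qed
  then obtain B where B: "\<And>i \<xi>. 0 \<le> \<xi> \<Longrightarrow> \<xi> \<le> 1 \<Longrightarrow> norm (M i (of_real \<xi>)) \<le> B i" by (metis atLeastAtMost_iff)
  have B0: "0 \<le> B i" for i using B[of 0 i] by (meson norm_ge_zero order_refl order_trans zero_le_one)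
  define D where "D = 1 + (\<Sum>i<N. B i)"
  have D1: "D \<ge> 1" using B0 by (auto simp: D_def intro!: sum_nonneg)
  \<comment> \<open>The summand 1 in D pays for the given row value, the rest for the entries
    already bounded. The factor 1 + T combines the two rows, the cut-off being at most T.\<close>
  define C where "C = max 1 ((1 + T) * D / \<delta>)"
  have "norm (c r) \<le> C * E"
    if adm: "admissible \<eta> c" and cE: "\<And>s. s \<in> {r+1..r+int N-1} \<Longrightarrow> norm (c s) \<le> E" and E: "E \<ge> 0"
      and H0: "norm (H \<eta> c r) \<le> E" and H1: "norm (H \<eta> c (r-1)) \<le> E" for \<eta> c r E
  proof (cases "rho \<eta> r \<ge> 1")
    case True
    thus ?thesis using adm E by (auto simp: admissible_def C_def)
  next
    case False
    define \<xi> where "\<xi> = rho \<eta> r"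
    have \<xi>: "0 \<le> \<xi>" "\<xi> < 1" using False rho_bounds by (auto simp: \<xi>_def)
    have term_le: "norm (M i (of_real (rho \<eta> s)) * c s) \<le> B i * E" if "s \<in> {r+1..r+int N-1}" for i s
    proof (cases "rho \<eta> s \<ge> 1")
      case True
      thus ?thesis using adm E B0 by (auto simp: admissible_def)
    next
      case F: False
      thus ?thesis using cE[OF that] B[of "rho \<eta> s" i] rho_bounds[of \<eta> s] B0
        by (auto simp: norm_mult intro!: mult_mono)
    qed
    have est: "norm (\<Sum>i\<in>I. M i (of_real (rho \<eta> (n + int i))) * c (n + int i)) \<le> (D - 1) * E"
      if "I \<subseteq> {..<N}" "\<And>i. i \<in> I \<Longrightarrow> n + int i \<in> {r+1..r+int N-1}" for I n
    proof -
      have "norm (\<Sum>i\<in>I. M i (of_real (rho \<eta> (n + int i))) * c (n + int i)) \<le> (\<Sum>i\<in>I. B i * E)"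
        by (intro sum_norm_le term_le that)
      also have "\<dots> \<le> (\<Sum>i<N. B i * E)" using that B0 E by (intro sum_mono2) auto
      finally show ?thesis by (simp add: D_def sum_distrib_right)
    qed
    have sp: "{..<N} = insert 0 {1..<N}" using N_pos by auto
    have "H \<eta> c r = M 0 (of_real \<xi>) * c r + (\<Sum>i\<in>{1..<N}. M i (of_real (rho \<eta> (r + int i))) * c (r + int i))"
      unfolding H_def sp by (subst sum.insert) (auto simp: \<xi>_def)
    moreover have "norm (\<Sum>i\<in>{1..<N}. M i (of_real (rho \<eta> (r + int i))) * c (r + int i)) \<le> (D - 1) * E"
      by (intro est) auto
    ultimately have b0: "norm (M 0 (of_real \<xi>) * c r) \<le> D * E"
      using H0 norm_diff_ineq[of "M 0 (of_real \<xi>) * c r"] by (smt (verit) left_diff_distrib mult_cancel_right1)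
    have b1: "norm (M (Suc 0) (of_real \<xi>) * c r) \<le> D * E" if lt: "\<xi> < T - 1"
    proof (cases "N = 1")
      case True
      thus ?thesis using D1 E M_ge[of "Suc 0"] by simp
    next
      case False
      hence N2: "N \<ge> 2" using N_pos by linarith
      have "rho \<eta> (r - 1) \<ge> 1" using rho_pred lt \<xi> by (simp add: \<xi>_def)
      hence c0: "c (r - 1) = 0" using adm by (auto simp: admissible_def)
      have sp: "{..<N} = insert 0 (insert (Suc 0) {2..<N})" using N2 by auto
      have "H \<eta> c (r - 1) = M (Suc 0) (of_real \<xi>) * c r +
          (\<Sum>i\<in>{2..<N}. M i (of_real (rho \<eta> (r - 1 + int i))) * c (r - 1 + int i))"
        unfolding H_def sp using c0 by (subst sum.insert, simp, simp, subst sum.insert) (auto simp: \<xi>_def)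
      moreover have "norm (\<Sum>i\<in>{2..<N}. M i (of_real (rho \<eta> (r - 1 + int i))) * c (r - 1 + int i)) \<le> (D - 1) * E"
        by (intro est) auto
      ultimately show ?thesis
        using H1 norm_diff_ineq[of "M (Suc 0) (of_real \<xi>) * c r"] by (smt (verit) left_diff_distrib mult_cancel_right1)
    qed
    have b2: "norm (M (Suc 0) (of_real \<xi>) * c r) * max 0 (T - 1 - \<xi>) \<le> T * (D * E)"
    proof (cases "\<xi> < T - 1")
      case True
      have "norm (M (Suc 0) (of_real \<xi>) * c r) * max 0 (T - 1 - \<xi>) \<le> (D * E) * T"
        using b1[OF True] \<xi> T E D1 by (intro mult_mono) auto
      thus ?thesis by (simp add: mult.commute)
    next
      case False
      thus ?thesis using T E D1 by simp
    qed
    have "\<delta> * norm (c r) \<le> \<phi> \<xi> * norm (c r)"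
      using \<xi>0(2)[of \<xi>] \<xi> by (intro mult_right_mono) (auto simp: \<delta>_def)
    also have "\<dots> \<le> D * E + T * (D * E)"
      using b0 b2 by (simp add: \<phi>_def ring_distribs norm_mult mult_ac)
    finally have "norm (c r) \<le> (1 + T) * D / \<delta> * E" using \<delta> by (simp add: field_simps)
    also have "\<dots> \<le> C * E" using E by (intro mult_right_mono) (auto simp: C_def)
    finally show ?thesis .
  qed
  thus ?thesis by (intro exI[of _ C]) (auto simp: C_def)
qed


section \<open>Unique solvability of the recurrence on a long window\<close>

definition gap :: "int \<Rightarrow> real" where "gap j = T * frac (\<alpha> * of_int j)"

lemma gap_bounds: "0 \<le> gap j" "gap j < T"
  using T by (auto simp: gap_def frac_lt_1)

text \<open>\<open>gap j\<close> is the value of rho at cell -j for \<eta> = 0. Seen from a cell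
  with small rho, the surrounding cells show this reference pattern, shifted rigidly until T is
  reached.\<close>

lemma rho_diff: "rho \<eta> (r - j) = gap j + rho \<eta> r" if "gap j + rho \<eta> r < T"
proof -
  have "T * (frac (\<alpha> * of_int j) + frac (\<alpha> * (\<eta> - of_int r))) < T * 1"
    using that by (simp add: gap_def rho_def ring_distribs)
  hence "frac (\<alpha> * of_int j) + frac (\<alpha> * (\<eta> - of_int r)) < 1" using T by (simp only: mult_less_cancel_left_pos)
  from frac_add_eq[OF this] show ?thesis
    by (simp add: gap_def rho_def ring_distribs[symmetric]) (simp add: algebra_simps)
qed

text \<open>\<open>gap j \<ge> 1\<close> says that \<open>frac (\<alpha> * j)\<close> lies in
  [\<alpha>, 1), an interval to which the irrational rotation keeps returning. The offset m turns
  signed cell indices into natural numbers.\<close>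

lemma infinite_gaps: "infinite {s::nat. s \<ge> m \<and> gap (int s - int m) \<ge> 1}"
proof -
  obtain K where K: "\<And>\<theta>. \<exists>k\<le>K. frac (\<theta> + real k * \<alpha>) \<in> {\<alpha><..<1}"
    using irrational_rotation_hits[OF irr, of \<alpha> 1] \<alpha> by auto
  show ?thesis unfolding infinite_nat_iff_unbounded_le
  proof
    fix n
    obtain k where k: "frac (real n * \<alpha> + real k * \<alpha>) \<in> {\<alpha><..<1}" using K by blast
    have "gap (int (n + k + m) - int m) = T * frac (real n * \<alpha> + real k * \<alpha>)"
      by (simp add: gap_def algebra_simps)
    also have "\<dots> \<ge> T * \<alpha>" using k T by (intro mult_left_mono) auto
    finally have "gap (int (n + k + m) - int m) \<ge> 1" using T by simp
    thus "\<exists>s\<ge>n. s \<in> {s. s \<ge> m \<and> gap (int s - int m) \<ge> 1}" by (intro exI[of _ "n + k + m"]) auto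
  qed
qed

definition dominant :: nat where
  "dominant = (SOME k. k < N \<and> (\<forall>l<N. Re (w l) \<le> Re (w k)))"

lemma dominant: "dominant < N" "l < N \<Longrightarrow> l \<noteq> dominant \<Longrightarrow> Re (w l) < Re (w dominant)"
proof -
  have "\<exists>k. k < N \<and> (\<forall>l<N. Re (w l) \<le> Re (w k))"
  proof -
    have "Max ((\<lambda>k. Re (w k)) ` {..<N}) \<in> (\<lambda>k. Re (w k)) ` {..<N}"
      using N_pos by (intro Max_in) auto
    then obtain k where "k < N" "Max ((\<lambda>k. Re (w k)) ` {..<N}) = Re (w k)" by auto
    moreover have "Re (w l) \<le> Max ((\<lambda>k. Re (w k)) ` {..<N})" if "l < N" for l
      using that by (intro Max_ge) auto
    ultimately have "k < N \<and> (\<forall>l<N. Re (w l) \<le> Re (w k))" by simp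
    thus ?thesis by blast
  qed
  from someI_ex[OF this] have d: "dominant < N" "\<And>l. l < N \<Longrightarrow> Re (w l) \<le> Re (w dominant)"
    unfolding dominant_def by blast+
  thus "dominant < N" by blast
  assume "l < N" "l \<noteq> dominant"
  thus "Re (w l) < Re (w dominant)" using d w_distinct[of l dominant] by force
qed

text \<open>Distinct real parts make every other summand exponentially smaller. The surviving
  coefficients belong to the polynomial without the dominant factor, so the limiting recurrence has
  only the other N - 1 bases.\<close>

lemma M_asymptotics:
  "((\<lambda>y. M i (of_real y) * exp (- (2 * of_real pi * of_real y * w dominant))) \<longlongrightarrow> a dominant * q dominant i) at_top"
proof -
  have *: "((\<lambda>y. a k * exp (2 * of_real pi * of_real y * (w k - w dominant)) * q k i) \<longlongrightarrow>
          (if k = dominant then a dominant * q dominant i else 0)) at_top" if "k < N" for k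
  proof (cases "k = dominant")
    case False
    define b where "b = Re (w dominant) - Re (w k)"
    have b: "b > 0" using dominant(2)[OF that False] by (simp add: b_def)
    have "((\<lambda>y. exp (- (2 * pi * b) * y)) \<longlongrightarrow> (0::real)) at_top"
      using b by real_asymp
    hence "((\<lambda>y. norm (exp (2 * of_real pi * of_real y * (w k - w dominant)))) \<longlongrightarrow> 0) at_top"
      by (simp add: b_def algebra_simps)
    hence "((\<lambda>y. exp (2 * of_real pi * of_real y * (w k - w dominant))) \<longlongrightarrow> 0) at_top"
      by (rule tendsto_norm_zero_cancel)
    hence "((\<lambda>y. a k * exp (2 * of_real pi * of_real y * (w k - w dominant)) * q k i) \<longlongrightarrow> a k * 0 * q k i) at_top"
      by (intro tendsto_intros)
    thus ?thesis using False by simp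
  qed simp
  have "((\<lambda>y. \<Sum>k<N. a k * exp (2 * of_real pi * of_real y * (w k - w dominant)) * q k i) \<longlongrightarrow>
          (\<Sum>k<N. if k = dominant then a dominant * q dominant i else 0)) at_top"
    by (intro tendsto_sum *) simp
  moreover have "(\<Sum>k<N. if k = dominant then a dominant * q dominant i else 0) = a dominant * q dominant i"
    using dominant(1) by simp
  moreover have "(\<Sum>k<N. a k * exp (2 * of_real pi * of_real y * (w k - w dominant)) * q k i) =
      M i (of_real y) * exp (- (2 * of_real pi * of_real y * w dominant))" for y :: real
    unfolding M_def sum_distrib_right
    by (intro sum.cong refl) (simp add: right_diff_distrib exp_diff exp_minus field_simps)
  ultimately show ?thesis by simp
qed

text \<open>Columns and rows are counted downwards: index \<open>p\<close> stands for the cell \<open>r0 - p\<close>.\<close>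
definition cols :: "nat \<Rightarrow> int set" where "cols J = {p\<in>{1 - int N..int J}. gap p < 1}"
definition limit_mat :: "int \<Rightarrow> int \<Rightarrow> complex" where
  "limit_mat r p = (if p \<le> r then a dominant * q dominant (nat (r - p)) else 0)"
definition window_mat :: "int \<Rightarrow> int \<Rightarrow> complex \<Rightarrow> complex" where
  "window_mat r p x = (if p \<le> r then M (nat (r - p)) (of_real (gap p) + x) else 0)"

lemma finite_cols: "finite (cols J)"
  by (rule finite_subset[of _ "{1 - int N..int J}"]) (auto simp: cols_def)

text \<open>A kernel vector, extended by 0 to the empty cells, solves the limiting recurrence and is
  thus an exponential sum with N - 1 bases of distinct moduli that vanishes at every empty cell. J
  is taken so large that the window contains enough of them.\<close>

lemma limit_mat_injective:
  "\<exists>J. \<forall>v. (\<forall>r\<in>{0..int J}. (\<Sum>p\<in>cols J. limit_mat r p * v p) = 0) \<longrightarrow> (\<forall>p\<in>cols J. v p = 0)"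
proof -
  define L where "L = {..<N} - {dominant}"
  have cL: "card L = N - 1" using dominant(1) by (simp add: L_def)
  define Z where "Z = {s::nat. s \<ge> N - 1 \<and> gap (int s - int (N - 1)) \<ge> 1}"
  have "\<exists>Z'\<subseteq>Z. finite Z' \<and> (\<forall>c. (\<forall>j\<in>Z'. (\<Sum>l\<in>L. c l * z l ^ j) = 0) \<longrightarrow> (\<forall>l\<in>L. c l = 0))"
    using inj_norm_z infinite_gaps[of "N - 1"]
    by (intro exponential_sum_zeros) (auto simp: L_def Z_def z_nz inj_on_def)
  then obtain Z' where Z': "Z' \<subseteq> Z" "finite Z'"
    "\<And>c. (\<forall>j\<in>Z'. (\<Sum>l\<in>L. c l * z l ^ j) = 0) \<Longrightarrow> (\<forall>l\<in>L. c l = 0)" by blast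
  define J where "J = Max (insert 0 Z')"
  have J: "s \<le> J" if "s \<in> Z'" for s using that Z'(2) by (auto simp: J_def)
  have "\<forall>p\<in>cols J. v p = 0" if v: "\<forall>r\<in>{0..int J}. (\<Sum>p\<in>cols J. limit_mat r p * v p) = 0" for v
  proof -
    define vv where "vv p = (if p \<in> cols J then v p else 0)" for p
    \<comment> \<open>The first column 1 - N becomes index 0; N - 1 is also the order of the
      recurrence.\<close>
    define u where "u s = vv (int s - int (N - 1))" for s
    have rec: "(\<Sum>i<N. q dominant i * vv (r - int i)) = 0" if r: "r \<in> {0..int J}" for r
    proof -
      have "(\<Sum>i<N. a dominant * q dominant i * vv (r - int i)) =
          (\<Sum>p\<in>{1 - int N..int J}. if p \<le> r then a dominant * q dominant (nat (r - p)) * vv p else 0)"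
        using r N_pos dominant(1) by (subst sum_window_reindex) (auto simp: q_ge)
      also have "\<dots> = (\<Sum>p\<in>{1 - int N..int J}. if p \<in> cols J then limit_mat r p * v p else 0)"
        by (intro sum.cong) (auto simp: vv_def limit_mat_def)
      also have "\<dots> = (\<Sum>p\<in>cols J. limit_mat r p * v p)"
        by (subst sum.inter_restrict[symmetric]) (auto simp: cols_def intro!: sum.cong)
      finally have "a dominant * (\<Sum>i<N. q dominant i * vv (r - int i)) = 0"
        using v r by (simp add: sum_distrib_left mult.assoc)
      thus ?thesis using a_nz[OF dominant(1)] by simp
    qed
    have "\<exists>c. \<forall>s\<le>J + card L. u s = (\<Sum>l\<in>L. c l * z l ^ s)"
    proof (rule linear_recurrence_solution)
      show "finite L" by (simp add: L_def)
      show "inj_on z L" using inj_norm_z by (auto simp: inj_on_def L_def)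
      fix s assume s: "s \<le> J"
      have "(\<Sum>i\<le>card L. coeff (\<Prod>l\<in>L. [:1, - z l:]) i * u (s + card L - i)) =
          (\<Sum>i<N. q dominant i * vv (int s - int i))"
      proof (intro sum.cong)
        show "{..card L} = {..<N}" using N_pos by (auto simp: cL)
        fix i assume "i \<in> {..<N}"
        hence "int (s + (N - 1) - i) - int (N - 1) = int s - int i" by auto
        thus "coeff (\<Prod>l\<in>L. [:1, - z l:]) i * u (s + card L - i) = q dominant i * vv (int s - int i)"
          unfolding u_def cL q_def L_def[symmetric] by (simp only:)
      qed
      thus "(\<Sum>i\<le>card L. coeff (\<Prod>l\<in>L. [:1, - z l:]) i * u (s + card L - i)) = 0"
        using rec[of "int s"] s by simp
    qed
    then obtain c where c: "\<And>s. s \<le> J + card L \<Longrightarrow> u s = (\<Sum>l\<in>L. c l * z l ^ s)" by blast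
    have "\<forall>l\<in>L. c l = 0"
    proof (rule Z'(3), intro ballI)
      fix j assume j: "j \<in> Z'"
      hence "j \<in> Z" using Z'(1) by blast
      hence "int j - int (N - 1) \<notin> cols J" by (auto simp: Z_def cols_def)
      hence "u j = 0" by (simp add: u_def vv_def)
      thus "(\<Sum>l\<in>L. c l * z l ^ j) = 0" using c[of j] J[OF j] by simp
    qed
    hence u0: "u s = 0" if "s \<le> J + card L" for s using c[OF that] by simp
    show ?thesis
    proof
      fix p assume p: "p \<in> cols J"
      hence pr: "1 - int N \<le> p" "p \<le> int J" by (auto simp: cols_def)
      have "u (nat (p + int (N - 1))) = 0" using pr N_pos by (intro u0) (simp add: cL)
      moreover have "int (nat (p + int (N - 1))) - int (N - 1) = p" using pr N_pos by simp
      ultimately show "v p = 0" using p by (simp add: u_def vv_def)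
    qed
  qed
  thus ?thesis by blast
qed

lemma window_mat_holomorphic: "window_mat r p holomorphic_on UNIV"
proof (cases "p \<le> r")
  case True
  hence "window_mat r p = (\<lambda>x. M (nat (r - p)) (of_real (gap p) + x))" by (auto simp: window_mat_def)
  thus ?thesis by (auto intro!: M_holomorphic holomorphic_intros)
next
  case False
  hence "window_mat r p = (\<lambda>x. 0)" by (auto simp: window_mat_def)
  thus ?thesis by simp
qed

text \<open>Rescaling the columns by the dominant exponential turns the matrix into its limit as x tends to
  infinity, so it is injective at some large x.\<close>
lemma window_mat_left_inverse:
  "\<exists>J L d x0. d holomorphic_on UNIV \<and> d x0 \<noteq> 0 \<and> (\<forall>p\<in>cols J. \<forall>r\<in>{0..int J}. L p r holomorphic_on UNIV) \<and>
    (\<forall>x. \<forall>p\<in>cols J. \<forall>p'\<in>cols J. (\<Sum>r\<in>{0..int J}. L p r x * window_mat r p' x) = (if p = p' then d x else 0))"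
proof -
  obtain J where J: "\<And>v. (\<forall>r\<in>{0..int J}. (\<Sum>p\<in>cols J. limit_mat r p * v p) = 0) \<Longrightarrow> (\<forall>p\<in>cols J. v p = 0)"
    using limit_mat_injective by blast
  define R where "R = {0..int J}"
  define P where "P = cols J"
  have fin: "finite P" "finite R" by (auto simp: P_def R_def finite_cols)
  \<comment> \<open>The limit matrix is constant; the analytic lemma is used here only to invert it,
    and just the values at 0 are kept.\<close>
  have "\<exists>L d. d holomorphic_on UNIV \<and> d 0 \<noteq> 0 \<and> (\<forall>p\<in>P. \<forall>r\<in>R. L p r holomorphic_on UNIV) \<and>
    (\<forall>x::complex. \<forall>p\<in>P. \<forall>p'\<in>P. (\<Sum>r\<in>R. L p r x * limit_mat r p') = (if p = p' then d x else 0))"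
    using fin J by (intro holomorphic_left_inverse) (auto simp: P_def R_def)
  then obtain L' d' where L': "d' (0::complex) \<noteq> (0::complex)"
     "\<forall>x::complex. \<forall>p\<in>P. \<forall>p'\<in>P. (\<Sum>r\<in>R. L' p r x * limit_mat r p') = (if p = p' then d' x else 0)" by blast
  define L where "L p r = L' p r 0" for p r
  define \<delta> where "\<delta> = d' 0"
  have \<delta>: "\<delta> \<noteq> 0" and L: "\<And>p p'. p \<in> P \<Longrightarrow> p' \<in> P \<Longrightarrow> (\<Sum>r\<in>R. L p r * limit_mat r p') = (if p = p' then \<delta> else 0)"
    using L' by (auto simp: L_def \<delta>_def)
  \<comment> \<open>The argument of M in column p is \<open>gap p\<close> + x in every row, so the
    growth depends on the column alone and column weights suffice.\<close>
  define D where "D p x = exp (- (2 * of_real pi * (of_real (gap p) + of_real x) * w dominant))" for p and x :: real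
  have lim: "((\<lambda>x. window_mat r p (of_real x) * D p x) \<longlongrightarrow> limit_mat r p) at_top" for r p
  proof (cases "p \<le> r")
    case True
    have "filterlim (\<lambda>x. gap p + x) at_top at_top" by real_asymp
    from filterlim_compose[OF M_asymptotics[of "nat (r - p)"] this] show ?thesis
      using True by (simp add: window_mat_def limit_mat_def D_def)
  qed (simp add: window_mat_def limit_mat_def)
  define C where "C p p' x = (\<Sum>r\<in>R. L p r * (window_mat r p' (of_real x) * D p' x))" for p p' x
  have C: "(C p p' \<longlongrightarrow> (if p = p' then \<delta> else 0)) at_top" if "p \<in> P" "p' \<in> P" for p p'
    unfolding L[OF that, symmetric] C_def[abs_def] by (intro tendsto_intros lim)
  \<comment> \<open>Entrywise errors below \<kappa> over \<open>card P\<close> columns add up to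
    less than \<open>norm \<delta>\<close>, so C stays injective by diagonal dominance.\<close>
  define \<kappa> where "\<kappa> = norm \<delta> / (real (card P) + 1)"
  have \<kappa>: "\<kappa> > 0" using \<delta> by (auto simp: \<kappa>_def)
  have "eventually (\<lambda>x. \<forall>p\<in>P. \<forall>p'\<in>P. dist (C p p' x) (if p = p' then \<delta> else 0) < \<kappa>) at_top"
    using C \<kappa> fin by (intro eventually_ball_finite ballI tendstoD) auto
  then obtain x0 where x0: "\<And>p p'. p \<in> P \<Longrightarrow> p' \<in> P \<Longrightarrow> dist (C p p' x0) (if p = p' then \<delta> else 0) < \<kappa>"
    unfolding eventually_at_top_linorder by blast
  have Dnz: "D p x \<noteq> 0" for p x by (simp add: D_def)
  have inj: "\<forall>p\<in>P. v p = 0" if v: "\<And>r. r \<in> R \<Longrightarrow> (\<Sum>p\<in>P. window_mat r p (of_real x0) * v p) = 0" for v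
  proof -
    define v' where "v' p = v p / D p x0" for p
    have Cv: "(\<Sum>p'\<in>P. C p p' x0 * v' p') = 0" for p
    proof -
      have "(\<Sum>p'\<in>P. C p p' x0 * v' p') = (\<Sum>p'\<in>P. \<Sum>r\<in>R. L p r * (window_mat r p' (of_real x0) * v p'))"
        unfolding C_def v'_def sum_distrib_right using Dnz by (intro sum.cong refl) simp
      also have "\<dots> = (\<Sum>r\<in>R. L p r * (\<Sum>p'\<in>P. window_mat r p' (of_real x0) * v p'))"
        by (subst sum.swap) (simp add: sum_distrib_left)
      also have "\<dots> = 0" using v by simp
      finally show ?thesis .
    qed
    define S where "S = (\<Sum>p\<in>P. norm (v' p))"
    have S0: "S \<ge> 0" by (auto simp: S_def intro: sum_nonneg)
    have "norm \<delta> * norm (v' p) \<le> \<kappa> * S" if p: "p \<in> P" for p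
    proof -
      have "\<delta> * v' p = (\<Sum>p'\<in>P. (if p = p' then \<delta> else 0) * v' p')" using p fin by (simp add: if_distrib[of "\<lambda>u. u * _"] cong: if_cong)
      also have "\<dots> = (\<Sum>p'\<in>P. ((if p = p' then \<delta> else 0) - C p p' x0) * v' p')"
        using Cv[of p] by (simp add: left_diff_distrib sum_subtractf)
      finally have "norm \<delta> * norm (v' p) = norm (\<Sum>p'\<in>P. ((if p = p' then \<delta> else 0) - C p p' x0) * v' p')"
        by (metis norm_mult)
      also have "\<dots> \<le> (\<Sum>p'\<in>P. \<kappa> * norm (v' p'))"
      proof (intro sum_norm_le)
        fix p' assume "p' \<in> P"
        hence "norm ((if p = p' then \<delta> else 0) - C p p' x0) \<le> \<kappa>"
          using x0[OF p] unfolding dist_norm by (metis norm_minus_commute less_imp_le)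
        thus "norm (((if p = p' then \<delta> else 0) - C p p' x0) * v' p') \<le> \<kappa> * norm (v' p')"
          by (simp only: norm_mult mult_right_mono norm_ge_zero)
      qed
      finally show ?thesis by (simp add: S_def sum_distrib_left)
    qed
    hence "(\<Sum>p\<in>P. norm \<delta> * norm (v' p)) \<le> (\<Sum>p\<in>P. \<kappa> * S)" by (intro sum_mono)
    hence "norm \<delta> * S \<le> real (card P) * \<kappa> * S" by (simp add: S_def sum_distrib_left mult.assoc)
    moreover have "real (card P) * \<kappa> < norm \<delta>" using \<delta> by (simp add: \<kappa>_def field_simps)
    ultimately have "S = 0" using S0 by (metis antisym_conv2 mult_less_cancel_right not_less order_le_less)
    hence "\<forall>p\<in>P. v' p = 0" using fin by (simp add: S_def sum_nonneg_eq_0_iff)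
    thus ?thesis using Dnz by (simp add: v'_def)
  qed
  have "\<exists>L d. d holomorphic_on UNIV \<and> d (complex_of_real x0) \<noteq> 0 \<and> (\<forall>p\<in>P. \<forall>r\<in>R. L p r holomorphic_on UNIV) \<and>
    (\<forall>x. \<forall>p\<in>P. \<forall>p'\<in>P. (\<Sum>r\<in>R. L p r x * window_mat r p' x) = (if p = p' then d x else 0))"
    by (rule holomorphic_left_inverse[OF fin window_mat_holomorphic inj])
  thus ?thesis unfolding P_def R_def by blast
qed


text \<open>For positions just above 0 every cell of the window keeps the occupancy it has at 0, so
  the rows of H are the rows of the entire matrix. Its left inverse is bounded on an interval where
  d stays away from 0.\<close>

lemma window_estimate:
  "\<exists>J x1 x2 C. 0 \<le> x1 \<and> x1 < x2 \<and> x2 \<le> T \<and> C \<ge> 0 \<and>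
    (\<forall>\<eta> c r0 E. admissible \<eta> c \<longrightarrow> x1 < rho \<eta> r0 \<longrightarrow> rho \<eta> r0 < x2 \<longrightarrow>
      (\<forall>n\<in>{r0 - int J..r0}. norm (H \<eta> c n) \<le> E) \<longrightarrow> (\<forall>s\<in>{r0 - int J..r0 + int N - 1}. norm (c s) \<le> C * E))"
proof -
  obtain J L d x0 where d: "d holomorphic_on UNIV" "d (x0::complex) \<noteq> (0::complex)"
    and L: "\<forall>p\<in>cols J. \<forall>r\<in>{0..int J}. L p r holomorphic_on UNIV"
    and LA: "\<forall>x. \<forall>p\<in>cols J. \<forall>p'\<in>cols J. (\<Sum>r\<in>{0..int J}. L p r x * window_mat r p' x) = (if p = p' then d x else 0)"
    using window_mat_left_inverse by blast
  define W where "W = {1 - int N..int J}"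
  \<comment> \<open>\<epsilon> must exclude wrap-around and keep occupied cells occupied. Empty
    cells stay empty, since distances only increase with x.\<close>
  have "eventually (\<lambda>\<epsilon>. \<forall>j\<in>W. gap j + \<epsilon> < T \<and> (gap j < 1 \<longrightarrow> gap j + \<epsilon> < 1)) (at_right (0::real))"
  proof (intro eventually_ball_finite ballI eventually_conj)
    fix j
    have t: "((\<lambda>\<epsilon>. gap j + \<epsilon>) \<longlongrightarrow> gap j) (at_right 0)" by (auto intro!: tendsto_eq_intros)
    show "eventually (\<lambda>\<epsilon>. gap j + \<epsilon> < T) (at_right 0)"
      using order_tendstoD(2)[OF t] gap_bounds by blast
    show "eventually (\<lambda>\<epsilon>. gap j < 1 \<longrightarrow> gap j + \<epsilon> < 1) (at_right 0)"
      using order_tendstoD(2)[OF t] by (cases "gap j < 1") auto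
  qed (simp add: W_def)
  hence "eventually (\<lambda>\<epsilon>. \<epsilon> > 0 \<and> (\<forall>j\<in>W. gap j + \<epsilon> < T \<and> (gap j < 1 \<longrightarrow> gap j + \<epsilon> < 1))) (at_right (0::real))"
    by (intro eventually_conj eventually_at_right_less)
  from eventually_happens[OF this] obtain \<epsilon> where \<epsilon>: "\<epsilon> > 0"
    "\<And>j. j \<in> W \<Longrightarrow> gap j + \<epsilon> < T" "\<And>j. j \<in> W \<Longrightarrow> gap j < 1 \<Longrightarrow> gap j + \<epsilon> < 1" by auto
  \<comment> \<open>The point x0 at which d is known to be nonzero may be far away; the identity
    theorem rules out that d vanishes on the whole interval.\<close>
  have "\<exists>y\<in>{0<..<\<epsilon>}. d (of_real y) \<noteq> 0"
  proof (rule ccontr)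
    assume "\<not> ?thesis"
    hence z: "d x = 0" if "x \<in> of_real ` {0<..<\<epsilon>}" for x using that by auto
    have "(complex_of_real (\<epsilon>/2)) islimpt (of_real ` {0<..<\<epsilon>})"
    proof (rule islimpt_sequential[THEN iffD2], intro exI[of _ "\<lambda>n. complex_of_real (\<epsilon>/2 + (\<epsilon>/2) / real (n + 2))"] conjI allI)
      fix n
      have "\<epsilon>/2 / real (n + 2) < \<epsilon>/2" "\<epsilon>/2 / real (n + 2) > 0" using \<epsilon> by (auto simp: field_simps add_pos_nonneg)
      hence "\<epsilon>/2 + (\<epsilon>/2) / real (n + 2) \<in> {0<..<\<epsilon>}" "\<epsilon>/2 + (\<epsilon>/2) / real (n + 2) \<noteq> \<epsilon>/2" using \<epsilon>(1)
        unfolding greaterThanLessThan_iff by linarith+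
      thus "complex_of_real (\<epsilon>/2 + (\<epsilon>/2) / real (n + 2)) \<in> of_real ` {0<..<\<epsilon>} - {complex_of_real (\<epsilon>/2)}"
        by (simp only: of_real_eq_iff Diff_iff singleton_iff imageI not_False_eq_True simp_thms)
    next
      have "(\<lambda>n. \<epsilon>/2 + (\<epsilon>/2) / real (n + 2)) \<longlonglongrightarrow> \<epsilon>/2" by real_asymp
      thus "(\<lambda>n. complex_of_real (\<epsilon>/2 + (\<epsilon>/2) / real (n + 2))) \<longlonglongrightarrow> complex_of_real (\<epsilon>/2)"
        by (rule tendsto_of_real)
    qed
    hence "d x0 = 0" using z d(1) by (intro analytic_continuation[of d UNIV "of_real ` {0<..<\<epsilon>}" "of_real (\<epsilon>/2)" x0]) auto
    thus False using d by simp
  qed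
  then obtain y where y: "0 < y" "y < \<epsilon>" "d (of_real y) \<noteq> 0" by auto
  have contd: "continuous_on UNIV (\<lambda>x::real. norm (d (of_real x)))"
    by (intro continuous_intros continuous_on_compose2[OF holomorphic_on_imp_continuous_on[OF d(1)]]) auto
  have "((\<lambda>x::real. norm (d (of_real x))) \<longlongrightarrow> norm (d (of_real y))) (at_right y)"
    using contd by (metis continuous_on_def UNIV_I tendsto_within_subset subset_UNIV)
  moreover have "norm (d (of_real y)) / 2 < norm (d (of_real y))" using y by simp
  ultimately have "eventually (\<lambda>x. norm (d (of_real y)) / 2 < norm (d (of_real x))) (at_right y)"
    by (rule order_tendstoD(1))
  then obtain b where b: "b > y" "\<And>x. y < x \<Longrightarrow> x < b \<Longrightarrow> norm (d (of_real y)) / 2 < norm (d (of_real x))"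
    unfolding eventually_at_right_field by auto
  define x2 where "x2 = min b \<epsilon>"
  have x2: "y < x2" "x2 \<le> \<epsilon>" using b y by (auto simp: x2_def)
  have "\<exists>B. \<forall>x\<in>{0..\<epsilon>}. norm (L p r (of_real x)) \<le> B" if "p \<in> cols J" "r \<in> {0..int J}" for p r
  proof -
    have "continuous_on {0..\<epsilon>} (\<lambda>x. L p r (of_real x))"
      using L that by (intro continuous_on_compose2[OF holomorphic_on_imp_continuous_on[of "L p r" UNIV]] continuous_intros) auto
    hence "compact ((\<lambda>x. L p r (complex_of_real x)) ` {0..\<epsilon>})"
      by (intro compact_continuous_image) auto
    from compact_imp_bounded[OF this] show ?thesis unfolding bounded_iff by auto
  qed
  then obtain B where B: "\<And>p r x. p \<in> cols J \<Longrightarrow> r \<in> {0..int J} \<Longrightarrow> x \<in> {0..\<epsilon>} \<Longrightarrow> norm (L p r (of_real x)) \<le> B p r"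
    by metis
  have B0: "0 \<le> B p r" if "p \<in> cols J" "r \<in> {0..int J}" for p r
    using B[OF that, of 0] \<epsilon> by (meson atLeastAtMost_iff less_imp_le norm_ge_zero order_refl order_trans)
  define BB where "BB = (\<Sum>p\<in>cols J. \<Sum>r\<in>{0..int J}. B p r)"
  have BB: "(\<Sum>r\<in>{0..int J}. B p r) \<le> BB" if "p \<in> cols J" for p
    unfolding BB_def using that B0 by (intro member_le_sum[of p] finite_cols) (auto intro!: sum_nonneg)
  have BB0: "BB \<ge> 0" unfolding BB_def using B0 by (auto intro!: sum_nonneg)
  \<comment> \<open>BB bounds the sum over r of the entries of L in each row p, and the 2 comes from
    d being larger than half of its value at y, in modulus, to the right of y.\<close>
  define C where "C = 2 * BB / norm (d (of_real y))"
  have C0: "C \<ge> 0" using BB0 by (simp add: C_def)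
  have "norm (c s) \<le> C * E"
    if adm: "admissible \<eta> c" and x: "y < rho \<eta> r0" "rho \<eta> r0 < x2"
      and E: "\<And>n. n \<in> {r0 - int J..r0} \<Longrightarrow> norm (H \<eta> c n) \<le> E" and s: "s \<in> {r0 - int J..r0 + int N - 1}" for \<eta> c r0 E s
  proof -
    define x where "x = rho \<eta> r0"
    have xr: "0 \<le> x" "x < \<epsilon>" "y < x" "x < b" using that x2 y by (auto simp: x_def x2_def)
    have rho_j: "rho \<eta> (r0 - j) = gap j + x" if "j \<in> W" for j
      unfolding x_def by (rule rho_diff) (use \<epsilon>(2)[OF that] xr in \<open>simp add: x_def\<close>)
    define v where "v p = c (r0 - p)" for p
    have v0: "v p = 0" if "p \<in> W" "p \<notin> cols J" for p
      using that adm rho_j[OF that(1)] xr by (auto simp: v_def admissible_def cols_def W_def)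
    have E0: "E \<ge> 0" using E[of r0] by (auto intro: order_trans[OF norm_ge_zero])
    have row: "(\<Sum>p\<in>cols J. window_mat r p (of_real x) * v p) = H \<eta> c (r0 - r)" if r: "r \<in> {0..int J}" for r
    proof -
      have "(\<Sum>p\<in>cols J. window_mat r p (of_real x) * v p) =
         (\<Sum>p\<in>W. if p \<in> cols J then window_mat r p (of_real x) * v p else 0)"
        by (subst sum.inter_restrict[symmetric]) (auto simp: cols_def W_def intro!: sum.cong)
      also have "\<dots> = (\<Sum>p\<in>W. if p \<le> r then M (nat (r - p)) (of_real (gap p) + of_real x) * v p else 0)"
        using v0 by (intro sum.cong) (auto simp: window_mat_def)
      also have "\<dots> = (\<Sum>i<N. M i (of_real (gap (r - int i)) + of_real x) * v (r - int i))"
        unfolding W_def using r N_pos by (subst sum_window_reindex) (auto simp: M_ge)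
      also have "\<dots> = H \<eta> c (r0 - r)"
        unfolding H_def
      proof (intro sum.cong refl)
        fix i assume "i \<in> {..<N}"
        hence "r - int i \<in> W" using r by (auto simp: W_def)
        moreover have "r0 - r + int i = r0 - (r - int i)" by simp
        ultimately show "M i (of_real (gap (r - int i)) + of_real x) * v (r - int i) =
           M i (of_real (rho \<eta> (r0 - r + int i))) * c (r0 - r + int i)"
          using rho_j[of "r - int i"] by (simp only: v_def of_real_add)
      qed
      finally show ?thesis .
    qed
    define p where "p = r0 - s"
    have pW: "p \<in> W" using s by (auto simp: p_def W_def)
    have cs: "c s = v p" by (simp add: v_def p_def)
    show ?thesis
    proof (cases "p \<in> cols J")
      case False
      thus ?thesis using v0[OF pW] cs C0 E0 by simp
    next
      case p: True
      have "d (of_real x) * v p = (\<Sum>p'\<in>cols J. (if p = p' then d (of_real x) else 0) * v p')"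
        using p finite_cols by (simp add: if_distrib[of "\<lambda>u. u * _"] cong: if_cong)
      also have "\<dots> = (\<Sum>p'\<in>cols J. \<Sum>r\<in>{0..int J}. L p r (of_real x) * (window_mat r p' (of_real x) * v p'))"
      proof (intro sum.cong refl)
        fix p' assume p': "p' \<in> cols J"
        have "(if p = p' then d (of_real x) else 0) = (\<Sum>r\<in>{0..int J}. L p r (of_real x) * window_mat r p' (of_real x))"
          by (rule LA[rule_format, symmetric]) (use p p' in auto)
        thus "(if p = p' then d (of_real x) else 0) * v p' =
            (\<Sum>r\<in>{0..int J}. L p r (of_real x) * (window_mat r p' (of_real x) * v p'))"
          by (simp only: sum_distrib_right mult.assoc)
      qed
      also have "\<dots> = (\<Sum>r\<in>{0..int J}. L p r (of_real x) * H \<eta> c (r0 - r))"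
        by (subst sum.swap) (simp add: sum_distrib_left[symmetric] row)
      finally have "norm (d (of_real x)) * norm (v p) = norm (\<Sum>r\<in>{0..int J}. L p r (of_real x) * H \<eta> c (r0 - r))"
        by (metis norm_mult)
      also have "\<dots> \<le> (\<Sum>r\<in>{0..int J}. B p r * E)"
        using xr B0[OF p] by (intro sum_norm_le) (auto simp: norm_mult intro!: mult_mono B p E)
      also have "\<dots> \<le> BB * E" using BB[OF p] E0 by (simp add: sum_distrib_right[symmetric] mult_right_mono)
      finally have "norm (d (of_real x)) * norm (v p) \<le> BB * E" .
      moreover have "norm (d (of_real y)) / 2 * norm (v p) \<le> norm (d (of_real x)) * norm (v p)"
        using b(2)[OF xr(3,4)] by (intro mult_right_mono) auto
      ultimately have "norm (d (of_real y)) / 2 * norm (v p) \<le> BB * E" by linarith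
      thus ?thesis using y(3) by (simp add: C_def cs field_simps)
    qed
  qed
  moreover have "x2 \<le> T" using x2 \<epsilon>(2)[of 0] gap_bounds[of 0] N_pos by (force simp: W_def)
  ultimately show ?thesis using y x2 C0
    by (intro exI[of _ J] exI[of _ y] exI[of _ x2] exI[of _ C]) auto
qed

text \<open>Some good window starts at a cell r0 at most K cells above r. Its estimate bounds the
  entries from r0 to r0 + N - 1, and the descent from r0 to r costs a factor D per step.\<close>

lemma uniform_local_bound:
  "\<exists>K C. C \<ge> 0 \<and> (\<forall>\<eta> c r E. admissible \<eta> c \<longrightarrow> (\<forall>n\<in>{r - int K..r + int K}. norm (H \<eta> c n) \<le> E) \<longrightarrow> norm (c r) \<le> C * E)"
proof -
  obtain J x1 x2 C where x: "0 \<le> x1" "x1 < x2" "x2 \<le> T" and C: "C \<ge> 0"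
    and win: "\<And>\<eta> c r0 E s. admissible \<eta> c \<Longrightarrow> x1 < rho \<eta> r0 \<Longrightarrow> rho \<eta> r0 < x2 \<Longrightarrow>
      (\<forall>n\<in>{r0 - int J..r0}. norm (H \<eta> c n) \<le> E) \<Longrightarrow> s\<in>{r0 - int J..r0 + int N - 1} \<Longrightarrow> norm (c s) \<le> C * E"
    using window_estimate by blast
  obtain D where D: "D \<ge> 1" and step: "\<And>\<eta> c r E. admissible \<eta> c \<Longrightarrow> (\<forall>s\<in>{r+1..r+int N-1}. norm (c s) \<le> E) \<Longrightarrow> E \<ge> 0 \<Longrightarrow>
     norm (H \<eta> c r) \<le> E \<Longrightarrow> norm (H \<eta> c (r-1)) \<le> E \<Longrightarrow> norm (c r) \<le> D * E"
    using descent_step by blast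
  obtain K where K: "\<And>\<theta>. \<exists>k\<le>K. frac (\<theta> + real k * \<alpha>) \<in> {\<alpha> * x1<..<\<alpha> * x2}"
    using irrational_rotation_hits[OF irr, of "\<alpha> * x1" "\<alpha> * x2"] x \<alpha> T by (auto simp: field_simps T_def)
  \<comment> \<open>At least 1, so that the inductive bound also dominates the row values E needed
    by each descent step.\<close>
  define C' where "C' = max 1 C"
  \<comment> \<open>Rows reach up to J below r0 in the window estimate, and the last descent step
    uses row r - 1; this explains the radius K + J + 1.\<close>
  have "norm (c r) \<le> D ^ K * C' * E"
    if adm: "admissible \<eta> c" and E: "\<And>n. n \<in> {r - int (K + J + 1)..r + int (K + J + 1)} \<Longrightarrow> norm (H \<eta> c n) \<le> E" for \<eta> c r E
  proof -
    \<comment> \<open>A rotation step by \<alpha> means going down one cell. Starting K cells above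
      r, the rotation hits a good cell r0 before passing r.\<close>
    obtain k where k: "k \<le> K" "frac (\<alpha> * (\<eta> - of_int r) - real K * \<alpha> + real k * \<alpha>) \<in> {\<alpha> * x1<..<\<alpha> * x2}"
      using K by blast
    define r0 where "r0 = r + int (K - k)"
    have "\<alpha> * (\<eta> - of_int r) - real K * \<alpha> + real k * \<alpha> = \<alpha> * (\<eta> - of_int r0)"
      using k(1) by (simp add: r0_def of_nat_diff algebra_simps)
    hence "frac (\<alpha> * (\<eta> - of_int r0)) \<in> {\<alpha> * x1<..<\<alpha> * x2}" using k(2) by simp
    hence rho: "x1 < rho \<eta> r0" "rho \<eta> r0 < x2" using \<alpha> by (auto simp: rho_def T_def field_simps)
    have E0: "E \<ge> 0" using E[of r] by (auto intro: order_trans[OF norm_ge_zero])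
    have base: "norm (c s) \<le> C' * E" if "s \<in> {r0 - int J..r0 + int N - 1}" for s
    proof -
      have "norm (c s) \<le> C * E" using that
        by (intro win[OF adm rho]) (auto intro!: E simp: r0_def)
      also have "\<dots> \<le> C' * E" using E0 by (intro mult_right_mono) (auto simp: C'_def)
      finally show ?thesis .
    qed
    have "\<forall>s\<in>{r0 - int t..r0 + int N - 1}. norm (c s) \<le> D ^ t * (C' * E)" if "t \<le> K - k" for t
      using that
    proof (induction t)
      case 0
      thus ?case using base by auto
    next
      case (Suc t)
      have ge: "E \<le> D ^ t * (C' * E)"
      proof -
        have "1 * E \<le> (D ^ t * C') * E" using D E0 by (intro mult_right_mono mult_ge1_I) (auto simp: C'_def)
        thus ?thesis by (simp add: mult.assoc)
      qed
      have IH: "\<forall>s\<in>{r0 - int t..r0 + int N - 1}. norm (c s) \<le> D ^ t * (C' * E)" using Suc by simp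
      have new: "norm (c (r0 - int (Suc t))) \<le> D * (D ^ t * (C' * E))"
      proof (rule step[OF adm])
        show "\<forall>s\<in>{r0 - int (Suc t) + 1..r0 - int (Suc t) + int N - 1}. norm (c s) \<le> D ^ t * (C' * E)"
          using IH by auto
        show "0 \<le> D ^ t * (C' * E)" using ge E0 by linarith
        show "norm (H \<eta> c (r0 - int (Suc t))) \<le> D ^ t * (C' * E)"
          using Suc.prems k by (intro order_trans[OF E ge]) (auto simp: r0_def)
        show "norm (H \<eta> c (r0 - int (Suc t) - 1)) \<le> D ^ t * (C' * E)"
          using Suc.prems k by (intro order_trans[OF E ge]) (auto simp: r0_def)
      qed
      have up: "D ^ t * (C' * E) \<le> D * (D ^ t * (C' * E))"
        using D ge E0 by (intro mult_le_cancel_right1[THEN iffD2]) auto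
      show ?case
      proof
        fix s assume s: "s \<in> {r0 - int (Suc t)..r0 + int N - 1}"
        show "norm (c s) \<le> D ^ Suc t * (C' * E)"
        proof (cases "s = r0 - int (Suc t)")
          case True
          thus ?thesis using new by (simp add: mult.assoc)
        next
          case False
          hence "norm (c s) \<le> D ^ t * (C' * E)" using IH s by auto
          thus ?thesis using up by (simp add: mult.assoc)
        qed
      qed
    qed
    from this[of "K - k"] have "norm (c r) \<le> D ^ (K - k) * (C' * E)" using N_pos by (auto simp: r0_def)
    also have "\<dots> \<le> D ^ K * (C' * E)"
      using D E0 by (intro mult_right_mono power_increasing) (auto simp: C'_def)
    finally show ?thesis by (simp add: mult.assoc)
  qed
  moreover have "D ^ K * C' \<ge> 0" using D by (simp add: C'_def)
  ultimately show ?thesis by (intro exI[of _ "K + J + 1"] exI[of _ "D ^ K * C'"]) auto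
qed

end

section \<open>Parseval's identity on an interval\<close>

inductive trig_poly :: "(real \<Rightarrow> complex) \<Rightarrow> bool" where
  monom: "trig_poly (\<lambda>x. c * cis (2 * pi * of_int n * x))"
| add: "trig_poly P \<Longrightarrow> trig_poly Q \<Longrightarrow> trig_poly (\<lambda>x. P x + Q x)"

lemma trig_poly_mult_monom:
  assumes "trig_poly P"
  shows "trig_poly (\<lambda>x. P x * (c * cis (2 * pi * of_int n * x)))"
  using assms
proof induction
  case (monom d m)
  have "(\<lambda>x. d * cis (2 * pi * of_int m * x) * (c * cis (2 * pi * of_int n * x))) =
      (\<lambda>x. (d * c) * cis (2 * pi * of_int (m + n) * x))"
    by (auto simp: fun_eq_iff ring_distribs simp flip: cis_mult)
  then show ?case using trig_poly.monom[of "d * c" "m + n"] by simp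
next
  case (add P Q)
  then show ?case using trig_poly.add by (auto simp: distrib_right)
qed

lemma trig_poly_mult:
  assumes "trig_poly P" "trig_poly Q"
  shows "trig_poly (\<lambda>x. P x * Q x)"
  using assms(2)
proof induction
  case (monom d m)
  then show ?case by (rule trig_poly_mult_monom[OF assms(1)])
next
  case (add P' Q')
  then show ?case using trig_poly.add by (auto simp: distrib_left)
qed

lemma trig_poly_const: "trig_poly (\<lambda>x. c)"
  using trig_poly.monom[of c 0] by simp

text \<open>Real polynomials are generated by constants and linear functionals, and a linear
  functional on the unit circle is a combination of cosine and sine, hence of the frequencies 1 and
  -1.\<close>

lemma trig_poly_real_polynomial:
  assumes "real_polynomial_function p"
  shows "trig_poly (\<lambda>x. complex_of_real (p (cis (2 * pi * x))))"
  using assms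
proof induction
  case (linear f)
  interpret f: bounded_linear f by fact
  have "complex_of_real (f (cis (2 * pi * x))) =
      (of_real (f 1) / 2 - \<i> * of_real (f \<i>) / 2) * cis (2 * pi * of_int 1 * x) +
      (of_real (f 1) / 2 + \<i> * of_real (f \<i>) / 2) * cis (2 * pi * of_int (-1) * x)" for x
  proof -
    have "cis (2 * pi * x) = cos (2 * pi * x) *\<^sub>R 1 + sin (2 * pi * x) *\<^sub>R \<i>"
      by (simp add: complex_eq_iff)
    hence "f (cis (2 * pi * x)) = cos (2 * pi * x) * f 1 + sin (2 * pi * x) * f \<i>"
      by (simp only: f.add f.scaleR) simp
    thus ?thesis by (simp add: complex_eq_iff field_simps)
  qed
  hence eq: "(\<lambda>x. complex_of_real (f (cis (2 * pi * x)))) =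
      (\<lambda>x. (of_real (f 1) / 2 - \<i> * of_real (f \<i>) / 2) * cis (2 * pi * of_int 1 * x) +
      (of_real (f 1) / 2 + \<i> * of_real (f \<i>) / 2) * cis (2 * pi * of_int (-1) * x))"
    by (rule ext)
  show ?case unfolding eq by (rule trig_poly.add[OF trig_poly.monom trig_poly.monom])
next
  case (mult f g)
  then show ?case using trig_poly_mult by simp
next
  case (add f g)
  then show ?case using trig_poly.add by simp
qed (rule trig_poly_const)

lemma trig_poly_sum_form:
  assumes "trig_poly P"
  shows "\<exists>A d. finite A \<and> P = (\<lambda>x. \<Sum>n\<in>A. d n * cis (2 * pi * of_int n * x))"
  using assms
proof induction
  case (monom c n)
  then show ?case by (intro exI[of _ "{n}"] exI[of _ "\<lambda>_. c"]) simp
next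
  case (add P Q)
  then obtain A d B e where A: "finite A" "P = (\<lambda>x. \<Sum>n\<in>A. d n * cis (2 * pi * of_int n * x))"
    and B: "finite B" "Q = (\<lambda>x. \<Sum>n\<in>B. e n * cis (2 * pi * of_int n * x))" by blast
  have "P x + Q x = (\<Sum>n\<in>A \<union> B. ((if n \<in> A then d n else 0) + (if n \<in> B then e n else 0)) * cis (2 * pi * of_int n * x))" for x
  proof -
    have "P x = (\<Sum>n\<in>A \<union> B. (if n \<in> A then d n else 0) * cis (2 * pi * of_int n * x))"
      using A B by (auto intro!: sum.mono_neutral_cong_left)
    moreover have "Q x = (\<Sum>n\<in>A \<union> B. (if n \<in> B then e n else 0) * cis (2 * pi * of_int n * x))"
      using A B by (auto intro!: sum.mono_neutral_cong_left)
    ultimately show ?thesis by (simp only: distrib_right sum.distrib)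
  qed
  hence "(\<lambda>x. P x + Q x) = (\<lambda>x. \<Sum>n\<in>A \<union> B. ((if n \<in> A then d n else 0) + (if n \<in> B then e n else 0)) * cis (2 * pi * of_int n * x))"
    by (rule ext)
  then show ?case using A(1) B(1)
    by (intro exI[of _ "A \<union> B"] exI[of _ "\<lambda>n. (if n \<in> A then d n else 0) + (if n \<in> B then e n else 0)"]) simp
qed

lemma trig_approx_continuous:
  fixes u :: "real \<Rightarrow> complex"
  assumes u: "continuous_on {0..1} u" "u 0 = u 1" and e: "e > 0"
  shows "\<exists>P. trig_poly P \<and> (\<forall>x\<in>{0..<1}. norm (u x - P x) < e)"
proof -
  \<comment> \<open>The constant homotopy is only a vehicle: the lemma on circle maps supplies the
    continuity of u composed with the angle across the cut of \<open>Arg2pi\<close>.\<close>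
  have "homotopic_loops UNIV u u"
    using u by (simp add: homotopic_loops_refl path_def pathstart_def pathfinish_def)
  from homotopic_with_imp_continuous[OF homotopic_loops_imp_homotopic_circlemaps[OF this]]
  have cont: "continuous_on (sphere 0 1) (u \<circ> (\<lambda>z. Arg2pi z / (2 * pi)))" by blast
  obtain g where g: "polynomial_function g" "\<And>z. z \<in> sphere 0 1 \<Longrightarrow> norm ((u \<circ> (\<lambda>z. Arg2pi z / (2 * pi))) z - g z) < e"
    using Stone_Weierstrass_polynomial_function[OF compact_sphere cont e] by blast
  have "real_polynomial_function (Re \<circ> g)" "real_polynomial_function (Im \<circ> g)"
    using g(1) bounded_linear_Re bounded_linear_Im unfolding polynomial_function_def by blast+
  hence "trig_poly (\<lambda>x. complex_of_real ((Re \<circ> g) (cis (2 * pi * x))) + complex_of_real ((Im \<circ> g) (cis (2 * pi * x))) * \<i>)"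
    by (intro trig_poly.add trig_poly_mult trig_poly_real_polynomial trig_poly_const)
  also have "(\<lambda>x. complex_of_real ((Re \<circ> g) (cis (2 * pi * x))) + complex_of_real ((Im \<circ> g) (cis (2 * pi * x))) * \<i>)
      = (\<lambda>x. g (cis (2 * pi * x)))"
    by (auto simp: complex_eq_iff)
  finally have tp: "trig_poly (\<lambda>x. g (cis (2 * pi * x)))" .
  moreover have "norm (u x - g (cis (2 * pi * x))) < e" if "x \<in> {0..<1}" for x
  proof -
    have "Arg2pi (cis (2 * pi * x)) = 2 * pi * x"
      using that by (intro Arg2pi_unique[of 1]) (auto simp: cis_conv_exp)
    thus ?thesis using g(2)[of "cis (2 * pi * x)"] by simp
  qed
  ultimately show ?thesis by blast
qed

section \<open>Fourier coefficients on one period\<close>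

abbreviation Ico :: "real \<Rightarrow> real measure" where "Ico T \<equiv> restrict_space lborel {0..<T}"

lemma space_Ico [simp]: "space (Ico T) = {0..<T}"
  by (simp add: space_restrict_space)

lemma finite_measure_Ico: "finite_measure (Ico T)"
  by (intro finite_measureI) (cases "T \<ge> 0"; simp add: emeasure_restrict_space)

lemma integrable_Ico_bounded:
  fixes f :: "real \<Rightarrow> 'a::{banach, second_countable_topology}"
  assumes "f \<in> borel_measurable borel" "\<And>x. x \<in> {0..<T} \<Longrightarrow> norm (f x) \<le> B"
  shows "integrable (Ico T) f"
proof -
  interpret finite_measure "Ico T" by (rule finite_measure_Ico)
  show ?thesis
    using assms by (intro integrable_const_bound[of _ B]) (auto intro!: measurable_restrict_space1 AE_I2)
qed

lemma measure_Ico_1: "measure (Ico 1) {0..<1} = 1"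
  by (simp add: measure_restrict_space)

lemma integral_cis_Ico: "(\<integral>x. cis (2 * pi * of_int n * x) \<partial>Ico 1) = (if n = 0 then 1 else 0)"
proof (cases "n = 0")
  case True
  interpret finite_measure "Ico 1" by (rule finite_measure_Ico)
  show ?thesis using True measure_Ico_1 by simp
next
  case False
  define F where "F x = cis (2 * pi * of_int n * x) / (\<i> * (2 * pi * of_int n))" for x
  have "(\<integral>x. cis (2 * pi * of_int n * x) \<partial>Ico 1) = (\<integral>x. indicator {0..<1} x *\<^sub>R cis (2 * pi * of_int n * x) \<partial>lborel)"
    by (subst integral_restrict_space) auto
  also have "\<dots> = (\<integral>x. indicator {0..1} x *\<^sub>R cis (2 * pi * of_int n * x) \<partial>lborel)"
  proof (rule integral_cong_AE)
    have "AE x in lborel. x \<noteq> (1::real)" by (rule AE_lborel_singleton)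
    thus "AE x in lborel. indicator {0..<1} x *\<^sub>R cis (2 * pi * of_int n * x) = indicator {0..1} x *\<^sub>R cis (2 * pi * of_int n * x)"
      by eventually_elim (auto simp: indicator_def)
  qed (auto simp: cis_conv_exp intro!: borel_measurable_continuous_onI borel_measurable_scaleR borel_measurable_indicator continuous_intros)
  also have "\<dots> = F 1 - F 0"
  proof (rule integral_FTC_Icc)
    fix x :: real
    have "((\<lambda>x. exp (\<i> * (2 * pi * of_int n) * of_real x) / (\<i> * (2 * pi * of_int n))) has_vector_derivative
        exp (\<i> * (2 * pi * of_int n) * of_real x)) (at x within {0..1})"
      using False by (auto intro!: derivative_eq_intros has_vector_derivative_real_field simp: field_simps)
    thus "(F has_vector_derivative cis (2 * pi * of_int n * x)) (at x within {0..1})"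
      by (simp add: F_def[abs_def] cis_conv_exp mult_ac)
  qed (auto simp: cis_conv_exp intro!: continuous_intros)
  also have "F 1 = F 0" by (simp add: F_def)
  finally show ?thesis using False by simp
qed


text \<open>The exponent has a positive sign, so this is the usual Fourier coefficient at -n; hence
  the arguments \<open>-n\<close> in the approximation lemmas.\<close>

definition fcoeff :: "(real \<Rightarrow> complex) \<Rightarrow> int \<Rightarrow> complex" where
  "fcoeff F n = (\<integral>x. F x * cis (2 * pi * of_int n * x) \<partial>Ico 1)"

lemma norm_diff_squared_complex: "(norm (x - y :: complex))\<^sup>2 = (norm x)\<^sup>2 + (norm y)\<^sup>2 - 2 * Re (x * cnj y)"
  unfolding cmod_power2 by (simp add: power2_eq_square algebra_simps)

lemma cis_measurable [measurable]: "f \<in> borel_measurable M \<Longrightarrow> (\<lambda>x. cis (f x)) \<in> borel_measurable M"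
  by (rule measurable_compose[of _ M borel cis]) (auto intro!: borel_measurable_continuous_onI continuous_intros)

lemma cnj_measurable [measurable]: "f \<in> borel_measurable M \<Longrightarrow> (\<lambda>x. cnj (f x)) \<in> borel_measurable M"
  by (rule measurable_compose[of _ M borel cnj]) (auto intro!: borel_measurable_continuous_onI continuous_intros)

text \<open>Completing the square. With d equal to the coefficients it yields Bessel's inequality;
  dropping the squared differences bounds the missing energy by the error of any trigonometric
  polynomial.\<close>

lemma fourier_approx_error:
  fixes F :: "real \<Rightarrow> complex"
  assumes [measurable]: "F \<in> borel_measurable borel" and B: "\<And>x. norm (F x) \<le> B" and "finite A"
  shows "(\<integral>x. (norm (F x - (\<Sum>n\<in>A. d n * cis (2 * pi * of_int n * x))))\<^sup>2 \<partial>Ico 1) =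
     (\<integral>x. (norm (F x))\<^sup>2 \<partial>Ico 1) + (\<Sum>n\<in>A. (norm (d n - fcoeff F (-n)))\<^sup>2 - (norm (fcoeff F (-n)))\<^sup>2)"
proof -
  define P where "P x = (\<Sum>n\<in>A. d n * cis (2 * pi * of_int n * x))" for x
  have [measurable]: "P \<in> borel_measurable borel" unfolding P_def by measurable
  define BP where "BP = (\<Sum>n\<in>A. norm (d n))"
  have BP: "norm (P x) \<le> BP" for x
    unfolding P_def BP_def by (intro sum_norm_le) (simp add: norm_mult)
  have iF: "integrable (Ico 1) (\<lambda>x. (norm (F x))\<^sup>2)"
    using B by (intro integrable_Ico_bounded[of _ _ "B\<^sup>2"]) (auto intro!: power_mono)
  have iP: "integrable (Ico 1) (\<lambda>x. (norm (P x))\<^sup>2)"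
    using BP by (intro integrable_Ico_bounded[of _ _ "BP\<^sup>2"]) (auto intro!: power_mono)
  have iFP: "integrable (Ico 1) (\<lambda>x. F x * cnj (P x))"
    using B BP
    by (intro integrable_Ico_bounded[of _ _ "B * BP"]) (auto simp: norm_mult intro!: mult_mono order_trans[OF norm_ge_zero B])
  have iFn: "integrable (Ico 1) (\<lambda>x. F x * cis (2 * pi * of_int n * x))" for n
    using B by (intro integrable_Ico_bounded[of _ _ B]) (auto simp: norm_mult)
  have icis: "integrable (Ico 1) (\<lambda>x. cis (2 * pi * of_int n * x))" for n
    by (intro integrable_Ico_bounded[of _ _ 1]) auto
  have cr: "(\<integral>x. F x * cnj (P x) \<partial>Ico 1) = (\<Sum>n\<in>A. cnj (d n) * fcoeff F (-n))"
  proof -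
    have "(\<integral>x. F x * cnj (P x) \<partial>Ico 1) = (\<integral>x. (\<Sum>n\<in>A. cnj (d n) * (F x * cis (2 * pi * of_int (-n) * x))) \<partial>Ico 1)"
      unfolding P_def cnj_sum sum_distrib_left
      by (intro Bochner_Integration.integral_cong sum.cong refl) (simp add: cis_cnj mult_ac)
    also have "\<dots> = (\<Sum>n\<in>A. cnj (d n) * fcoeff F (-n))"
      unfolding fcoeff_def by (subst Bochner_Integration.integral_sum) (use iFn in \<open>auto intro!: integrable_mult_right simp del: of_int_minus\<close>)
    finally show ?thesis .
  qed
  have pp: "(\<integral>x. (norm (P x))\<^sup>2 \<partial>Ico 1) = (\<Sum>n\<in>A. (norm (d n))\<^sup>2)"
  proof -
    have "complex_of_real (\<integral>x. (norm (P x))\<^sup>2 \<partial>Ico 1) = (\<integral>x. P x * cnj (P x) \<partial>Ico 1)"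
      by (simp only: integral_complex_of_real[symmetric] complex_norm_square)
    also have "\<dots> = (\<integral>x. (\<Sum>n\<in>A. \<Sum>m\<in>A. d n * cnj (d m) * cis (2 * pi * of_int (n - m) * x)) \<partial>Ico 1)"
      unfolding P_def cnj_sum sum_product
      by (intro Bochner_Integration.integral_cong sum.cong refl)
         (simp add: cis_cnj ring_distribs cis_mult[symmetric] mult_ac cis_divide[symmetric] divide_inverse)
    also have "\<dots> = (\<Sum>n\<in>A. \<Sum>m\<in>A. d n * cnj (d m) * (if n - m = 0 then 1 else 0))"
      using icis by (simp add: Bochner_Integration.integral_sum integral_cis_Ico del: of_int_diff right_minus_eq)
    also have "\<dots> = (\<Sum>n\<in>A. d n * cnj (d n))" using assms(3)
      by (intro sum.cong refl) (simp add: if_distrib[of "\<lambda>u. _ * u"] cong: if_cong)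
    also have "\<dots> = complex_of_real (\<Sum>n\<in>A. (norm (d n))\<^sup>2)" by (simp only: complex_norm_square of_real_sum)
    finally show ?thesis by (simp only: of_real_eq_iff)
  qed
  have "(\<integral>x. (norm (F x - P x))\<^sup>2 \<partial>Ico 1) = (\<integral>x. (norm (F x))\<^sup>2 + (norm (P x))\<^sup>2 - 2 * Re (F x * cnj (P x)) \<partial>Ico 1)"
    by (simp only: norm_diff_squared_complex)
  also have "\<dots> = (\<integral>x. (norm (F x))\<^sup>2 \<partial>Ico 1) + (\<Sum>n\<in>A. (norm (d n))\<^sup>2) - 2 * Re (\<Sum>n\<in>A. cnj (d n) * fcoeff F (-n))"
  proof -
    define rr where "rr x = Re (F x * cnj (P x))" for x
    have "integrable (Ico 1) rr" unfolding rr_def by (rule integrable_Re[OF iFP])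
    moreover have "(\<integral>x. rr x \<partial>Ico 1) = Re (\<Sum>n\<in>A. cnj (d n) * fcoeff F (-n))"
      unfolding rr_def integral_Re[OF iFP] cr ..
    ultimately show ?thesis unfolding rr_def[symmetric] using iF iP by (simp only: pp
      Bochner_Integration.integral_diff Bochner_Integration.integral_add Bochner_Integration.integrable_add
      integral_mult_right_zero integrable_mult_right)
  qed
  also have "\<dots> = (\<integral>x. (norm (F x))\<^sup>2 \<partial>Ico 1) + (\<Sum>n\<in>A. (norm (d n - fcoeff F (-n)))\<^sup>2 - (norm (fcoeff F (-n)))\<^sup>2)"
    unfolding norm_diff_squared_complex
    by (simp add: sum.distrib sum_subtractf sum_distrib_left algebra_simps)
  finally show ?thesis by (simp add: P_def)
qed

text \<open>A measurable function is an almost everywhere limit of continuous ones. Clipping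
  provides the dominating constant, and a trapezoidal cut-off makes the approximants vanish at 0 and
  1, hence periodic.\<close>

lemma continuous_approx_L2:
  fixes F :: "real \<Rightarrow> complex"
  assumes [measurable]: "F \<in> borel_measurable borel" and B: "\<And>x. norm (F x) \<le> B" and e: "e > 0"
  shows "\<exists>u. continuous_on UNIV u \<and> u 0 = 0 \<and> u 1 = 0 \<and> (\<forall>x. norm (u x) \<le> B + 1) \<and> (\<integral>x. (norm (F x - u x))\<^sup>2 \<partial>Ico 1) < e"
proof -
  have B0: "B \<ge> 0" using B[of 0] norm_ge_zero order_trans by blast
  define D where "D = B + 1"
  have D: "D > 0" using B0 by (simp add: D_def)
  have "F measurable_on UNIV"
    by (rule lebesgue_measurable_imp_measurable_on) (auto intro: measurable_completion)
  then obtain Ng g where Ng: "negligible Ng" and g: "\<And>n::nat. continuous_on UNIV (g n)"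
    and lim: "\<And>x. x \<notin> Ng \<Longrightarrow> (\<lambda>n. g n x) \<longlonglongrightarrow> F x"
    unfolding measurable_on_def by auto
  define clip where "clip y = y /\<^sub>R max 1 (norm y / D)" for y :: complex
  have clip_cont: "continuous_on S (\<lambda>x. clip (f x))" if "continuous_on S f" for S and f :: "real \<Rightarrow> complex"
    unfolding clip_def using that D by (intro continuous_intros) auto
  have clip_tends: "((\<lambda>n. clip (f n)) \<longlonglongrightarrow> clip y)" if "f \<longlonglongrightarrow> y" for f y
    unfolding clip_def using that D by (intro tendsto_intros) auto
  have clip_id: "clip (F x) = F x" for x
    using B[of x] D by (simp add: clip_def D_def max_def field_simps)
  have clip_le: "norm (clip y) \<le> D" for y
  proof (cases "norm y \<le> D")
    case True
    hence "max 1 (norm y / D) = 1" using D by (simp add: field_simps max_def)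
    thus ?thesis using True by (simp add: clip_def)
  next
    case False
    hence "max 1 (norm y / D) = norm y / D" using D by (simp add: field_simps max_def)
    thus ?thesis using False D by (simp add: clip_def)
  qed
  define h where "h n x = max 0 (min 1 (min (real n * x) (real n * (1 - x))))" for n :: nat and x :: real
  define u where "u n x = of_real (h n x) * clip (g n x)" for n x
  have h01: "0 \<le> h n x" "h n x \<le> 1" for n x by (auto simp: h_def)
  have cont: "continuous_on UNIV (u n)" for n
    unfolding u_def[abs_def] h_def by (intro continuous_intros clip_cont g)
  have u_le: "norm (u n x) \<le> D" for n x
  proof -
    have "norm (u n x) \<le> 1 * D" unfolding u_def norm_mult using h01 clip_le by (intro mult_mono) auto
    thus ?thesis by simp
  qed
  have u01: "u n 0 = 0" "u n 1 = 0" for n by (auto simp: u_def h_def)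
  interpret finite_measure "Ico 1" by (rule finite_measure_Ico)
  have meas_u [measurable]: "u n \<in> borel_measurable borel" for n
    using cont by (rule borel_measurable_continuous_onI)
  have "(\<lambda>n. \<integral>x. (norm (F x - u n x))\<^sup>2 \<partial>Ico 1) \<longlonglongrightarrow> (\<integral>x. 0 \<partial>Ico 1)"
  proof (rule integral_dominated_convergence[where w = "\<lambda>_. (2 * D)\<^sup>2"])
    show "integrable (Ico 1) (\<lambda>_. (2 * D)\<^sup>2)" by simp
    show "(\<lambda>x. (norm (F x - u n x))\<^sup>2) \<in> borel_measurable (Ico 1)" for n
      by (rule measurable_restrict_space1) measurable
    show "AE x in Ico 1. norm ((norm (F x - u n x))\<^sup>2) \<le> (2 * D)\<^sup>2" for n
    proof (rule AE_I2)
      fix x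
      have "norm (F x - u n x) \<le> norm (F x) + norm (u n x)" by (rule norm_triangle_ineq4)
      also have "\<dots> \<le> 2 * D" using B[of x] u_le[of n x] by (simp add: D_def)
      finally show "norm ((norm (F x - u n x))\<^sup>2) \<le> (2 * D)\<^sup>2"
        using power_mono[of "norm (F x - u n x)" "2 * D" 2] by simp
    qed
    have "Ng \<in> null_sets lebesgue" using Ng by (simp add: negligible_iff_null_sets)
    hence "AE x in lborel. x \<notin> Ng" by (metis AE_completion_iff AE_not_in)
    moreover have "AE x in lborel. x \<noteq> (0::real)" by (rule AE_lborel_singleton)
    ultimately have "AE x in lborel. x \<in> {0..<1} \<longrightarrow> (\<lambda>n. (norm (F x - u n x))\<^sup>2) \<longlonglongrightarrow> 0"
    proof eventually_elim
      case (elim x)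
      show ?case
      proof
        assume x: "x \<in> {0..<1}"
        hence x01: "0 < x" "x < 1" using elim by auto
        have "eventually (\<lambda>n. 1 \<le> real n * x \<and> 1 \<le> real n * (1 - x)) sequentially"
          using x01 by (intro eventually_conj) real_asymp+
        hence "eventually (\<lambda>n. h n x = 1) sequentially" by eventually_elim (auto simp: h_def)
        hence "(\<lambda>n. complex_of_real (h n x)) \<longlonglongrightarrow> 1"
          by (intro tendsto_eventually) (auto elim: eventually_mono)
        moreover have "(\<lambda>n. clip (g n x)) \<longlonglongrightarrow> F x"
          using clip_tends[OF lim] elim clip_id by metis
        ultimately have "(\<lambda>n. u n x) \<longlonglongrightarrow> 1 * F x" unfolding u_def by (rule tendsto_mult)
        hence "(\<lambda>n. (norm (F x - u n x))\<^sup>2) \<longlonglongrightarrow> (norm (F x - 1 * F x))\<^sup>2" by (intro tendsto_intros)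
        thus "(\<lambda>n. (norm (F x - u n x))\<^sup>2) \<longlonglongrightarrow> 0" by simp
      qed
    qed
    thus "AE x in Ico 1. (\<lambda>n. (norm (F x - u n x))\<^sup>2) \<longlonglongrightarrow> 0"
      by (subst AE_restrict_space_iff) auto
  qed auto
  hence "(\<lambda>n. \<integral>x. (norm (F x - u n x))\<^sup>2 \<partial>Ico 1) \<longlonglongrightarrow> 0" by simp
  from order_tendstoD(2)[OF this e] obtain n where "(\<integral>x. (norm (F x - u n x))\<^sup>2 \<partial>Ico 1) < e"
    unfolding eventually_sequentially by blast
  thus ?thesis using cont[of n] u01 u_le by (intro exI[of _ "u n"]) (auto simp: D_def)
qed

lemma nn_integral_count_space_has_sum:
  fixes f :: "'a \<Rightarrow> real"
  assumes "(f has_sum S) A" "\<And>x. x \<in> A \<Longrightarrow> f x \<ge> 0"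
  shows "(\<integral>\<^sup>+x. ennreal (f x) \<partial>count_space A) = ennreal S"
proof -
  have "f summable_on A" using assms(1) by (rule has_sum_imp_summable)
  hence "(\<lambda>x. norm (f x)) summable_on A" using assms(2) by (subst summable_on_cong[of _ _ f]) auto
  hence "Infinite_Set_Sum.abs_summable_on f A" by (simp only: abs_summable_equivalent)
  thus ?thesis using assms by (simp add: nn_integral_conv_infsetsum infsetsum_infsum infsumI)
qed

abbreviation count_int :: "int measure" where "count_int \<equiv> count_space UNIV"

abbreviation sq_nn :: "'a measure \<Rightarrow> ('a \<Rightarrow> complex) \<Rightarrow> ennreal" where
  "sq_nn M f \<equiv> (\<integral>\<^sup>+x. ennreal ((norm (f x))\<^sup>2) \<partial>M)"

lemma parseval_Ico_1:
  fixes F :: "real \<Rightarrow> complex"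
  assumes [measurable]: "F \<in> borel_measurable borel" and B: "\<And>x. norm (F x) \<le> B"
  shows "sq_nn count_int (fcoeff F) = ennreal (\<integral>x. (norm (F x))\<^sup>2 \<partial>Ico 1)"
proof -
  define S where "S = (\<integral>x. (norm (F x))\<^sup>2 \<partial>Ico 1)"
  have bessel: "(\<Sum>n\<in>A. (norm (fcoeff F (-n)))\<^sup>2) \<le> S" if "finite A" for A
  proof -
    have "0 \<le> (\<integral>x. (norm (F x - (\<Sum>n\<in>A. fcoeff F (-n) * cis (2 * pi * of_int n * x))))\<^sup>2 \<partial>Ico 1)" by simp
    also have "\<dots> = S + (\<Sum>n\<in>A. - (norm (fcoeff F (-n)))\<^sup>2)"
      by (subst fourier_approx_error[OF assms that]) (simp add: S_def)
    finally show ?thesis by (simp add: sum_negf)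
  qed
  have approx: "\<exists>A. finite A \<and> S - e < (\<Sum>n\<in>A. (norm (fcoeff F (-n)))\<^sup>2)" if e: "e > 0" for e
  proof -
    obtain u where u: "continuous_on UNIV u" "u 0 = 0" "u 1 = 0" "\<And>x. norm (u x) \<le> B + 1"
       "(\<integral>x. (norm (F x - u x))\<^sup>2 \<partial>Ico 1) < e / 4"
      using continuous_approx_L2[OF assms, of "e/4"] e by auto
    have [measurable]: "u \<in> borel_measurable borel" using u(1) by (rule borel_measurable_continuous_onI)
    \<comment> \<open>Error budget: twice e/4 from the continuous function and 2 \<epsilon>^2 = e/4
      from the trigonometric polynomial, together less than e.\<close>
    define \<epsilon> where "\<epsilon> = sqrt (e / 8)"
    have \<epsilon>: "\<epsilon> > 0" "\<epsilon>\<^sup>2 = e / 8" using e by (auto simp: \<epsilon>_def)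
    obtain P where P: "trig_poly P" "\<And>x. x \<in> {0..<1} \<Longrightarrow> norm (u x - P x) < \<epsilon>"
      using trig_approx_continuous[of u \<epsilon>] u \<epsilon> continuous_on_subset[OF u(1)] by auto
    obtain A d where A: "finite A" "P = (\<lambda>x. \<Sum>n\<in>A. d n * cis (2 * pi * of_int n * x))"
      using trig_poly_sum_form[OF P(1)] by blast
    have [measurable]: "P \<in> borel_measurable borel" unfolding A by measurable
    interpret finite_measure "Ico 1" by (rule finite_measure_Ico)
    have iFu: "integrable (Ico 1) (\<lambda>x. (norm (F x - u x))\<^sup>2)"
    proof (intro integrable_Ico_bounded[of _ _ "(B + (B + 1))\<^sup>2"])
      fix x show "norm ((norm (F x - u x))\<^sup>2) \<le> (B + (B + 1))\<^sup>2"
        using norm_triangle_ineq4[of "F x" "u x"] B[of x] u(4)[of x] by (simp add: power_mono)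
    qed measurable
    have S': "S + (\<Sum>n\<in>A. (norm (d n - fcoeff F (-n)))\<^sup>2 - (norm (fcoeff F (-n)))\<^sup>2) = (\<integral>x. (norm (F x - P x))\<^sup>2 \<partial>Ico 1)"
      unfolding A(2) by (subst fourier_approx_error[OF assms A(1)]) (simp add: S_def)
    also have "\<dots> \<le> (\<integral>x. 2 * (norm (F x - u x))\<^sup>2 + 2 * \<epsilon>\<^sup>2 \<partial>Ico 1)"
    proof (rule integral_mono_AE')
      show "integrable (Ico 1) (\<lambda>x. 2 * (norm (F x - u x))\<^sup>2 + 2 * \<epsilon>\<^sup>2)" using iFu by simp
      show "AE x in Ico 1. (norm (F x - P x))\<^sup>2 \<le> 2 * (norm (F x - u x))\<^sup>2 + 2 * \<epsilon>\<^sup>2"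
      proof (rule AE_I2)
        fix x assume x: "x \<in> space (Ico 1)"
        have "norm (F x - P x) \<le> norm (F x - u x) + norm (u x - P x)" using norm_triangle_ineq[of "F x - u x" "u x - P x"] by simp
        also have "\<dots> \<le> norm (F x - u x) + \<epsilon>" using P(2)[of x] x by simp
        finally have "(norm (F x - P x))\<^sup>2 \<le> (norm (F x - u x) + \<epsilon>)\<^sup>2" by (intro power_mono) auto
        also have "\<dots> \<le> 2 * (norm (F x - u x))\<^sup>2 + 2 * \<epsilon>\<^sup>2"
          using zero_le_power2[of "norm (F x - u x) - \<epsilon>"] by (simp add: power2_eq_square algebra_simps)
        finally show "(norm (F x - P x))\<^sup>2 \<le> 2 * (norm (F x - u x))\<^sup>2 + 2 * \<epsilon>\<^sup>2" .
      qed
    qed simp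
    also have "\<dots> = 2 * (\<integral>x. (norm (F x - u x))\<^sup>2 \<partial>Ico 1) + 2 * \<epsilon>\<^sup>2"
      using iFu measure_Ico_1 by simp
    also have "\<dots> < e" using u(5) \<epsilon> e by simp
    finally have "S + (\<Sum>n\<in>A. (norm (d n - fcoeff F (-n)))\<^sup>2 - (norm (fcoeff F (-n)))\<^sup>2) < e" .
    moreover have "(\<Sum>n\<in>A. - (norm (fcoeff F (-n)))\<^sup>2) \<le> (\<Sum>n\<in>A. (norm (d n - fcoeff F (-n)))\<^sup>2 - (norm (fcoeff F (-n)))\<^sup>2)"
      by (intro sum_mono) simp
    ultimately show ?thesis using A(1) by (intro exI[of _ A]) (simp add: sum_negf)
  qed
  have "((\<lambda>n. (norm (fcoeff F (-n)))\<^sup>2) has_sum S) UNIV"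
    unfolding has_sum_def tendsto_iff eventually_finite_subsets_at_top
  proof (intro allI impI)
    fix e :: real assume e: "e > 0"
    obtain A where A: "finite A" "S - e < (\<Sum>n\<in>A. (norm (fcoeff F (-n)))\<^sup>2)" using approx[OF e] by blast
    show "\<exists>X. finite X \<and> X \<subseteq> UNIV \<and> (\<forall>Y. finite Y \<and> X \<subseteq> Y \<and> Y \<subseteq> UNIV \<longrightarrow> dist (\<Sum>n\<in>Y. (norm (fcoeff F (-n)))\<^sup>2) S < e)"
    proof (intro exI[of _ A] conjI allI impI A(1) subset_UNIV)
      fix Y assume Y: "finite Y \<and> A \<subseteq> Y \<and> Y \<subseteq> UNIV"
      hence "(\<Sum>n\<in>A. (norm (fcoeff F (-n)))\<^sup>2) \<le> (\<Sum>n\<in>Y. (norm (fcoeff F (-n)))\<^sup>2)"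
        by (intro sum_mono2) auto
      thus "dist (\<Sum>n\<in>Y. (norm (fcoeff F (-n)))\<^sup>2) S < e"
        using A(2) bessel[of Y] Y by (simp add: dist_real_def)
    qed
  qed
  hence "sq_nn count_int (\<lambda>n. fcoeff F (-n)) = ennreal S"
    by (rule nn_integral_count_space_has_sum) simp
  moreover have "sq_nn count_int (\<lambda>n. fcoeff F (-n)) =
      sq_nn count_int (fcoeff F)"
    by (rule nn_integral_bij_count_space[of uminus]) (auto simp: bij_betw_def)
  ultimately show ?thesis by (simp add: S_def)
qed

section \<open>Periodization and Plancherel's identity\<close>

lemma integral_Ico_scale:
  fixes g :: "real \<Rightarrow> 'a::{banach, second_countable_topology}"
  assumes "T > 0"
  shows "(\<integral>x. g x \<partial>Ico T) = T *\<^sub>R (\<integral>x. g (T * x) \<partial>Ico 1)"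
proof -
  have "(\<integral>x. g x \<partial>Ico T) = (\<integral>x. indicator {0..<T} x *\<^sub>R g x \<partial>lborel)"
    by (subst integral_restrict_space) auto
  also have "\<dots> = T *\<^sub>R (\<integral>x. indicator {0..<T} (0 + T * x) *\<^sub>R g (0 + T * x) \<partial>lborel)"
    using assms by (subst lborel_integral_real_affine[where c = T and t = 0]) auto
  also have "(\<lambda>x. indicator {0..<T} (0 + T * x) *\<^sub>R g (0 + T * x)) = (\<lambda>x. indicator {0..<1} x *\<^sub>R g (T * x))"
    using assms by (auto simp: indicator_def fun_eq_iff zero_le_mult_iff)
  also have "(\<integral>x. indicator {0..<1} x *\<^sub>R g (T * x) \<partial>lborel) = (\<integral>x. g (T * x) \<partial>Ico 1)"
    by (subst integral_restrict_space) auto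
  finally show ?thesis .
qed

lemma parseval_Ico:
  fixes F :: "real \<Rightarrow> complex"
  assumes T: "T > 0" and [measurable]: "F \<in> borel_measurable borel" and B: "\<And>x. norm (F x) \<le> B"
  shows "sq_nn count_int (\<lambda>n. \<integral>x. F x * cis (2 * pi * of_int n * x / T) \<partial>Ico T)
       = ennreal T * ennreal (\<integral>x. (norm (F x))\<^sup>2 \<partial>Ico T)"
proof -
  define F' where "F' x = F (T * x)" for x
  have [measurable]: "F' \<in> borel_measurable borel" unfolding F'_def by measurable
  have c: "(\<integral>x. F x * cis (2 * pi * of_int n * x / T) \<partial>Ico T) = T *\<^sub>R fcoeff F' n" for n
    using T by (subst integral_Ico_scale) (auto simp: fcoeff_def F'_def mult.assoc)
  have "sq_nn count_int (\<lambda>n. \<integral>x. F x * cis (2 * pi * of_int n * x / T) \<partial>Ico T)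
     = (\<integral>\<^sup>+n. ennreal (T\<^sup>2) * ennreal ((norm (fcoeff F' n))\<^sup>2) \<partial>count_space UNIV)"
    unfolding c by (intro nn_integral_cong) (simp add: power_mult_distrib ennreal_mult)
  also have "\<dots> = ennreal (T\<^sup>2) * sq_nn count_int (fcoeff F')"
    by (rule nn_integral_cmult) simp
  also have "\<dots> = ennreal (T\<^sup>2) * ennreal (\<integral>x. (norm (F' x))\<^sup>2 \<partial>Ico 1)"
    by (subst parseval_Ico_1[of F' B]) (auto simp: F'_def B)
  also have "\<dots> = ennreal T * ennreal (T * (\<integral>x. (norm (F' x))\<^sup>2 \<partial>Ico 1))"
    using T by (simp add: ennreal_mult[symmetric] power2_eq_square mult.assoc)
  also have "T * (\<integral>x. (norm (F' x))\<^sup>2 \<partial>Ico 1) = (\<integral>x. (norm (F x))\<^sup>2 \<partial>Ico T)"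
    using T by (subst integral_Ico_scale) (auto simp: F'_def)
  finally show ?thesis .
qed

text \<open>Half-open intervals of length T tile the line: x lies in exactly one translate, the one
  with index \<open>\<lfloor>x / T\<rfloor>\<close>.\<close>

lemma nn_integral_periodize:
  fixes u :: "real \<Rightarrow> ennreal"
  assumes T: "T > 0" and [measurable]: "u \<in> borel_measurable borel"
  shows "(\<integral>\<^sup>+x. u x \<partial>lborel) = (\<integral>\<^sup>+p. \<integral>\<^sup>+x. u (x + of_int p * T) \<partial>Ico T \<partial>count_int)"
proof -
  have ind: "(\<integral>\<^sup>+p. u x * indicator {0..<T} (x - of_int p * T) \<partial>count_int) = u x" for x
  proof -
    have "x - of_int p * T \<in> {0..<T} \<longleftrightarrow> p = \<lfloor>x / T\<rfloor>" for p
    proof -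
      have "x - of_int p * T \<in> {0..<T} \<longleftrightarrow> of_int p \<le> x / T \<and> x / T < of_int p + 1"
        using T by (auto simp: field_simps)
      thus ?thesis by (metis floor_eq_iff)
    qed
    hence "(\<integral>\<^sup>+p. u x * indicator {0..<T} (x - of_int p * T) \<partial>count_int) =
        (\<integral>\<^sup>+p. u x * indicator {\<lfloor>x / T\<rfloor>} p \<partial>count_space UNIV)"
      by (intro nn_integral_cong) (simp add: indicator_def)
    thus ?thesis by (simp add: nn_integral_cmult_indicator)
  qed
  have "(\<integral>\<^sup>+x. u x \<partial>lborel) = (\<integral>\<^sup>+x. \<integral>\<^sup>+p. u x * indicator {0..<T} (x - of_int p * T) \<partial>count_int \<partial>lborel)"
    by (simp only: ind)
  also have "\<dots> = (\<integral>\<^sup>+p. \<integral>\<^sup>+x. u x * indicator {0..<T} (x - of_int p * T) \<partial>lborel \<partial>count_int)"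
    by (rule nn_integral_count_space_nn_integral) auto
  also have "\<dots> = (\<integral>\<^sup>+p. \<integral>\<^sup>+x. u (x + of_int p * T) \<partial>Ico T \<partial>count_int)"
  proof (rule nn_integral_cong)
    fix p :: int
    have "(\<integral>\<^sup>+x. u x * indicator {0..<T} (x - of_int p * T) \<partial>lborel)
       = (\<integral>\<^sup>+x. u (of_int p * T + 1 * x) * indicator {0..<T} (of_int p * T + 1 * x - of_int p * T) \<partial>lborel)"
      by (subst nn_integral_real_affine[where c = 1 and t = "of_int p * T"]) auto
    also have "\<dots> = (\<integral>\<^sup>+x. u (x + of_int p * T) \<partial>Ico T)"
      by (subst nn_integral_restrict_space) (auto simp: add.commute)
    finally show "(\<integral>\<^sup>+x. u x * indicator {0..<T} (x - of_int p * T) \<partial>lborel) = (\<integral>\<^sup>+x. u (x + of_int p * T) \<partial>Ico T)" .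
  qed
  finally show ?thesis .
qed

text \<open>Stated for measures so that Bochner integrability also transfers to the product measure,
  where Fubini's theorem applies.\<close>

lemma lborel_eq_periodized:
  assumes T: "T > 0"
  shows "lborel = distr (count_int \<Otimes>\<^sub>M Ico T) borel (\<lambda>(p, x). x + of_int p * T)"
proof -
  interpret finite_measure "Ico T" by (rule finite_measure_Ico)
  have m: "(\<lambda>(p, x). x + of_int p * T) \<in> measurable (count_int \<Otimes>\<^sub>M Ico T) borel"
    by (rule measurable_pair_measure_countable1) (auto intro!: measurable_restrict_space1)
  show ?thesis
  proof (rule measure_eqI)
    fix A :: "real set" assume "A \<in> sets lborel"
    hence [measurable]: "A \<in> sets borel" by simp
    have mi: "(\<lambda>(p, x). indicator A (x + of_int p * T) :: ennreal) \<in> borel_measurable (count_int \<Otimes>\<^sub>M Ico T)"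
      by (rule measurable_pair_measure_countable1) (auto intro!: measurable_restrict_space1)
    have "emeasure (distr (count_int \<Otimes>\<^sub>M Ico T) borel (\<lambda>(p, x). x + of_int p * T)) A =
       (\<integral>\<^sup>+x. indicator A x \<partial>distr (count_int \<Otimes>\<^sub>M Ico T) borel (\<lambda>(p, x). x + of_int p * T))"
      by (subst nn_integral_indicator) auto
    also have "\<dots> = (\<integral>\<^sup>+z. indicator A (case z of (p, x) \<Rightarrow> x + of_int p * T) \<partial>(count_int \<Otimes>\<^sub>M Ico T))"
      by (rule nn_integral_distr[OF m]) auto
    also have "\<dots> = (\<integral>\<^sup>+p. \<integral>\<^sup>+x. indicator A (x + of_int p * T) \<partial>Ico T \<partial>count_space UNIV)"
      by (subst nn_integral_fst[symmetric]) (use mi in \<open>auto simp: case_prod_unfold\<close>)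
    also have "\<dots> = (\<integral>\<^sup>+x. indicator A x \<partial>lborel)"
      by (rule nn_integral_periodize[OF T, symmetric]) auto
    also have "\<dots> = emeasure lborel A" by (subst nn_integral_indicator) auto
    finally show "emeasure lborel A = emeasure (distr (count_int \<Otimes>\<^sub>M Ico T) borel (\<lambda>(p, x). x + of_int p * T)) A" ..
  qed auto
qed

lemma pair_sigma_finite_periodize: "pair_sigma_finite (count_int) (Ico T)"
proof -
  interpret finite_measure "Ico T" by (rule finite_measure_Ico)
  show ?thesis by (intro pair_sigma_finite.intro sigma_finite_measure_count_space_countable) (auto intro: sigma_finite_measure_axioms)
qed

lemma measurable_count_space_integral:
  fixes f :: "int \<Rightarrow> real \<Rightarrow> 'a::{banach, second_countable_topology}"
  assumes "\<And>p. f p \<in> borel_measurable borel"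
  shows "(\<lambda>x. \<integral>p. f p x \<partial>count_space UNIV) \<in> borel_measurable borel"
proof -
  interpret sigma_finite_measure "count_int"
    by (rule sigma_finite_measure_count_space_countable) auto
  have "case_prod (\<lambda>x p. f p x) \<in> borel_measurable (borel \<Otimes>\<^sub>M count_space UNIV)"
    unfolding case_prod_unfold
    by (rule measurable_compose_countable[where f = "\<lambda>p z. f p (fst z)" and g = snd])
      (use assms in \<open>auto intro: measurable_compose[OF measurable_fst]\<close>)
  thus ?thesis by (rule borel_measurable_lebesgue_integral)
qed

lemma integral_periodize:
  fixes H :: "real \<Rightarrow> 'a::{banach, second_countable_topology}"
  assumes T: "T > 0" and H: "integrable lborel H"
  shows "(\<integral>x. H x \<partial>lborel) = (\<integral>x. (\<integral>p. H (x + of_int p * T) \<partial>count_int) \<partial>Ico T)"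
proof -
  interpret pair_sigma_finite "count_int" "Ico T" by (rule pair_sigma_finite_periodize)
  have m: "(\<lambda>(p, x). x + of_int p * T) \<in> measurable (count_int \<Otimes>\<^sub>M Ico T) borel"
    by (rule measurable_pair_measure_countable1) (auto intro!: measurable_restrict_space1)
  have Hm: "H \<in> borel_measurable borel" using H by auto
  have "integrable (count_int \<Otimes>\<^sub>M Ico T) (\<lambda>z. H (case z of (p, x) \<Rightarrow> x + of_int p * T))"
    using H unfolding integrable_distr_eq[OF m Hm, symmetric] lborel_eq_periodized[OF T, symmetric] .
  hence int: "integrable (count_int \<Otimes>\<^sub>M Ico T) (\<lambda>(p, x). H (x + of_int p * T))"
    by (simp add: case_prod_unfold)
  have "(\<integral>x. H x \<partial>lborel) = (\<integral>x. H x \<partial>distr (count_int \<Otimes>\<^sub>M Ico T) borel (\<lambda>(p, x). x + of_int p * T))"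
    by (subst lborel_eq_periodized[OF T]) simp
  also have "\<dots> = (\<integral>z. H (case z of (p, x) \<Rightarrow> x + of_int p * T) \<partial>(count_int \<Otimes>\<^sub>M Ico T))"
    by (rule integral_distr[OF m Hm])
  also have "\<dots> = (\<integral>x. (\<integral>p. H (x + of_int p * T) \<partial>count_int) \<partial>Ico T)"
    using integral_snd[OF int] by (simp add: case_prod_unfold)
  finally show ?thesis .
qed

text \<open>Characters of period T see only the periodization of H, which B keeps bounded, so
  Parseval on one period applies. It is used twice: in time for Plancherel's identity and in
  frequency for the sum over the translates of the window.\<close>

lemma parseval_periodized:
  fixes H :: "real \<Rightarrow> complex"
  assumes T: "T > 0" and H: "integrable lborel H"
    and B: "\<And>x. (\<integral>\<^sup>+p. norm (H (x + of_int p * T)) \<partial>count_int) \<le> ennreal B"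
  shows "sq_nn count_int (\<lambda>n. \<integral>x. H x * cis (2 * pi * of_int n * x / T) \<partial>lborel)
       = ennreal T * sq_nn (Ico T) (\<lambda>x. \<integral>p. H (x + of_int p * T) \<partial>count_int)"
proof -
  have [measurable]: "H \<in> borel_measurable borel" using H by auto
  define F where "F x = (\<integral>p. H (x + of_int p * T) \<partial>count_int)" for x
  have [measurable]: "F \<in> borel_measurable borel"
    unfolding F_def by (rule measurable_count_space_integral) measurable
  have int: "integrable (count_int) (\<lambda>p. H (x + of_int p * T))" for x
    using B[of x] by (intro integrableI_bounded) (auto intro: order.strict_trans1)
  have FB: "norm (F x) \<le> max 0 B" for x
  proof -
    have "ennreal (norm (F x)) \<le> (\<integral>\<^sup>+p. norm (H (x + of_int p * T)) \<partial>count_int)"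
      unfolding F_def by (rule integral_norm_bound_ennreal[OF int])
    also have "\<dots> \<le> ennreal (max 0 B)" using B[of x] by (simp add: ennreal_max_0)
    finally show ?thesis by simp
  qed
  have iH: "integrable lborel (\<lambda>x. H x * cis (2 * pi * of_int n * x / T))" for n :: int
    by (rule Bochner_Integration.integrable_bound[OF H]) (auto simp: norm_mult)
  have "(\<integral>x. H x * cis (2 * pi * of_int n * x / T) \<partial>lborel) = (\<integral>x. F x * cis (2 * pi * of_int n * x / T) \<partial>Ico T)" for n :: int
  proof -
    have "cis (2 * pi * of_int n * (x + of_int p * T) / T) = cis (2 * pi * of_int n * x / T)" for x p
    proof -
      have "2 * pi * of_int n * (x + of_int p * T) / T = 2 * pi * of_int n * x / T + 2 * pi * of_int (n * p)"
        using T by (simp add: field_simps)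
      thus ?thesis by (simp add: cis_mult[symmetric] del: of_int_mult)
    qed
    thus ?thesis unfolding integral_periodize[OF T iH] by (simp add: F_def)
  qed
  hence "sq_nn count_int (\<lambda>n. \<integral>x. H x * cis (2 * pi * of_int n * x / T) \<partial>lborel)
     = ennreal T * ennreal (\<integral>x. (norm (F x))\<^sup>2 \<partial>Ico T)"
    using parseval_Ico[OF T _ FB] by simp
  also have "ennreal (\<integral>x. (norm (F x))\<^sup>2 \<partial>Ico T) = sq_nn (Ico T) F"
    using FB by (intro nn_integral_eq_integral[symmetric] integrable_Ico_bounded[of _ _ "(max 0 B)\<^sup>2"])
      (auto intro!: power_mono)
  finally show ?thesis by (simp add: F_def)
qed

section \<open>The Fourier transform and Plancherel's identity\<close>

definition fourier :: "(real \<Rightarrow> complex) \<Rightarrow> real \<Rightarrow> complex" where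
  "fourier f \<xi> = (\<integral>t. f t * cis (- (2 * pi * \<xi> * t)) \<partial>lborel)"

lemma fourier_measurable [measurable]:
  assumes [measurable]: "f \<in> borel_measurable borel"
  shows "fourier f \<in> borel_measurable borel"
proof -
  have "(\<lambda>\<xi>. \<integral>t. f t * cis (- (2 * pi * \<xi> * t)) \<partial>lborel) \<in> borel_measurable borel"
    by (rule lborel.borel_measurable_lebesgue_integral) measurable
  thus ?thesis by (simp add: fourier_def[abs_def])
qed

lemma norm_fourier_le: "norm (fourier f \<xi>) \<le> (\<integral>t. norm (f t) \<partial>lborel)"
  unfolding fourier_def
  by (rule order_trans[OF integral_norm_bound]) (simp add: norm_mult)

lemma nn_integral_int_shift: "(\<integral>\<^sup>+n. f (n + k) \<partial>count_space UNIV) = (\<integral>\<^sup>+n. f n \<partial>count_int)"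
  by (rule nn_integral_bij_count_space[of "\<lambda>n. n + k"]) (rule bij_betw_byWitness[of _ "\<lambda>n. n - k"]; auto)

lemma nn_integral_int_uminus: "(\<integral>\<^sup>+n. f (- n) \<partial>count_space UNIV) = (\<integral>\<^sup>+n. f n \<partial>count_int)"
  by (rule nn_integral_bij_count_space[of uminus]) (auto simp: bij_betw_def)

text \<open>For T = 2R the translates of the support are disjoint, so periodizing loses no energy.
  The samples of the transform at spacing 1/T starting from \<xi> are Fourier coefficients of a
  modulated copy of f, with energy independent of \<xi>; integration over \<xi> in [0, 1/T) collects
  all frequencies.\<close>

lemma plancherel_bounded_support:
  fixes f :: "real \<Rightarrow> complex"
  assumes [measurable]: "f \<in> borel_measurable borel" and B: "\<And>t. norm (f t) \<le> B"
    and R: "R > 0" and supp: "\<And>t. R \<le> \<bar>t\<bar> \<Longrightarrow> f t = 0"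
  shows "sq_nn lborel (fourier f) = sq_nn lborel f"
proof -
  define T where "T = 2 * R"
  have T: "T > 0" using R by (simp add: T_def)
  have intf: "integrable lborel f"
  proof -
    have "integrable lborel (\<lambda>t. indicator {-R..R} t *\<^sub>R B)"
      by (intro integrable_scaleR_left integrable_real_indicator) (auto simp: emeasure_lborel_Icc_eq)
    thus ?thesis by (rule Bochner_Integration.integrable_bound)
      (use B supp in \<open>auto simp: indicator_def intro!: AE_I2 order_trans[OF B]\<close>)
  qed
  have single: "\<exists>p0. \<forall>p. p \<noteq> p0 \<longrightarrow> f (x + of_int p * T) = 0" for x
  proof -
    have "f (x + of_int p * T) = 0" if "p \<noteq> - \<lfloor>x / T + 1 / 2\<rfloor>" for p
    proof (rule supp, rule ccontr)
      assume "\<not> R \<le> \<bar>x + of_int p * T\<bar>"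
      hence "- of_int p \<le> x / T + 1 / 2" "x / T + 1 / 2 < - of_int p + 1"
        using R by (auto simp: T_def field_simps)
      hence "\<lfloor>x / T + 1 / 2\<rfloor> = - p" by (intro floor_unique) auto
      thus False using that by simp
    qed
    thus ?thesis by blast
  qed
  have slice: "sq_nn count_int (\<lambda>m. fourier f (\<xi> + of_int m * (1 / T)))
      = ennreal T * sq_nn lborel f" for \<xi>
  proof -
    define H where "H t = f t * cis (- (2 * pi * \<xi> * t))" for t
    have [measurable]: "H \<in> borel_measurable borel" unfolding H_def by measurable
    have nH: "norm (H t) = norm (f t)" for t by (simp add: H_def norm_mult)
    have iH: "integrable lborel H" by (rule Bochner_Integration.integrable_bound[OF intf]) (auto simp: nH)
    \<comment> \<open>The only translate of the support that can contain the point; every sum over p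
      collapses to this term.\<close>
    obtain p0 where p0: "\<And>x p. p \<noteq> p0 x \<Longrightarrow> H (x + of_int p * T) = 0"
      using single unfolding H_def by (metis mult_zero_left)
    have s1: "(\<integral>p. H (x + of_int p * T) \<partial>count_int) = H (x + of_int (p0 x) * T)" for x
    proof -
      have "(\<integral>p. H (x + of_int p * T) \<partial>count_int) = (\<integral>p. indicator {p0 x} p *\<^sub>R H (x + of_int (p0 x) * T) \<partial>count_space UNIV)"
        by (intro Bochner_Integration.integral_cong refl) (auto simp: indicator_def p0)
      thus ?thesis by simp
    qed
    have s2: "(\<integral>\<^sup>+p. v (norm (H (x + of_int p * T))) \<partial>count_int) = v (norm (H (x + of_int (p0 x) * T)))"
      if "v 0 = 0" for x and v :: "real \<Rightarrow> ennreal"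
    proof -
      have "(\<integral>\<^sup>+p. v (norm (H (x + of_int p * T))) \<partial>count_int) =
          (\<integral>\<^sup>+p. v (norm (H (x + of_int (p0 x) * T))) * indicator {p0 x} p \<partial>count_space UNIV)"
        using that by (intro nn_integral_cong) (auto simp: indicator_def p0)
      thus ?thesis by (simp add: nn_integral_cmult_indicator)
    qed
    have "sq_nn count_int (\<lambda>m. fourier f (\<xi> + of_int m * (1 / T))) =
       sq_nn count_int (\<lambda>m. fourier f (\<xi> + of_int (- m) * (1 / T)))"
      by (rule nn_integral_int_uminus[symmetric])
    also have "\<dots> = sq_nn count_int (\<lambda>m. \<integral>x. H x * cis (2 * pi * of_int m * x / T) \<partial>lborel)"
    proof -
      have "f t * cis (- (2 * pi * (\<xi> + of_int (- m) * (1 / T)) * t)) = H t * cis (2 * pi * of_int m * t / T)" for t and m :: int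
        by (simp add: H_def mult.assoc cis_mult) (simp add: field_simps)
      thus ?thesis unfolding fourier_def by simp
    qed
    also have "\<dots> = ennreal T * sq_nn (Ico T) (\<lambda>x. \<integral>p. H (x + of_int p * T) \<partial>count_int)"
    proof (rule parseval_periodized[OF T iH])
      fix x
      show "(\<integral>\<^sup>+p. norm (H (x + of_int p * T)) \<partial>count_int) \<le> ennreal B"
        using s2[of ennreal x] B by (simp add: nH ennreal_leI)
    qed
    also have "sq_nn (Ico T) (\<lambda>x. \<integral>p. H (x + of_int p * T) \<partial>count_int)
       = (\<integral>\<^sup>+x. \<integral>\<^sup>+p. ennreal ((norm (f (x + of_int p * T)))\<^sup>2) \<partial>count_int \<partial>Ico T)"
      using s2[of "\<lambda>y. ennreal (y\<^sup>2)"] by (intro nn_integral_cong) (simp add: s1 nH)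
    also have "\<dots> = (\<integral>\<^sup>+p. \<integral>\<^sup>+x. ennreal ((norm (f (x + of_int p * T)))\<^sup>2) \<partial>Ico T \<partial>count_int)"
      by (rule nn_integral_count_space_nn_integral) (auto intro!: measurable_restrict_space1)
    also have "\<dots> = sq_nn lborel f"
      by (rule nn_integral_periodize[OF T, symmetric]) measurable
    finally show ?thesis .
  qed
  have T': "1 / T > 0" using T by simp
  have "sq_nn lborel (fourier f) =
      (\<integral>\<^sup>+m. \<integral>\<^sup>+\<xi>. ennreal ((norm (fourier f (\<xi> + of_int m * (1 / T))))\<^sup>2) \<partial>Ico (1 / T) \<partial>count_int)"
    by (rule nn_integral_periodize[OF T']) measurable
  also have "\<dots> = (\<integral>\<^sup>+\<xi>. \<integral>\<^sup>+m. ennreal ((norm (fourier f (\<xi> + of_int m * (1 / T))))\<^sup>2) \<partial>count_int \<partial>Ico (1 / T))"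
    by (rule nn_integral_count_space_nn_integral[symmetric]) (auto intro!: measurable_restrict_space1)
  also have "\<dots> = ennreal T * sq_nn lborel f * emeasure (Ico (1 / T)) {0..<1 / T}"
    unfolding slice by simp
  also have "emeasure (Ico (1 / T)) {0..<1 / T} = ennreal (1 / T)"
    using T' by (simp add: emeasure_restrict_space)
  also have "ennreal T * sq_nn lborel f * ennreal (1 / T) =
     (ennreal T * ennreal (1 / T)) * sq_nn lborel f" by (simp only: mult_ac)
  also have "ennreal T * ennreal (1 / T) = 1" using T by (simp add: ennreal_mult[symmetric])
  finally show ?thesis by simp
qed

section \<open>The Fourier transform of the window\<close>

lemma exp_half_line:
  fixes s :: complex
  assumes s: "Re s < 0"
  shows "integrable lborel (\<lambda>x. indicator {0<..} x *\<^sub>R exp (s * of_real x))"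
    and "(\<integral>x. indicator {0<..} x *\<^sub>R exp (s * of_real x) \<partial>lborel) = - (1 / s)"
proof -
  have meas: "(\<lambda>x. indicator {0<..} x *\<^sub>R exp (s * of_real x)) \<in> borel_measurable lborel"
    by (auto intro!: borel_measurable_continuous_onI continuous_intros borel_measurable_scaleR borel_measurable_indicator)
  have "set_integrable lebesgue {0..} (\<lambda>x. exp (- (- Re s) * x))"
    using s by (intro nonnegative_absolutely_integrable_1 integrable_on_exp_minus_to_infinity) auto
  hence i0: "integrable lborel (\<lambda>x. indicator {0..} x *\<^sub>R exp (- (- Re s) * x))"
    unfolding set_integrable_def
    by (subst (asm) integrable_completion) (auto intro!: borel_measurable_continuous_onI continuous_intros borel_measurable_times borel_measurable_indicator)
  show int: "integrable lborel (\<lambda>x. indicator {0<..} x *\<^sub>R exp (s * of_real x))"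
    by (rule Bochner_Integration.integrable_bound[OF i0 meas]) (auto simp: indicator_def)
  have ei: "einterval 0 \<infinity> = {0::real<..}"
    by (auto simp: einterval_def zero_ereal_def)
  have snz: "s \<noteq> 0" using s by auto
  have "(LBINT x=0..\<infinity>. exp (s * of_real x)) = 0 - 1 / s"
  proof (rule interval_integral_FTC_integrable[where F = "\<lambda>x. exp (s * of_real x) / s"])
    fix x :: real
    show "((\<lambda>x. exp (s * of_real x) / s) has_vector_derivative exp (s * of_real x)) (at x)"
      using snz by (auto intro!: derivative_eq_intros has_vector_derivative_real_field)
    show "isCont (\<lambda>x. exp (s * complex_of_real x)) x" by (intro continuous_intros)
  next
    show "set_integrable lborel (einterval 0 \<infinity>) (\<lambda>x. exp (s * of_real x))"
      using int by (simp add: set_integrable_def ei)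
    have "((\<lambda>x. exp (s * of_real x) / s) \<longlongrightarrow> exp (s * of_real 0) / s) (at_right 0)"
      using snz by (intro tendsto_intros) auto
    thus "(((\<lambda>x. exp (s * complex_of_real x) / s) \<circ> real_of_ereal) \<longlongrightarrow> 1 / s) (at_right 0)"
      by (simp add: zero_ereal_def ereal_tendsto_simps)
    have "((\<lambda>x. exp (Re s * x)) \<longlongrightarrow> 0) at_top" using s by real_asymp
    hence "((\<lambda>x. norm (exp (s * complex_of_real x))) \<longlongrightarrow> 0) at_top" by simp
    hence "((\<lambda>x. exp (s * complex_of_real x)) \<longlongrightarrow> 0) at_top" by (rule tendsto_norm_zero_cancel)
    hence "((\<lambda>x. exp (s * complex_of_real x) / s) \<longlongrightarrow> 0 / s) at_top" using snz by (intro tendsto_intros)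
    thus "(((\<lambda>x. exp (s * complex_of_real x) / s) \<circ> real_of_ereal) \<longlongrightarrow> 0) (at_left \<infinity>)"
      by (simp add: ereal_tendsto_simps)
  qed auto
  thus "(\<integral>x. indicator {0<..} x *\<^sub>R exp (s * of_real x) \<partial>lborel) = - (1 / s)"
    by (simp add: interval_lebesgue_integral_def set_lebesgue_integral_def ei)
qed

lemma integral_reflect_lborel:
  fixes f :: "real \<Rightarrow> 'a :: {banach, second_countable_topology}"
  shows "(\<integral>x. f (- x) \<partial>lborel) = (\<integral>x. f x \<partial>lborel)"
  using lborel_integral_real_affine[of "-1" f 0] by simp

lemma integrable_reflect_lborel:
  fixes f :: "real \<Rightarrow> 'a :: {banach, second_countable_topology}"
  shows "integrable lborel f \<Longrightarrow> integrable lborel (\<lambda>x. f (- x))"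
  using lborel_integrable_real_affine[of f "-1" 0] by simp

lemma integrable_exp_abs:
  assumes "\<kappa> > 0"
  shows "integrable lborel (\<lambda>x::real. exp (- \<kappa> * \<bar>x\<bar>))"
proof -
  have i: "integrable lborel (\<lambda>x. indicator {0<..} x *\<^sub>R exp (complex_of_real (- \<kappa>) * of_real x))"
    using assms by (intro exp_half_line) auto
  have "integrable lborel (\<lambda>x. norm (indicator {0<..} x *\<^sub>R exp (complex_of_real (- \<kappa>) * of_real x)) +
     norm (indicator {0<..} (-x) *\<^sub>R exp (complex_of_real (- \<kappa>) * of_real (-x))))"
    using integrable_norm[OF i] integrable_norm[OF integrable_reflect_lborel[OF i]] by (rule Bochner_Integration.integrable_add)
  thus ?thesis
  proof (rule Bochner_Integration.integrable_cong_AE[THEN iffD1, rotated -1])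
    have "AE x in lborel. x \<noteq> (0::real)" by (rule AE_lborel_singleton)
    thus "AE x in lborel. norm (indicator {0<..} x *\<^sub>R exp (complex_of_real (- \<kappa>) * of_real x)) +
     norm (indicator {0<..} (-x) *\<^sub>R exp (complex_of_real (- \<kappa>) * of_real (-x))) = exp (- \<kappa> * \<bar>x\<bar>)"
      by eventually_elim (auto simp: indicator_def)
  qed (auto intro!: borel_measurable_continuous_onI continuous_intros borel_measurable_scaleR borel_measurable_times borel_measurable_indicator borel_measurable_add borel_measurable_norm)
qed

text \<open>Comparison with an integral: moving the argument by s in [0, T) costs at most a factor
  \<open>exp (\<kappa> * T)\<close>, and integrating over s joins the shifted intervals to the whole
  line.\<close>

lemma exp_sum_bound:
  assumes \<kappa>: "\<kappa> > 0" and T: "T > 0"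
  shows "\<exists>C\<ge>0. \<forall>x::real. (\<integral>\<^sup>+p. ennreal (exp (- \<kappa> * \<bar>x + of_int p * T\<bar>)) \<partial>count_int) \<le> ennreal C"
proof -
  define I where "I = (\<integral>x. exp (- \<kappa> * \<bar>x\<bar>) \<partial>lborel)"
  have I: "(\<integral>\<^sup>+x. ennreal (exp (- \<kappa> * \<bar>x\<bar>)) \<partial>lborel) = ennreal I"
    unfolding I_def by (intro nn_integral_eq_integral integrable_exp_abs \<kappa>) auto
  have I0: "I \<ge> 0" by (simp add: I_def)
  have "(\<integral>\<^sup>+p. ennreal (exp (- \<kappa> * \<bar>x + of_int p * T\<bar>)) \<partial>count_int) \<le> ennreal (exp (\<kappa> * T) * I / T)" for x
  proof -
    let ?S = "\<integral>\<^sup>+p. ennreal (exp (- \<kappa> * \<bar>x + of_int p * T\<bar>)) \<partial>count_int"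
    have "?S * ennreal T = (\<integral>\<^sup>+s. ?S \<partial>Ico T)" using T by (simp add: emeasure_restrict_space)
    also have "\<dots> = (\<integral>\<^sup>+p. \<integral>\<^sup>+s. ennreal (exp (- \<kappa> * \<bar>x + of_int p * T\<bar>)) \<partial>Ico T \<partial>count_int)"
      by (rule nn_integral_count_space_nn_integral) auto
    also have "\<dots> \<le> (\<integral>\<^sup>+p. \<integral>\<^sup>+s. ennreal (exp (\<kappa> * T)) * ennreal (exp (- \<kappa> * \<bar>x + (s + of_int p * T)\<bar>)) \<partial>Ico T \<partial>count_int)"
    proof (intro nn_integral_mono)
      fix p :: int and s assume "s \<in> space (Ico T)"
      hence "\<bar>x + (s + of_int p * T)\<bar> \<le> T + \<bar>x + of_int p * T\<bar>" by auto
      hence "\<kappa> * \<bar>x + (s + of_int p * T)\<bar> \<le> \<kappa> * (T + \<bar>x + of_int p * T\<bar>)" using \<kappa> by (intro mult_left_mono) auto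
      hence "exp (- \<kappa> * \<bar>x + of_int p * T\<bar>) \<le> exp (\<kappa> * T) * exp (- \<kappa> * \<bar>x + (s + of_int p * T)\<bar>)"
        by (simp add: exp_add[symmetric] ring_distribs)
      thus "ennreal (exp (- \<kappa> * \<bar>x + of_int p * T\<bar>)) \<le> ennreal (exp (\<kappa> * T)) * ennreal (exp (- \<kappa> * \<bar>x + (s + of_int p * T)\<bar>))"
        by (simp add: ennreal_mult[symmetric])
    qed
    also have "\<dots> = (\<integral>\<^sup>+s. ennreal (exp (\<kappa> * T)) * ennreal (exp (- \<kappa> * \<bar>x + s\<bar>)) \<partial>lborel)"
      by (rule nn_integral_periodize[OF T, symmetric]) measurable
    also have "\<dots> = ennreal (exp (\<kappa> * T)) * (\<integral>\<^sup>+s. ennreal (exp (- \<kappa> * \<bar>x + 1 * s\<bar>)) \<partial>lborel)"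
      by (subst nn_integral_cmult) auto
    also have "(\<integral>\<^sup>+s. ennreal (exp (- \<kappa> * \<bar>x + 1 * s\<bar>)) \<partial>lborel) = (\<integral>\<^sup>+s. ennreal (exp (- \<kappa> * \<bar>s\<bar>)) \<partial>lborel)"
      using nn_integral_real_affine[of "\<lambda>s. ennreal (exp (- \<kappa> * \<bar>s\<bar>))" 1 x] by simp
    also have "ennreal (exp (\<kappa> * T)) * \<dots> = ennreal (exp (\<kappa> * T) * I)" unfolding I using I0 by (simp add: ennreal_mult)
    finally have *: "?S * ennreal T \<le> ennreal (exp (\<kappa> * T) * I)" .
    have "?S = ?S * ennreal T * ennreal (1 / T)"
      using T by (simp add: mult.assoc ennreal_mult[symmetric])
    also have "\<dots> \<le> ennreal (exp (\<kappa> * T) * I) * ennreal (1 / T)" by (intro mult_right_mono *) auto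
    also have "\<dots> = ennreal (exp (\<kappa> * T) * I / T)" using T I0 by (simp add: ennreal_mult[symmetric])
    finally show ?thesis .
  qed
  thus ?thesis using I0 T by (intro exI[of _ "exp (\<kappa> * T) * I / T"]) auto
qed

text \<open>One formula for both signs of \<open>Re w\<close>. It is supported on the half-line
  where the exponential decays, yet it differs from the restriction to the negative half-line only
  by a full exponential. The jump at 0 thus has the same form for all w, which the difference
  operator exploits.\<close>

lemma cauchy_transform:
  fixes w :: complex
  assumes w: "Re w \<noteq> 0"
  defines "f \<equiv> \<lambda>\<xi>. exp (2 * pi * of_real \<xi> * w) * (of_bool (\<xi> < 0) - of_bool (Re w < 0))"
  shows "integrable lborel f"
    and "(\<integral>\<xi>. f \<xi> * cis (2 * pi * \<xi> * t) \<partial>lborel) = 1 / (2 * pi * (w + \<i> * t))"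
proof -
  have fmeas [measurable]: "f \<in> borel_measurable lborel"
    unfolding f_def by measurable
  have nf: "norm (f \<xi>) = norm (f \<xi> * cis (2 * pi * \<xi> * t))" for \<xi> by (simp add: norm_mult)
  define s where "s = 2 * pi * (w + \<i> * of_real t)"
  have fs: "exp (2 * pi * of_real \<xi> * w) * cis (2 * pi * \<xi> * t) = exp (s * of_real \<xi>)" for \<xi>
    by (simp add: s_def cis_conv_exp exp_add[symmetric] algebra_simps)
  have "integrable lborel (\<lambda>\<xi>. f \<xi> * cis (2 * pi * \<xi> * t)) \<and> (\<integral>\<xi>. f \<xi> * cis (2 * pi * \<xi> * t) \<partial>lborel) = 1 / s"
  proof (cases "Re w < 0")
    case True
    hence rs: "Re s < 0" by (simp add: s_def mult_pos_neg)
    have ae: "AE \<xi> in lborel. - (indicator {0<..} \<xi> *\<^sub>R exp (s * of_real \<xi>)) = f \<xi> * cis (2 * pi * \<xi> * t)"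
    proof -
      have "AE x in lborel. x \<noteq> (0::real)" by (rule AE_lborel_singleton)
      thus ?thesis
      proof eventually_elim
        case (elim \<xi>)
        thus ?case using True fs[of \<xi>] by (cases "\<xi> < 0") (auto simp: f_def indicator_def)
      qed
    qed
    have m: "(\<lambda>\<xi>. - (indicator {0<..} \<xi> *\<^sub>R exp (s * of_real \<xi>))) \<in> borel_measurable lborel"
      using exp_half_line(1)[OF rs] by measurable
    show ?thesis
    proof
      show "integrable lborel (\<lambda>\<xi>. f \<xi> * cis (2 * pi * \<xi> * t))"
        by (subst integrable_cong_AE[symmetric, OF m _ ae]) (use exp_half_line(1)[OF rs] in \<open>auto simp del: scaleR_complex.sel\<close>)
      have "(\<integral>\<xi>. f \<xi> * cis (2 * pi * \<xi> * t) \<partial>lborel) = (\<integral>\<xi>. - (indicator {0<..} \<xi> *\<^sub>R exp (s * of_real \<xi>)) \<partial>lborel)"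
        by (subst integral_cong_AE[symmetric, OF m _ ae]) auto
      also have "\<dots> = 1 / s" by (subst integral_minus) (simp add: exp_half_line(2)[OF rs])
      finally show "(\<integral>\<xi>. f \<xi> * cis (2 * pi * \<xi> * t) \<partial>lborel) = 1 / s" .
    qed
  next
    case False
    hence "Re w > 0" using w by simp
    hence rs: "Re (- s) < 0" by (simp add: s_def)
    have eq: "(\<lambda>\<xi>. f \<xi> * cis (2 * pi * \<xi> * t)) = (\<lambda>\<xi>. indicator {0<..} (-\<xi>) *\<^sub>R exp (- s * of_real (- \<xi>)))"
    proof
      fix \<xi> show "f \<xi> * cis (2 * pi * \<xi> * t) = indicator {0<..} (-\<xi>) *\<^sub>R exp (- s * of_real (- \<xi>))"
        using False fs[of \<xi>] by (cases "\<xi> < 0") (auto simp: f_def indicator_def)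
    qed
    show ?thesis unfolding eq
      using integrable_reflect_lborel[OF exp_half_line(1)[OF rs]]
        integral_reflect_lborel[of "\<lambda>\<xi>. indicator {0<..} \<xi> *\<^sub>R exp (- s * of_real \<xi>)"] exp_half_line(2)[OF rs] by simp
  qed
  hence *: "integrable lborel (\<lambda>\<xi>. f \<xi> * cis (2 * pi * \<xi> * t))" "(\<integral>\<xi>. f \<xi> * cis (2 * pi * \<xi> * t) \<partial>lborel) = 1 / s"
    by blast+
  show "integrable lborel f"
    by (rule Bochner_Integration.integrable_bound[OF *(1) fmeas]) (auto simp: norm_mult)
  show "(\<integral>\<xi>. f \<xi> * cis (2 * pi * \<xi> * t) \<partial>lborel) = 1 / (2 * pi * (w + \<i> * t))"
    using *(2) by (simp add: s_def)
qed

context rational_window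
begin

definition g :: "real \<Rightarrow> complex" where "g t = (\<Sum>k<N. a k / (of_real t - \<i> * w k))"
definition window_ft :: "real \<Rightarrow> complex" where
  "window_ft \<xi> = 2 * pi * \<i> * (\<Sum>k<N. a k * (exp (2 * pi * of_real \<xi> * w k) * (of_bool (\<xi> < 0) - of_bool (Re (w k) < 0))))"

lemma window_ft_measurable [measurable]: "window_ft \<in> borel_measurable borel"
  unfolding window_ft_def[abs_def] by measurable

lemma window_ft_integrable: "integrable lborel window_ft"
  unfolding window_ft_def[abs_def] using cauchy_transform(1)[OF w_re]
  by (intro integrable_mult_right Bochner_Integration.integrable_sum) auto

text \<open>Since 1 / (t - i w) equals 2 pi i / (2 pi (w + i t)), each pole is one instance of the
  preceding integral; this is the origin of the constant in \<open>window_ft\<close>.\<close>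

lemma g_eq_transform: "g t = (\<integral>\<xi>. window_ft \<xi> * cis (2 * pi * \<xi> * t) \<partial>lborel)"
proof -
  define f where "f k = (\<lambda>\<xi>. exp (2 * pi * of_real \<xi> * w k) * (of_bool (\<xi> < 0) - of_bool (Re (w k) < 0)))" for k
  have i: "integrable lborel (\<lambda>\<xi>. a k * (f k \<xi> * cis (2 * pi * \<xi> * t)))" if "k < N" for k
  proof -
    have "integrable lborel (f k)" unfolding f_def by (rule cauchy_transform(1)[OF w_re[OF that]])
    hence "integrable lborel (\<lambda>\<xi>. f k \<xi> * cis (2 * pi * \<xi> * t))"
      by (rule Bochner_Integration.integrable_bound) (auto simp: norm_mult f_def)
    thus ?thesis by simp
  qed
  have "(\<integral>\<xi>. window_ft \<xi> * cis (2 * pi * \<xi> * t) \<partial>lborel) =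
     (\<integral>\<xi>. 2 * pi * \<i> * (\<Sum>k<N. a k * (f k \<xi> * cis (2 * pi * \<xi> * t))) \<partial>lborel)"
    by (simp add: window_ft_def f_def sum_distrib_right mult.assoc)
  also have "\<dots> = 2 * pi * \<i> * (\<Sum>k<N. a k * (\<integral>\<xi>. f k \<xi> * cis (2 * pi * \<xi> * t) \<partial>lborel))"
    using i by (simp add: Bochner_Integration.integral_sum)
  also have "\<dots> = 2 * pi * \<i> * (\<Sum>k<N. a k * (1 / (2 * pi * (w k + \<i> * t))))"
    unfolding f_def using cauchy_transform(2)[OF w_re] by simp
  also have "\<dots> = g t" unfolding g_def sum_distrib_left
  proof (intro sum.cong refl)
    fix k assume "k \<in> {..<N}"
    hence k: "Re (w k) \<noteq> 0" using w_re by simp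
    have ne: "w k + \<i> * t \<noteq> 0" "of_real t - \<i> * w k \<noteq> 0"
      using k by (auto simp: complex_eq_iff)
    have "2 * pi * \<i> * (a k * (1 / (2 * pi * X))) = a k / (- \<i> * X)" if "X \<noteq> 0" for X :: complex
      using that by (simp add: field_simps)
    from this[OF ne(1)] show "2 * pi * \<i> * (a k * (1 / (2 * pi * (w k + \<i> * t)))) = a k / (of_real t - \<i> * w k)"
      by (simp add: algebra_simps)
  qed
  finally show ?thesis ..
qed

lemma window_ft_bound: "\<exists>G \<kappa>. \<kappa> > 0 \<and> G \<ge> 0 \<and> (\<forall>\<xi>. norm (window_ft \<xi>) \<le> G * exp (- \<kappa> * \<bar>\<xi>\<bar>))"
proof -
  define \<mu> where "\<mu> = Min ((\<lambda>k. \<bar>Re (w k)\<bar>) ` {..<N})"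
  have \<mu>: "\<mu> > 0" unfolding \<mu>_def using w_re N_pos by (subst Min_gr_iff) (auto simp: lessThan_empty_iff)
  have \<mu>_le: "\<mu> \<le> \<bar>Re (w k)\<bar>" if "k < N" for k using that by (auto simp: \<mu>_def intro!: Min_le)
  define G where "G = 2 * pi * (\<Sum>k<N. norm (a k))"
  have "norm (window_ft \<xi>) \<le> G * exp (- (2 * pi * \<mu>) * \<bar>\<xi>\<bar>)" for \<xi>
  proof -
    have "norm (a k * (exp (2 * pi * of_real \<xi> * w k) * (of_bool (\<xi> < 0) - of_bool (Re (w k) < 0)))) \<le>
        norm (a k) * exp (- (2 * pi * \<mu>) * \<bar>\<xi>\<bar>)" if k: "k < N" for k
    proof -
      have "norm (exp (2 * pi * of_real \<xi> * w k) * (of_bool (\<xi> < 0) - of_bool (Re (w k) < 0))) \<le> exp (- (2 * pi * \<bar>Re (w k)\<bar>) * \<bar>\<xi>\<bar>)"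
        by (cases "\<xi> < 0"; cases "Re (w k) < 0") (auto simp: norm_mult abs_if)
      also have "\<dots> \<le> exp (- (2 * pi * \<mu>) * \<bar>\<xi>\<bar>)"
        using \<mu>_le[OF k] by (auto intro!: mult_right_mono)
      finally show ?thesis unfolding norm_mult[of "a k"] by (intro mult_left_mono) auto
    qed
    hence "norm (\<Sum>k<N. a k * (exp (2 * pi * of_real \<xi> * w k) * (of_bool (\<xi> < 0) - of_bool (Re (w k) < 0)))) \<le>
       (\<Sum>k<N. norm (a k) * exp (- (2 * pi * \<mu>) * \<bar>\<xi>\<bar>))" by (intro sum_norm_le) auto
    thus ?thesis by (simp add: window_ft_def G_def norm_mult sum_distrib_right[symmetric] mult.assoc)
  qed
  moreover have "G \<ge> 0" unfolding G_def by (intro mult_nonneg_nonneg sum_nonneg) auto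
  moreover have "2 * pi * \<mu> > 0" using \<mu> by simp
  ultimately show ?thesis by blast
qed

lemma window_ft_sum_bounds:
  "\<exists>C\<ge>0. (\<forall>x. (\<integral>\<^sup>+p. ennreal (norm (window_ft (x + of_int p * T))) \<partial>count_int) \<le> ennreal C) \<and>
     (\<forall>x. (\<integral>\<^sup>+n. ennreal (norm (window_ft (x - of_int n))) \<partial>count_int) \<le> ennreal C)"
proof -
  obtain G \<kappa> where G: "\<kappa> > 0" "G \<ge> 0" "\<And>\<xi>. norm (window_ft \<xi>) \<le> G * exp (- \<kappa> * \<bar>\<xi>\<bar>)" using window_ft_bound by blast
  have *: "\<exists>C\<ge>0. \<forall>x. (\<integral>\<^sup>+p. ennreal (norm (window_ft (x + of_int p * S))) \<partial>count_int) \<le> ennreal C" if S: "S > 0" for S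
  proof -
    obtain C where C: "C \<ge> 0" "\<And>x::real. (\<integral>\<^sup>+p. ennreal (exp (- \<kappa> * \<bar>x + of_int p * S\<bar>)) \<partial>count_int) \<le> ennreal C"
      using exp_sum_bound[OF G(1) S] by blast
    have "(\<integral>\<^sup>+p. ennreal (norm (window_ft (x + of_int p * S))) \<partial>count_int) \<le> ennreal (G * C)" for x
    proof -
      have "(\<integral>\<^sup>+p. ennreal (norm (window_ft (x + of_int p * S))) \<partial>count_int) \<le>
         (\<integral>\<^sup>+p. ennreal G * ennreal (exp (- \<kappa> * \<bar>x + of_int p * S\<bar>)) \<partial>count_int)"
        using G by (intro nn_integral_mono) (simp add: ennreal_mult[symmetric] ennreal_leI)
      also have "\<dots> = ennreal G * (\<integral>\<^sup>+p. ennreal (exp (- \<kappa> * \<bar>x + of_int p * S\<bar>)) \<partial>count_int)"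
        by (rule nn_integral_cmult) auto
      also have "\<dots> \<le> ennreal G * ennreal C" by (intro mult_left_mono C) auto
      finally show ?thesis using G(2) C(1) by (simp add: ennreal_mult)
    qed
    thus ?thesis using G(2) C(1) by (intro exI[of _ "G * C"]) auto
  qed
  obtain C1 where C1: "C1 \<ge> 0" "\<And>x. (\<integral>\<^sup>+p. ennreal (norm (window_ft (x + of_int p * T))) \<partial>count_int) \<le> ennreal C1"
    using *[OF T(2)] by blast
  obtain C2 where C2: "C2 \<ge> 0" "\<And>x. (\<integral>\<^sup>+p. ennreal (norm (window_ft (x + of_int p * 1))) \<partial>count_int) \<le> ennreal C2"
    using *[of 1] by auto
  have "(\<integral>\<^sup>+n. ennreal (norm (window_ft (x - of_int n))) \<partial>count_int) \<le> ennreal C2" for x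
    using C2(2)[of x] nn_integral_int_uminus[of "\<lambda>n. ennreal (norm (window_ft (x + of_int n * 1)))"] by simp
  thus ?thesis using C1(1) order_trans[OF C1(2) ennreal_leI] order_trans[OF _ ennreal_leI]
    by (intro exI[of _ "max C1 C2"]) (meson max.cobounded1 max.cobounded2 order_trans)
qed

text \<open>The fibre matrix at \<eta> applied to b; the integral over counting measure is a series
  that converges absolutely for bounded b.\<close>

definition dual_samples :: "real \<Rightarrow> (int \<Rightarrow> complex) \<Rightarrow> int \<Rightarrow> complex" where
  "dual_samples \<eta> b n = (\<integral>p. b p * window_ft (\<eta> + of_int p * T - of_int n) \<partial>count_space UNIV)"

lemma dual_samples_integrable:
  assumes "\<And>p. norm (b p) \<le> B"
  shows "integrable (count_int) (\<lambda>p. b p * window_ft (\<eta> + of_int p * T - of_int n))"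
proof -
  obtain C where C: "C \<ge> 0" "\<And>x. (\<integral>\<^sup>+p. ennreal (norm (window_ft (x + of_int p * T))) \<partial>count_int) \<le> ennreal C"
    using window_ft_sum_bounds by blast
  have "integrable (count_int) (\<lambda>p. window_ft ((\<eta> - of_int n) + of_int p * T))"
    using C(2)[of "\<eta> - of_int n"] by (intro integrableI_bounded) (auto intro: order.strict_trans1)
  hence "integrable (count_int) (\<lambda>p. B *\<^sub>R window_ft ((\<eta> - of_int n) + of_int p * T))" by simp
  thus ?thesis
  proof (rule Bochner_Integration.integrable_bound)
    show "AE p in count_space UNIV. norm (b p * window_ft (\<eta> + of_int p * T - of_int n)) \<le> norm (B *\<^sub>R window_ft ((\<eta> - of_int n) + of_int p * T))"
    proof (rule AE_I2)
      fix p
      have "norm (b p) \<le> \<bar>B\<bar>" using assms[of p] by linarith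
      thus "norm (b p * window_ft (\<eta> + of_int p * T - of_int n)) \<le> norm (B *\<^sub>R window_ft ((\<eta> - of_int n) + of_int p * T))"
        by (simp add: norm_mult mult_right_mono algebra_simps)
    qed
  qed simp
qed

text \<open>Schur's test: the modulus of the window transform is split into two square roots, and
  Cauchy-Schwarz leaves one factor C from the sum over p and one from the sum over n. The constant
  is independent of \<eta> and of B.\<close>

lemma dual_samples_upper:
  "\<exists>C\<ge>0. \<forall>\<eta> b B. (\<forall>p. norm (b p) \<le> B) \<longrightarrow>
    (sq_nn count_int (dual_samples \<eta> b)) \<le> ennreal C * sq_nn count_int b"
proof -
  obtain C where C: "C \<ge> 0" "\<And>x. (\<integral>\<^sup>+p. ennreal (norm (window_ft (x + of_int p * T))) \<partial>count_int) \<le> ennreal C"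
    "\<And>x. (\<integral>\<^sup>+n. ennreal (norm (window_ft (x - of_int n))) \<partial>count_int) \<le> ennreal C"
    using window_ft_sum_bounds by blast
  have "sq_nn count_int (dual_samples \<eta> b) \<le> ennreal (C * C) * sq_nn count_int b"
    if B: "\<And>p. norm (b p) \<le> B" for \<eta> b B
  proof -
    define y where "y p = \<eta> + of_int p * T" for p :: int
    have one: "ennreal ((norm (dual_samples \<eta> b n))\<^sup>2) \<le> ennreal C * (\<integral>\<^sup>+p. ennreal ((norm (b p))\<^sup>2 * norm (window_ft (y p - of_int n))) \<partial>count_space UNIV)" for n
    proof -
      have "ennreal (norm (dual_samples \<eta> b n)) \<le> (\<integral>\<^sup>+p. ennreal (norm (b p * window_ft (y p - of_int n))) \<partial>count_space UNIV)"
        unfolding dual_samples_def y_def by (rule integral_norm_bound_ennreal[OF dual_samples_integrable[OF B]])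
      also have "\<dots> = (\<integral>\<^sup>+p. ennreal (sqrt (norm (window_ft (y p - of_int n)))) * ennreal (norm (b p) * sqrt (norm (window_ft (y p - of_int n)))) \<partial>count_space UNIV)"
        by (intro nn_integral_cong) (simp add: ennreal_mult[symmetric] norm_mult mult.left_commute)
      finally have "(ennreal (norm (dual_samples \<eta> b n)))\<^sup>2 \<le> (\<integral>\<^sup>+p. ennreal (sqrt (norm (window_ft (y p - of_int n)))) * ennreal (norm (b p) * sqrt (norm (window_ft (y p - of_int n)))) \<partial>count_space UNIV)\<^sup>2"
        by (rule power_mono) simp
      also have "\<dots> \<le> (\<integral>\<^sup>+p. (ennreal (sqrt (norm (window_ft (y p - of_int n)))))\<^sup>2 \<partial>count_space UNIV) *
            (\<integral>\<^sup>+p. (ennreal (norm (b p) * sqrt (norm (window_ft (y p - of_int n)))))\<^sup>2 \<partial>count_space UNIV)"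
        by (rule Cauchy_Schwarz_nn_integral) auto
      also have "\<dots> = (\<integral>\<^sup>+p. ennreal (norm (window_ft ((\<eta> - of_int n) + of_int p * T))) \<partial>count_space UNIV) *
            (\<integral>\<^sup>+p. ennreal ((norm (b p))\<^sup>2 * norm (window_ft (y p - of_int n))) \<partial>count_space UNIV)"
        by (simp add: ennreal_power power_mult_distrib y_def algebra_simps)
      also have "\<dots> \<le> ennreal C * (\<integral>\<^sup>+p. ennreal ((norm (b p))\<^sup>2 * norm (window_ft (y p - of_int n))) \<partial>count_space UNIV)"
        by (intro mult_right_mono C) auto
      finally show ?thesis by (simp add: ennreal_power)
    qed
    have "sq_nn count_int (dual_samples \<eta> b) \<le>
       (\<integral>\<^sup>+n. ennreal C * (\<integral>\<^sup>+p. ennreal ((norm (b p))\<^sup>2 * norm (window_ft (y p - of_int n))) \<partial>count_space UNIV) \<partial>count_space UNIV)"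
      by (intro nn_integral_mono one)
    also have "\<dots> = ennreal C * (\<integral>\<^sup>+n. \<integral>\<^sup>+p. ennreal ((norm (b p))\<^sup>2 * norm (window_ft (y p - of_int n))) \<partial>count_space UNIV \<partial>count_space UNIV)"
      by (rule nn_integral_cmult) auto
    also have "(\<integral>\<^sup>+n. \<integral>\<^sup>+p. ennreal ((norm (b p))\<^sup>2 * norm (window_ft (y p - of_int n))) \<partial>count_space UNIV \<partial>count_int)
       = (\<integral>\<^sup>+p. \<integral>\<^sup>+n. ennreal ((norm (b p))\<^sup>2 * norm (window_ft (y p - of_int n))) \<partial>count_int \<partial>count_space UNIV)"
      by (rule nn_integral_count_space_nn_integral) auto
    also have "\<dots> = (\<integral>\<^sup>+p. ennreal ((norm (b p))\<^sup>2) * (\<integral>\<^sup>+n. ennreal (norm (window_ft (y p - of_int n))) \<partial>count_int) \<partial>count_space UNIV)"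
      by (intro nn_integral_cong) (simp add: ennreal_mult nn_integral_cmult)
    also have "\<dots> \<le> (\<integral>\<^sup>+p. ennreal ((norm (b p))\<^sup>2) * ennreal C \<partial>count_space UNIV)"
      by (intro nn_integral_mono mult_left_mono C) auto
    also have "\<dots> = sq_nn count_int b * ennreal C"
      by (rule nn_integral_multc) auto
    finally have "sq_nn count_int (dual_samples \<eta> b) \<le>
        ennreal C * (sq_nn count_int b * ennreal C)"
      by (simp add: mult_left_mono)
    thus ?thesis using C(1) by (simp add: ennreal_mult mult_ac)
  qed
  thus ?thesis using C(1) by (intro exI[of _ "C * C"]) auto
qed

end

section \<open>Bounds for the fibre matrices\<close>

context rational_window
begin

text \<open>The annihilating polynomial with all N factors, in contrast to \<open>q k\<close>, which
  omits the k-th.\<close>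

definition Q :: "nat \<Rightarrow> complex" where "Q i = coeff (\<Prod>l\<in>{..<N}. [:1, - z l:]) i"
text \<open>The ceiling of \<alpha> (r - \<eta>): the index of the first point at or above r,
  whether or not that point lies in cell r.\<close>

definition pidx :: "real \<Rightarrow> int \<Rightarrow> int" where "pidx \<eta> r = - \<lfloor>\<alpha> * (\<eta> - of_int r)\<rfloor>"
definition spread :: "real \<Rightarrow> (int \<Rightarrow> complex) \<Rightarrow> int \<Rightarrow> complex" where
  "spread \<eta> b r = (if rho \<eta> r < 1 then b (pidx \<eta> r) else 0)"

text \<open>Q is the k-th reduced polynomial times 1 - z X with z = \<open>z k\<close>, so the
  prefix sums at X = 1/z telescope. For n = N this says that 1/z is a root of Q.\<close>

lemma Q_prefix_sum: "(\<Sum>i\<le>n. Q i * (1 / z k) ^ i) = q k n * (1 / z k) ^ n" if k: "k < N"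
proof -
  have "(\<Prod>l\<in>{..<N}. [:1, - z l:]) = [:1, - z k:] * (\<Prod>l\<in>{..<N} - {k}. [:1, - z l:])"
    using k by (intro prod.remove) auto
  hence Q0: "Q 0 = q k 0" and QS: "Q (Suc i) = q k (Suc i) - z k * q k i" for i
    by (simp_all add: Q_def q_def)
  show ?thesis
  proof (induction n)
    case (Suc n)
    show ?case unfolding sum.atMost_Suc Suc.IH QS using z_nz[of k] by (simp add: field_simps)
  qed (simp add: Q0)
qed

text \<open>The operator with symbol Q annihilates every exponential of the window, so only the jump at 0
  survives, and the prefix sum of Q up to the jump gives the coefficient of the remaining factors.\<close>
lemma window_ft_difference:
  "(\<Sum>i\<le>N. Q i * window_ft (y - real i)) = (if y \<ge> 0 then - 2 * pi * \<i> * M (nat \<lfloor>y\<rfloor>) (of_real (frac y)) else 0)"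
proof -
  have one: "(\<Sum>i\<le>N. Q i * (exp (2 * pi * of_real (y - real i) * w k) * (of_bool (y - real i < 0) - of_bool (Re (w k) < 0)))) =
     (if y \<ge> 0 then - (exp (2 * pi * of_real (frac y) * w k) * q k (nat \<lfloor>y\<rfloor>)) else 0)" if k: "k < N" for k
  proof -
    have ex: "exp (2 * pi * of_real (y - real i) * w k) = exp (2 * pi * of_real y * w k) * (1 / z k) ^ i" for i
    proof -
      have "exp (2 * pi * of_real (y - real i) * w k) = exp (2 * pi * of_real y * w k - of_nat i * (2 * pi * w k))"
        by (simp add: algebra_simps)
      also have "\<dots> = exp (2 * pi * of_real y * w k) * (1 / z k) ^ i"
        by (simp only: exp_diff exp_of_nat_mult z_def power_one_over) simp
      finally show ?thesis .
    qed
    have full: "(\<Sum>i\<le>N. Q i * (1 / z k) ^ i) = 0" using Q_prefix_sum[OF k, of N] q_ge[OF k, of N] by simp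
    \<comment> \<open>The shifts that put the argument below 0 are those beyond the floor of y. The
      full sum vanishes, so they contribute minus the prefix sum.\<close>
    have part: "(\<Sum>i\<le>N. Q i * (1 / z k) ^ i * of_bool (y - real i < 0)) =
       (if y \<ge> 0 then - (q k (nat \<lfloor>y\<rfloor>) * (1 / z k) ^ nat \<lfloor>y\<rfloor>) else 0)"
    proof (cases "y \<ge> 0")
      case True
      define m where "m = nat \<lfloor>y\<rfloor>"
      have m: "y - real i < 0 \<longleftrightarrow> \<not> i \<le> m" for i using True unfolding m_def by linarith
      have "(\<Sum>i\<le>N. Q i * (1 / z k) ^ i * of_bool (y - real i < 0)) =
         (\<Sum>i\<le>N. Q i * (1 / z k) ^ i) - (\<Sum>i\<le>N. Q i * (1 / z k) ^ i * of_bool (i \<le> m))"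
        unfolding sum_subtractf[symmetric] by (intro sum.cong refl) (simp only: m of_bool_not_iff right_diff_distrib mult_1_right)
      also have "(\<Sum>i\<le>N. Q i * (1 / z k) ^ i * of_bool (i \<le> m)) = (\<Sum>i\<le>min N m. Q i * (1 / z k) ^ i)"
        by (intro sum.mono_neutral_cong_right) auto
      also have "\<dots> = q k m * (1 / z k) ^ m"
        using Q_prefix_sum[OF k] q_ge[OF k] by (cases "m \<le> N") (auto simp: min_def)
      finally show ?thesis using True by (simp add: full m_def)
    next
      case False
      hence "(\<Sum>i\<le>N. Q i * (1 / z k) ^ i * of_bool (y - real i < 0)) = (\<Sum>i\<le>N. Q i * (1 / z k) ^ i)"
        by (intro sum.cong) (auto simp: of_bool_def)
      thus ?thesis using False full by simp
    qed
    have "(\<Sum>i\<le>N. Q i * (exp (2 * pi * of_real (y - real i) * w k) * (of_bool (y - real i < 0) - of_bool (Re (w k) < 0)))) =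
       exp (2 * pi * of_real y * w k) * ((\<Sum>i\<le>N. Q i * (1 / z k) ^ i * of_bool (y - real i < 0)) -
         (\<Sum>i\<le>N. Q i * (1 / z k) ^ i) * of_bool (Re (w k) < 0))"
      unfolding ex sum_distrib_right right_diff_distrib sum_distrib_left sum_subtractf[symmetric]
      by (intro sum.cong refl) (simp add: algebra_simps)
    also have "\<dots> = (if y \<ge> 0 then - (exp (2 * pi * of_real y * w k) * (1 / z k) ^ nat \<lfloor>y\<rfloor> * q k (nat \<lfloor>y\<rfloor>)) else 0)"
      unfolding full part by simp
    also have "\<dots> = (if y \<ge> 0 then - (exp (2 * pi * of_real (frac y) * w k) * q k (nat \<lfloor>y\<rfloor>)) else 0)"
      unfolding ex[symmetric] by (simp add: frac_def)
    finally show ?thesis .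
  qed
  have "(\<Sum>i\<le>N. Q i * window_ft (y - real i)) = 2 * pi * \<i> * (\<Sum>k<N. a k *
      (\<Sum>i\<le>N. Q i * (exp (2 * pi * of_real (y - real i) * w k) * (of_bool (y - real i < 0) - of_bool (Re (w k) < 0)))))"
    unfolding window_ft_def sum_distrib_left by (subst sum.swap) (simp only: mult_ac)
  also have "\<dots> = 2 * pi * \<i> * (\<Sum>k<N. a k * (if y \<ge> 0 then - (exp (2 * pi * of_real (frac y) * w k) * q k (nat \<lfloor>y\<rfloor>)) else 0))"
    by (intro arg_cong2[of _ _ _ _ "(*)"] sum.cong refl one) simp
  also have "\<dots> = (if y \<ge> 0 then - 2 * pi * \<i> * M (nat \<lfloor>y\<rfloor>) (of_real (frac y)) else 0)"
    by (simp add: M_def sum_negf mult.assoc)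
  finally show ?thesis .
qed

lemma pidx_point: "\<eta> + of_int (pidx \<eta> r) * T = of_int r + rho \<eta> r"
proof -
  have "rho \<eta> r = (T * \<alpha>) * (\<eta> - of_int r) - T * of_int \<lfloor>\<alpha> * (\<eta> - of_int r)\<rfloor>"
    by (simp add: rho_def frac_def right_diff_distrib mult.assoc)
  thus ?thesis using T by (simp add: pidx_def)
qed

text \<open>Because the spacing exceeds 1, a point lying in cell r is the first one at or above r;
  each point is thus recovered from its cell.\<close>

lemma pidx_floor:
  assumes "r = \<lfloor>\<eta> + of_int p * T\<rfloor>"
  shows "pidx \<eta> r = p" "rho \<eta> r = frac (\<eta> + of_int p * T)"
proof -
  define f where "f = frac (\<eta> + of_int p * T)"
  have f: "0 \<le> f" "f < 1" by (auto simp: f_def frac_lt_1)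
  have "\<eta> - of_int r = f - of_int p * T" using assms by (simp add: f_def frac_def)
  hence "\<alpha> * (\<eta> - of_int r) = \<alpha> * f - of_int p * (\<alpha> * T)" by (simp add: right_diff_distrib)
  hence eq: "\<alpha> * (\<eta> - of_int r) = of_int (- p) + \<alpha> * f" using T by simp
  have af: "0 \<le> \<alpha> * f" "\<alpha> * f < 1" using f \<alpha> by (auto intro: mult_le_one[THEN order_le_less_trans] mult_strict_mono[of \<alpha> 1 f 1, simplified])
  have fl: "\<lfloor>\<alpha> * (\<eta> - of_int r)\<rfloor> = - p" unfolding eq using af by (intro floor_unique) auto
  thus "pidx \<eta> r = p" by (simp add: pidx_def)
  have "rho \<eta> r = T * (\<alpha> * f)" using fl eq by (simp add: rho_def frac_def)
  thus "rho \<eta> r = frac (\<eta> + of_int p * T)" using T by (simp add: f_def mult.assoc[symmetric])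
qed

text \<open>After the difference operator a point acts only on the N rows from its cell downwards,
  so the series over p becomes a finite band sum over occupied cells.\<close>

lemma dual_samples_difference:
  assumes B: "\<And>p. norm (b p) \<le> B"
  shows "(\<Sum>i\<le>N. Q i * dual_samples \<eta> b (n + int i)) = - 2 * pi * \<i> * H \<eta> (spread \<eta> b) n"
proof -
  define y where "y p = \<eta> + of_int p * T" for p :: int
  define \<phi> where "\<phi> p = b p * (if y p - of_int n \<ge> 0 then - 2 * pi * \<i> * M (nat \<lfloor>y p - of_int n\<rfloor>) (of_real (frac (y p - of_int n))) else 0)" for p
  have "(\<Sum>i\<le>N. Q i * dual_samples \<eta> b (n + int i)) = (\<integral>p. (\<Sum>i\<le>N. Q i * (b p * window_ft (y p - of_int (n + int i)))) \<partial>count_space UNIV)"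
    unfolding dual_samples_def y_def using dual_samples_integrable[OF B] by (simp add: Bochner_Integration.integral_sum del: of_int_add)
  also have "(\<lambda>p. \<Sum>i\<le>N. Q i * (b p * window_ft (y p - of_int (n + int i)))) = \<phi>"
  proof
    fix p
    have "(\<Sum>i\<le>N. Q i * (b p * window_ft (y p - of_int (n + int i)))) = b p * (\<Sum>i\<le>N. Q i * window_ft ((y p - of_int n) - real i))"
      unfolding sum_distrib_left by (intro sum.cong refl) (simp add: algebra_simps)
    thus "(\<Sum>i\<le>N. Q i * (b p * window_ft (y p - of_int (n + int i)))) = \<phi> p"
      unfolding \<phi>_def window_ft_difference .
  qed
  also have "(\<integral>p. \<phi> p \<partial>count_space UNIV) = - 2 * pi * \<i> * H \<eta> (spread \<eta> b) n"
  proof -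
    \<comment> \<open>The occupied cells in the band of row n; \<open>pidx\<close> is injective on
      them and reaches every point with a nonzero term.\<close>
    define Rr where "Rr = {r \<in> {n..<n + int N}. rho \<eta> r < 1}"
    have supp: "p \<in> pidx \<eta> ` Rr" if "\<phi> p \<noteq> 0" for p
    proof -
      define r where "r = \<lfloor>y p\<rfloor>"
      have pr: "pidx \<eta> r = p" "rho \<eta> r = frac (y p)" using pidx_floor[of r \<eta> p] by (auto simp: r_def y_def)
      have nz: "y p - of_int n \<ge> 0" "M (nat \<lfloor>y p - of_int n\<rfloor>) (of_real (frac (y p - of_int n))) \<noteq> 0"
        using that by (auto simp: \<phi>_def split: if_splits)
      hence "nat \<lfloor>y p - of_int n\<rfloor> < N" using M_ge by (metis not_le)
      hence "r \<in> Rr" using nz(1) pr by (auto simp: Rr_def r_def frac_lt_1 le_floor_iff)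
      thus ?thesis using pr by blast
    qed
    have finR: "finite Rr" by (rule finite_subset[of _ "{n..<n + int N}"]) (auto simp: Rr_def)
    have fl: "\<lfloor>y (pidx \<eta> r)\<rfloor> = r" "frac (y (pidx \<eta> r)) = rho \<eta> r" if "r \<in> Rr" for r
    proof -
      have *: "y (pidx \<eta> r) = of_int r + rho \<eta> r" by (simp add: y_def pidx_point)
      show "\<lfloor>y (pidx \<eta> r)\<rfloor> = r" unfolding * using that rho_bounds[of \<eta> r] by (intro floor_unique) (auto simp: Rr_def)
      thus "frac (y (pidx \<eta> r)) = rho \<eta> r" by (simp add: frac_def *)
    qed
    have inj: "inj_on (pidx \<eta>) Rr" using fl(1) by (metis inj_onI)
    have "(\<integral>p. \<phi> p \<partial>count_space UNIV) = (\<Sum>p | p \<in> UNIV \<and> \<phi> p \<noteq> 0. \<phi> p)"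
      by (rule lebesgue_integral_count_space_finite_support)
        (rule finite_subset[OF _ finite_imageI[OF finR]], use supp in auto)
    also have "\<dots> = (\<Sum>p\<in>pidx \<eta> ` Rr. \<phi> p)"
      using supp finR by (intro sum.mono_neutral_left) auto
    also have "\<dots> = (\<Sum>r\<in>Rr. \<phi> (pidx \<eta> r))" using inj by (simp add: sum.reindex)
    also have "\<dots> = (\<Sum>r\<in>Rr. - 2 * pi * \<i> * (M (nat (r - n)) (of_real (rho \<eta> r)) * spread \<eta> b r))"
    proof (intro sum.cong refl)
      fix r assume r: "r \<in> Rr"
      have "y (pidx \<eta> r) - of_int n \<ge> 0" using fl(1)[OF r] r by (simp add: Rr_def le_floor_iff[symmetric])
      moreover have "frac (y (pidx \<eta> r) - of_int n) = rho \<eta> r" using fl(2)[OF r] by (simp add: frac_def)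
      ultimately show "\<phi> (pidx \<eta> r) = - 2 * pi * \<i> * (M (nat (r - n)) (of_real (rho \<eta> r)) * spread \<eta> b r)"
        using fl(1)[OF r] r by (simp add: \<phi>_def spread_def Rr_def)
    qed
    also have "\<dots> = - 2 * pi * \<i> * (\<Sum>r\<in>Rr. M (nat (r - n)) (of_real (rho \<eta> r)) * spread \<eta> b r)"
      by (simp only: sum_distrib_left)
    also have "(\<Sum>r\<in>Rr. M (nat (r - n)) (of_real (rho \<eta> r)) * spread \<eta> b r) =
        (\<Sum>r\<in>{n..<n + int N}. M (nat (r - n)) (of_real (rho \<eta> r)) * spread \<eta> b r)"
      by (intro sum.mono_neutral_left) (auto simp: Rr_def spread_def)
    also have "\<dots> = H \<eta> (spread \<eta> b) n" unfolding H_def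
      by (rule sum.reindex_bij_witness[of _ "\<lambda>i. n + int i" "\<lambda>r. nat (r - n)"]) auto
    finally show ?thesis .
  qed
  finally show ?thesis .
qed

lemma spread_admissible: "admissible \<eta> (spread \<eta> b)"
  by (auto simp: admissible_def spread_def)

lemma norm_sum_mult_squared_le:
  fixes x y :: "'i \<Rightarrow> complex"
  shows "(norm (\<Sum>i\<in>A. x i * y i))\<^sup>2 \<le> (\<Sum>i\<in>A. (norm (x i))\<^sup>2) * (\<Sum>i\<in>A. (norm (y i))\<^sup>2)"
proof -
  have "norm (\<Sum>i\<in>A. x i * y i) \<le> (\<Sum>i\<in>A. norm (x i) * norm (y i))"
    by (rule order_trans[OF norm_sum]) (simp add: norm_mult)
  hence "(norm (\<Sum>i\<in>A. x i * y i))\<^sup>2 \<le> (\<Sum>i\<in>A. norm (x i) * norm (y i))\<^sup>2" by (intro power_mono) auto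
  also have "\<dots> \<le> (\<Sum>i\<in>A. (norm (x i))\<^sup>2) * (\<Sum>i\<in>A. (norm (y i))\<^sup>2)" by (rule Cauchy_Schwarz_ineq_sum)
  finally show ?thesis .
qed

lemma nn_integral_sum_shifts:
  fixes f :: "int \<Rightarrow> real"
  assumes "finite A" "\<And>n. f n \<ge> 0" "C \<ge> 0"
  shows "(\<integral>\<^sup>+n. ennreal (C * (\<Sum>k\<in>A. f (n + k))) \<partial>count_space UNIV) = ennreal (C * real (card A)) * (\<integral>\<^sup>+n. ennreal (f n) \<partial>count_space UNIV)"
proof -
  have "(\<integral>\<^sup>+n. ennreal (C * (\<Sum>k\<in>A. f (n + k))) \<partial>count_space UNIV) = (\<integral>\<^sup>+n. ennreal C * (\<Sum>k\<in>A. ennreal (f (n + k))) \<partial>count_space UNIV)"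
    using assms by (intro nn_integral_cong) (simp add: ennreal_mult sum_nonneg)
  also have "\<dots> = ennreal C * (\<Sum>k\<in>A. \<integral>\<^sup>+n. ennreal (f (n + k)) \<partial>count_space UNIV)"
    by (simp add: nn_integral_cmult nn_integral_sum)
  also have "\<dots> = ennreal C * (of_nat (card A) * (\<integral>\<^sup>+n. ennreal (f n) \<partial>count_space UNIV))"
    by (simp add: nn_integral_int_shift[of "\<lambda>n. ennreal (f n)"])
  finally show ?thesis using assms(3) by (simp add: ennreal_mult mult.assoc ennreal_of_nat_eq_real_of_nat)
qed

text \<open>The local bound turns into an l2 bound because every entry depends on a fixed number of
  rows and every row on a fixed number of samples: summing the squares costs only the number of
  shifts.\<close>

lemma dual_samples_lower:
  "\<exists>C\<ge>0. \<forall>\<eta> b B. (\<forall>p. norm (b p) \<le> B) \<longrightarrow>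
    (sq_nn count_int b) \<le> ennreal C * sq_nn count_int (dual_samples \<eta> b)"
proof -
  obtain K C where C: "C \<ge> 0" and loc: "\<And>\<eta> c r E. admissible \<eta> c \<Longrightarrow>
     (\<forall>n\<in>{r - int K..r + int K}. norm (H \<eta> c n) \<le> E) \<Longrightarrow> norm (c r) \<le> C * E"
    using uniform_local_bound by blast
  define D where "D = (\<Sum>i\<le>N. (norm (Q i))\<^sup>2) / (2 * pi)\<^sup>2"
  have D0: "D \<ge> 0" by (auto simp: D_def intro!: sum_nonneg divide_nonneg_nonneg)
  define C1 where "C1 = C\<^sup>2 * real (card {- int K..int K})"
  define C2 where "C2 = D * real (card (int ` {..N}))"
  have C12: "C1 \<ge> 0" "C2 \<ge> 0" using D0 by (auto simp: C1_def C2_def)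
  have "sq_nn count_int b \<le> ennreal (C1 * C2) * sq_nn count_int (dual_samples \<eta> b)"
    if B: "\<And>p. norm (b p) \<le> B" for \<eta> b B
  proof -
    define c where "c = spread \<eta> b"
    define fl where "fl p = \<lfloor>\<eta> + of_int p * T\<rfloor>" for p :: int
    have pfl: "pidx \<eta> (fl p) = p" "rho \<eta> (fl p) < 1" for p
      using pidx_floor[OF fl_def[of p]] frac_lt_1 by simp_all
    have cfl: "c (fl p) = b p" for p
      using pfl by (simp add: c_def spread_def)
    have injfl: "inj fl" by (rule inj_on_inverseI[of _ "pidx \<eta>"]) (rule pfl)
    have H2: "(norm (H \<eta> c n))\<^sup>2 \<le> D * (\<Sum>k\<in>int ` {..N}. (norm (dual_samples \<eta> b (n + k)))\<^sup>2)" for n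
    proof -
      have "(2 * pi)\<^sup>2 * (norm (H \<eta> c n))\<^sup>2 = (norm (\<Sum>i\<le>N. Q i * dual_samples \<eta> b (n + int i)))\<^sup>2"
        unfolding dual_samples_difference[OF B] c_def by (simp add: norm_mult power_mult_distrib)
      also have "\<dots> \<le> (\<Sum>i\<le>N. (norm (Q i))\<^sup>2) * (\<Sum>i\<le>N. (norm (dual_samples \<eta> b (n + int i)))\<^sup>2)"
        by (rule norm_sum_mult_squared_le)
      also have "(\<Sum>i\<le>N. (norm (dual_samples \<eta> b (n + int i)))\<^sup>2) = (\<Sum>k\<in>int ` {..N}. (norm (dual_samples \<eta> b (n + k)))\<^sup>2)"
        by (subst sum.reindex) auto
      finally have "(2 * pi)\<^sup>2 * (norm (H \<eta> c n))\<^sup>2 \<le> (\<Sum>i\<le>N. (norm (Q i))\<^sup>2) * (\<Sum>k\<in>int ` {..N}. (norm (dual_samples \<eta> b (n + k)))\<^sup>2)" .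
      moreover have "(2 * pi)\<^sup>2 > 0" by simp
      ultimately have "(norm (H \<eta> c n))\<^sup>2 \<le> (\<Sum>i\<le>N. (norm (Q i))\<^sup>2) * (\<Sum>k\<in>int ` {..N}. (norm (dual_samples \<eta> b (n + k)))\<^sup>2) / (2 * pi)\<^sup>2"
        using pos_le_divide_eq mult.commute by metis
      thus ?thesis unfolding D_def by (simp only: times_divide_eq_left)
    qed
    have cr: "(norm (c r))\<^sup>2 \<le> C\<^sup>2 * (\<Sum>k\<in>{- int K..int K}. (norm (H \<eta> c (r + k)))\<^sup>2)" for r
    proof -
      \<comment> \<open>The l2 norm of the rows within reach bounds each single one of them.\<close>
      define E where "E = sqrt (\<Sum>k\<in>{- int K..int K}. (norm (H \<eta> c (r + k)))\<^sup>2)"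
      have "norm (H \<eta> c n) \<le> E" if "n \<in> {r - int K..r + int K}" for n
        unfolding E_def
      proof (rule real_le_rsqrt)
        have "(norm (H \<eta> c (r + (n - r))))\<^sup>2 \<le> (\<Sum>k\<in>{- int K..int K}. (norm (H \<eta> c (r + k)))\<^sup>2)"
          using that by (intro member_le_sum) auto
        thus "(norm (H \<eta> c n))\<^sup>2 \<le> (\<Sum>k\<in>{- int K..int K}. (norm (H \<eta> c (r + k)))\<^sup>2)" by simp
      qed
      hence "norm (c r) \<le> C * E" by (intro loc[of \<eta>]) (auto simp: c_def spread_admissible)
      hence "(norm (c r))\<^sup>2 \<le> (C * E)\<^sup>2" by (intro power_mono) auto
      also have "\<dots> = C\<^sup>2 * (\<Sum>k\<in>{- int K..int K}. (norm (H \<eta> c (r + k)))\<^sup>2)"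
        by (simp add: E_def power_mult_distrib sum_nonneg)
      finally show ?thesis .
    qed
    have "sq_nn count_int b = sq_nn count_int (\<lambda>p. c (fl p))"
      by (simp add: cfl)
    also have "\<dots> = sq_nn (count_space (range fl)) c"
      by (rule nn_integral_bij_count_space) (use injfl in \<open>auto simp: bij_betw_def\<close>)
    also have "\<dots> \<le> sq_nn count_int c"
      by (subst nn_integral_count_space_indicator) (auto intro!: nn_integral_mono simp: indicator_def)
    also have "\<dots> \<le> (\<integral>\<^sup>+r. ennreal (C\<^sup>2 * (\<Sum>k\<in>{- int K..int K}. (norm (H \<eta> c (r + k)))\<^sup>2)) \<partial>count_space UNIV)"
      by (intro nn_integral_mono ennreal_leI cr)
    also have "\<dots> = ennreal C1 * sq_nn count_int (H \<eta> c)"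
      unfolding C1_def by (rule nn_integral_sum_shifts) auto
    also have "\<dots> \<le> ennreal C1 * (\<integral>\<^sup>+n. ennreal (D * (\<Sum>k\<in>int ` {..N}. (norm (dual_samples \<eta> b (n + k)))\<^sup>2)) \<partial>count_space UNIV)"
      by (intro mult_left_mono nn_integral_mono ennreal_leI H2) auto
    also have "\<dots> = ennreal C1 * (ennreal C2 * sq_nn count_int (dual_samples \<eta> b))"
      unfolding C2_def by (subst nn_integral_sum_shifts) (use D0 in auto)
    finally show ?thesis using C12 by (simp add: ennreal_mult mult.assoc)
  qed
  thus ?thesis using C12 by (intro exI[of _ "C1 * C2"]) auto
qed

end

section \<open>The frame inequalities\<close>

definition frame_sum :: "(real \<Rightarrow> complex) \<Rightarrow> real \<Rightarrow> real \<Rightarrow> (real \<Rightarrow> complex) \<Rightarrow> ennreal" where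
  "frame_sum h \<alpha> \<beta> f = sq_nn (count_space UNIV) (\<lambda>mn. L2_inner f (gabor_atom h \<alpha> \<beta> (fst mn) (snd mn)))"

text \<open>For these functions the transform is bounded and Plancherel's identity is available, and
  truncations of L2 functions are of this kind.\<close>

definition test_function :: "(real \<Rightarrow> complex) \<Rightarrow> bool" where
  "test_function f \<longleftrightarrow> f \<in> borel_measurable borel \<and> (\<exists>B. \<forall>t. norm (f t) \<le> B) \<and> (\<exists>R>0. \<forall>t. R \<le> \<bar>t\<bar> \<longrightarrow> f t = 0)"

lemma test_function_integrable:
  assumes "test_function f"
  shows "integrable lborel f"
proof -
  obtain B R where [measurable]: "f \<in> borel_measurable borel" and B: "\<And>t. norm (f t) \<le> B" and R: "\<And>t. R \<le> \<bar>t\<bar> \<Longrightarrow> f t = 0"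
    using assms by (auto simp: test_function_def)
  have "integrable lborel (\<lambda>t. indicator {-R..R} t *\<^sub>R B)"
    by (intro integrable_scaleR_left integrable_real_indicator) (auto simp: emeasure_lborel_Icc_eq)
  thus ?thesis by (rule Bochner_Integration.integrable_bound)
    (use B R in \<open>auto simp: indicator_def intro!: AE_I2 order_trans[OF B]\<close>)
qed

context rational_window
begin

text \<open>Writing g as an integral of exponentials and exchanging the integrals moves the pairing
  to the frequency side. There m occurs only in the character of period T and n only as a
  translation of the window, up to a phase that the modulus ignores.\<close>

lemma gabor_coefficient:
  assumes f: "test_function f"
  shows "norm (L2_inner f (gabor_atom g \<alpha> 1 m n)) =
    norm (\<integral>\<eta>. fourier f \<eta> * cnj (window_ft (\<eta> - of_int n)) * cis (2 * pi * of_int m * \<eta> / T) \<partial>lborel)"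
proof -
  have [measurable]: "f \<in> borel_measurable borel" using f by (simp add: test_function_def)
  have intf: "integrable lborel f" by (rule test_function_integrable[OF f])
  define \<Phi> where "\<Phi> t \<eta> = f t * (cnj (window_ft (\<eta> - of_int n)) * (cis (- (2 * pi * \<eta> * t)) * cis (2 * pi * (\<eta> - of_int n) * (\<alpha> * of_int m))))" for t \<eta>
  have gsh: "integrable lborel (\<lambda>\<eta>. window_ft (\<eta> - of_int n))"
    using lborel_integrable_real_affine[OF window_ft_integrable, of 1 "- of_int n"] by simp
  have norm\<Phi>: "norm (\<Phi> t \<eta>) = norm (f t) * norm (window_ft (\<eta> - of_int n))" for t \<eta> by (simp add: \<Phi>_def norm_mult)
  have \<Phi>m: "case_prod \<Phi> \<in> borel_measurable (lborel \<Otimes>\<^sub>M lborel)"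
    unfolding \<Phi>_def by measurable
  have int\<Phi>: "integrable (lborel \<Otimes>\<^sub>M lborel) (case_prod \<Phi>)"
  proof (rule lborel_pair.Fubini_integrable[OF \<Phi>m])
    show "integrable lborel (\<lambda>t. \<integral>\<eta>. norm (case (t, \<eta>) of (x, y) \<Rightarrow> \<Phi> x y) \<partial>lborel)"
      using intf by (simp add: norm\<Phi>)
    show "AE t in lborel. integrable lborel (\<lambda>\<eta>. case (t, \<eta>) of (x, y) \<Rightarrow> \<Phi> x y)"
    proof (rule AE_I2)
      fix t
      have "integrable lborel (\<lambda>\<eta>. f t * window_ft (\<eta> - of_int n))" using gsh by simp
      thus "integrable lborel (\<lambda>\<eta>. case (t, \<eta>) of (x, y) \<Rightarrow> \<Phi> x y)"
        by (rule Bochner_Integration.integrable_bound) (auto simp: norm\<Phi> norm_mult \<Phi>_def)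
    qed
  qed
  have inner: "f t * cnj (gabor_atom g \<alpha> 1 m n t) = (\<integral>\<eta>. \<Phi> t \<eta> \<partial>lborel)" for t
  proof -
    have "g (t - \<alpha> * of_int m) = (\<integral>\<xi>. window_ft \<xi> * cis (2 * pi * \<xi> * (t - \<alpha> * of_int m)) \<partial>lborel)" by (rule g_eq_transform)
    also have "\<dots> = (\<integral>\<eta>. window_ft (\<eta> - of_int n) * cis (2 * pi * (\<eta> - of_int n) * (t - \<alpha> * of_int m)) \<partial>lborel)"
      by (subst lborel_integral_real_affine[where c = 1 and t = "- of_int n"]) auto
    finally have "gabor_atom g \<alpha> 1 m n t = cis (2 * pi * of_int n * t) *
       (\<integral>\<eta>. window_ft (\<eta> - of_int n) * cis (2 * pi * (\<eta> - of_int n) * (t - \<alpha> * of_int m)) \<partial>lborel)"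
      by (simp add: gabor_atom_def cis_conv_exp mult_ac)
    hence "f t * cnj (gabor_atom g \<alpha> 1 m n t) = f t * (cnj (cis (2 * pi * of_int n * t)) *
       (\<integral>\<eta>. cnj (window_ft (\<eta> - of_int n) * cis (2 * pi * (\<eta> - of_int n) * (t - \<alpha> * of_int m))) \<partial>lborel))"
      by (simp only: complex_cnj_mult[of "cis (2 * pi * of_int n * t)"] Bochner_Integration.integral_cnj)
    also have "\<dots> = (\<integral>\<eta>. f t * (cnj (cis (2 * pi * of_int n * t)) *
       cnj (window_ft (\<eta> - of_int n) * cis (2 * pi * (\<eta> - of_int n) * (t - \<alpha> * of_int m)))) \<partial>lborel)"
      by (simp only: integral_mult_right_zero)
    also have "\<dots> = (\<integral>\<eta>. \<Phi> t \<eta> \<partial>lborel)"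
    proof (intro Bochner_Integration.integral_cong refl)
      fix \<eta>
      have "- (2 * pi * of_int n * t) + - (2 * pi * (\<eta> - of_int n) * (t - \<alpha> * of_int m)) =
          - (2 * pi * \<eta> * t) + 2 * pi * (\<eta> - of_int n) * (\<alpha> * of_int m)" by (simp add: algebra_simps)
      hence "cis (- (2 * pi * of_int n * t)) * cis (- (2 * pi * (\<eta> - of_int n) * (t - \<alpha> * of_int m))) =
          cis (- (2 * pi * \<eta> * t)) * cis (2 * pi * (\<eta> - of_int n) * (\<alpha> * of_int m))" by (simp only: cis_mult)
      thus "f t * (cnj (cis (2 * pi * of_int n * t)) *
         cnj (window_ft (\<eta> - of_int n) * cis (2 * pi * (\<eta> - of_int n) * (t - \<alpha> * of_int m)))) = \<Phi> t \<eta>"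
        unfolding \<Phi>_def complex_cnj_mult cis_cnj by (simp only: mult.left_commute)
    qed
    finally show ?thesis .
  qed
  have "L2_inner f (gabor_atom g \<alpha> 1 m n) = (\<integral>t. (\<integral>\<eta>. \<Phi> t \<eta> \<partial>lborel) \<partial>lborel)"
    by (simp only: L2_inner_def inner)
  also have "\<dots> = (\<integral>\<eta>. (\<integral>t. \<Phi> t \<eta> \<partial>lborel) \<partial>lborel)"
    by (rule lborel_pair.Fubini_integral[OF int\<Phi>, symmetric])
  also have "\<dots> = (\<integral>\<eta>. cis (- (2 * pi * of_int n * (\<alpha> * of_int m))) *
       (fourier f \<eta> * cnj (window_ft (\<eta> - of_int n)) * cis (2 * pi * of_int m * \<eta> / T)) \<partial>lborel)"
  proof (intro Bochner_Integration.integral_cong refl)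
    fix \<eta>
    have "(\<integral>t. \<Phi> t \<eta> \<partial>lborel) = (\<integral>t. (cnj (window_ft (\<eta> - of_int n)) * cis (2 * pi * (\<eta> - of_int n) * (\<alpha> * of_int m))) * (f t * cis (- (2 * pi * \<eta> * t))) \<partial>lborel)"
      by (simp add: \<Phi>_def mult_ac)
    also have "\<dots> = cnj (window_ft (\<eta> - of_int n)) * cis (2 * pi * (\<eta> - of_int n) * (\<alpha> * of_int m)) * fourier f \<eta>"
      unfolding fourier_def by (rule integral_mult_right_zero)
    also have "cis (2 * pi * (\<eta> - of_int n) * (\<alpha> * of_int m)) = cis (- (2 * pi * of_int n * (\<alpha> * of_int m))) * cis (2 * pi * of_int m * \<eta> / T)"
      unfolding cis_mult by (rule arg_cong[of _ _ cis]) (simp add: T_def algebra_simps)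
    finally show "(\<integral>t. \<Phi> t \<eta> \<partial>lborel) = cis (- (2 * pi * of_int n * (\<alpha> * of_int m))) *
       (fourier f \<eta> * cnj (window_ft (\<eta> - of_int n)) * cis (2 * pi * of_int m * \<eta> / T))" by (simp only: mult_ac)
  qed
  also have "\<dots> = cis (- (2 * pi * of_int n * (\<alpha> * of_int m))) *
      (\<integral>\<eta>. fourier f \<eta> * cnj (window_ft (\<eta> - of_int n)) * cis (2 * pi * of_int m * \<eta> / T) \<partial>lborel)"
    by (rule integral_mult_right_zero)
  finally show ?thesis by (simp add: norm_mult)
qed

text \<open>For fixed n, Parseval with period T sums over m. The periodization is the complex
  conjugate of a fibre row applied to the conjugated transform of f, hence the
  \<open>cnj\<close>.\<close>

lemma frame_sum_eq:
  assumes f: "test_function f"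
  shows "frame_sum g \<alpha> 1 f = ennreal T *
    (\<integral>\<^sup>+\<eta>. \<integral>\<^sup>+n. ennreal ((norm (dual_samples \<eta> (\<lambda>p. cnj (fourier f (\<eta> + of_int p * T))) n))\<^sup>2) \<partial>count_space UNIV \<partial>Ico T)"
proof -
  have [measurable]: "f \<in> borel_measurable borel" using f by (simp add: test_function_def)
  define F where "F = (\<integral>t. norm (f t) \<partial>lborel)"
  have F: "norm (fourier f \<eta>) \<le> F" for \<eta> unfolding F_def by (rule norm_fourier_le)
  have F0: "F \<ge> 0" by (simp add: F_def)
  obtain C where C: "C \<ge> 0" "\<And>x. (\<integral>\<^sup>+p. ennreal (norm (window_ft (x + of_int p * T))) \<partial>count_int) \<le> ennreal C"
    using window_ft_sum_bounds by blast
  define Hn where "Hn n \<eta> = fourier f \<eta> * cnj (window_ft (\<eta> - of_int n))" for n :: int and \<eta>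
  have [measurable]: "Hn n \<in> borel_measurable borel" for n unfolding Hn_def by measurable
  have Hle: "norm (Hn n \<eta>) \<le> F * norm (window_ft (\<eta> - of_int n))" for n \<eta>
    using F by (simp add: Hn_def norm_mult mult_right_mono)
  have iH: "integrable lborel (Hn n)" for n
  proof -
    have "integrable lborel (\<lambda>\<eta>. F *\<^sub>R window_ft (\<eta> - of_int n))"
      using lborel_integrable_real_affine[OF window_ft_integrable, of 1 "- of_int n"] by simp
    thus ?thesis by (rule Bochner_Integration.integrable_bound) (use Hle F0 in \<open>auto intro!: AE_I2\<close>)
  qed
  have sampeq: "(norm (\<integral>p. Hn n (\<eta> + of_int p * T) \<partial>count_space UNIV)) = norm (dual_samples \<eta> (\<lambda>p. cnj (fourier f (\<eta> + of_int p * T))) n)" for n \<eta>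
  proof -
    have "cnj (dual_samples \<eta> (\<lambda>p. cnj (fourier f (\<eta> + of_int p * T))) n) = (\<integral>p. Hn n (\<eta> + of_int p * T) \<partial>count_space UNIV)"
      unfolding dual_samples_def Bochner_Integration.integral_cnj[symmetric] by (simp add: Hn_def)
    thus ?thesis by (metis complex_mod_cnj)
  qed
  have par: "sq_nn count_int (\<lambda>m. \<integral>\<eta>. Hn n \<eta> * cis (2 * pi * of_int m * \<eta> / T) \<partial>lborel) =
     ennreal T * sq_nn (Ico T) (\<lambda>\<eta>. dual_samples \<eta> (\<lambda>p. cnj (fourier f (\<eta> + of_int p * T))) n)" for n
    unfolding sampeq[symmetric]
  proof (rule parseval_periodized[OF T(2) iH])
    fix x
    have "(\<integral>\<^sup>+p. norm (Hn n (x + of_int p * T)) \<partial>count_int) \<le>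
       (\<integral>\<^sup>+p. ennreal F * ennreal (norm (window_ft ((x - of_int n) + of_int p * T))) \<partial>count_space UNIV)"
    proof (rule nn_integral_mono)
      fix p :: int
      have "x + of_int p * T - of_int n = (x - of_int n) + of_int p * T" by simp
      hence "norm (Hn n (x + of_int p * T)) \<le> F * norm (window_ft ((x - of_int n) + of_int p * T))"
        using Hle[of n "x + of_int p * T"] by (simp only:)
      thus "ennreal (norm (Hn n (x + of_int p * T))) \<le> ennreal F * ennreal (norm (window_ft ((x - of_int n) + of_int p * T)))"
        using F0 by (simp add: ennreal_mult[symmetric] ennreal_leI)
    qed
    also have "\<dots> = ennreal F * (\<integral>\<^sup>+p. ennreal (norm (window_ft ((x - of_int n) + of_int p * T))) \<partial>count_int)"
      by (rule nn_integral_cmult) auto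
    also have "\<dots> \<le> ennreal F * ennreal C" by (intro mult_left_mono C) auto
    finally show "(\<integral>\<^sup>+p. norm (Hn n (x + of_int p * T)) \<partial>count_int) \<le> ennreal (F * C)"
      using F0 C(1) by (simp add: ennreal_mult)
  qed
  have smeas: "(\<lambda>\<eta>. norm (dual_samples \<eta> (\<lambda>p. cnj (fourier f (\<eta> + of_int p * T))) n)) \<in> borel_measurable borel" for n
  proof -
    have "(\<lambda>\<eta>. \<integral>p. Hn n (\<eta> + of_int p * T) \<partial>count_int) \<in> borel_measurable borel"
      by (rule measurable_count_space_integral) measurable
    thus ?thesis unfolding sampeq[symmetric] by measurable
  qed
  have smeas2: "(\<lambda>\<eta>. ennreal ((norm (dual_samples \<eta> (\<lambda>p. cnj (fourier f (\<eta> + of_int p * T))) n))\<^sup>2)) \<in> borel_measurable (Ico T)" for n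
  proof -
    have "(\<lambda>\<eta>. ennreal ((norm (dual_samples \<eta> (\<lambda>p. cnj (fourier f (\<eta> + of_int p * T))) n))\<^sup>2)) \<in> borel_measurable borel"
      using smeas[of n] by measurable
    thus ?thesis by (intro measurable_restrict_space1) simp
  qed
  have "frame_sum g \<alpha> 1 f = (\<integral>\<^sup>+n. \<integral>\<^sup>+m. ennreal ((norm (L2_inner f (gabor_atom g \<alpha> 1 m n)))\<^sup>2) \<partial>count_space UNIV \<partial>count_space UNIV)"
    unfolding frame_sum_def by (subst nn_integral_snd_count_space[symmetric]) simp
  also have "\<dots> = (\<integral>\<^sup>+n. ennreal T * sq_nn (Ico T) (\<lambda>\<eta>. dual_samples \<eta> (\<lambda>p. cnj (fourier f (\<eta> + of_int p * T))) n) \<partial>count_space UNIV)"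
    unfolding gabor_coefficient[OF f] par[symmetric] Hn_def ..
  also have "\<dots> = ennreal T * (\<integral>\<^sup>+n. \<integral>\<^sup>+\<eta>. ennreal ((norm (dual_samples \<eta> (\<lambda>p. cnj (fourier f (\<eta> + of_int p * T))) n))\<^sup>2) \<partial>Ico T \<partial>count_space UNIV)"
    by (rule nn_integral_cmult) auto
  also have "(\<integral>\<^sup>+n. \<integral>\<^sup>+\<eta>. ennreal ((norm (dual_samples \<eta> (\<lambda>p. cnj (fourier f (\<eta> + of_int p * T))) n))\<^sup>2) \<partial>Ico T \<partial>count_space UNIV) =
     (\<integral>\<^sup>+\<eta>. \<integral>\<^sup>+n. ennreal ((norm (dual_samples \<eta> (\<lambda>p. cnj (fourier f (\<eta> + of_int p * T))) n))\<^sup>2) \<partial>count_space UNIV \<partial>Ico T)"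
    by (rule nn_integral_count_space_nn_integral[symmetric]) (rule countableI_type, rule smeas2)
  finally show ?thesis .
qed

lemma frame_bounds_test_function:
  "\<exists>A B. A > 0 \<and> B \<ge> 0 \<and> (\<forall>f. test_function f \<longrightarrow>
     ennreal A * sq_nn lborel f \<le> frame_sum g \<alpha> 1 f \<and>
     frame_sum g \<alpha> 1 f \<le> ennreal B * sq_nn lborel f)"
proof -
  obtain Cu where Cu: "Cu \<ge> 0" "\<And>\<eta> b B. (\<forall>p. norm (b p) \<le> B) \<Longrightarrow>
    (sq_nn count_int (dual_samples \<eta> b)) \<le> ennreal Cu * sq_nn count_int b"
    using dual_samples_upper by blast
  obtain Cl where Cl: "Cl \<ge> 0" "\<And>\<eta> b B. (\<forall>p. norm (b p) \<le> B) \<Longrightarrow>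
    (sq_nn count_int b) \<le> ennreal Cl * sq_nn count_int (dual_samples \<eta> b)"
    using dual_samples_lower by blast
  \<comment> \<open>Cl may be 0; adding 1 keeps the quotient positive and still gives A * Cl <=
    T.\<close>
  define A where "A = T / (Cl + 1)"
  have A: "A > 0" using T Cl(1) by (simp add: A_def)
  have "ennreal A * sq_nn lborel f \<le> frame_sum g \<alpha> 1 f \<and>
     frame_sum g \<alpha> 1 f \<le> ennreal (T * Cu) * sq_nn lborel f" if f: "test_function f" for f
  proof -
    have [measurable]: "f \<in> borel_measurable borel" using f by (simp add: test_function_def)
    obtain B R where B: "\<And>t. norm (f t) \<le> B" and R: "R > 0" "\<And>t. R \<le> \<bar>t\<bar> \<Longrightarrow> f t = 0"
      using f by (auto simp: test_function_def)
    define b where "b \<eta> p = cnj (fourier f (\<eta> + of_int p * T))" for \<eta> and p :: int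
    have bb: "\<forall>p. norm (b \<eta> p) \<le> (\<integral>t. norm (f t) \<partial>lborel)" for \<eta> by (simp add: b_def norm_fourier_le)
    define X where "X \<eta> = sq_nn count_int (dual_samples \<eta> (b \<eta>))" for \<eta>
    define Y where "Y \<eta> = sq_nn count_int (\<lambda>p. fourier f (\<eta> + of_int p * T))" for \<eta>
    define E where "E = sq_nn lborel f"
    have S: "frame_sum g \<alpha> 1 f = ennreal T * (\<integral>\<^sup>+\<eta>. X \<eta> \<partial>Ico T)"
      unfolding X_def b_def by (rule frame_sum_eq[OF f])
    have Ym: "Y \<in> borel_measurable (Ico T)"
    proof -
      interpret sigma_finite_measure "count_int" by (rule sigma_finite_measure_count_space_countable) auto
      have "(\<lambda>z. ennreal ((norm (fourier f (fst z + of_int (snd z) * T)))\<^sup>2)) \<in> borel_measurable (borel \<Otimes>\<^sub>M count_int)"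
        by measurable
      hence "case_prod (\<lambda>\<eta> (p :: int). ennreal ((norm (fourier f (\<eta> + of_int p * T)))\<^sup>2)) \<in> borel_measurable (borel \<Otimes>\<^sub>M count_space UNIV)"
        by (simp add: case_prod_unfold)
      hence "Y \<in> borel_measurable borel" unfolding Y_def by (rule borel_measurable_nn_integral)
      thus ?thesis by (intro measurable_restrict_space1) simp
    qed
    have "(\<integral>\<^sup>+\<eta>. Y \<eta> \<partial>Ico T) = (\<integral>\<^sup>+p. \<integral>\<^sup>+\<eta>. ennreal ((norm (fourier f (\<eta> + of_int p * T)))\<^sup>2) \<partial>Ico T \<partial>count_int)"
      unfolding Y_def by (rule nn_integral_count_space_nn_integral) (auto intro!: measurable_restrict_space1)
    also have "\<dots> = sq_nn lborel (fourier f)"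
      by (rule nn_integral_periodize[OF T(2), symmetric]) measurable
    also have "\<dots> = E" unfolding E_def by (rule plancherel_bounded_support[OF _ B R]) measurable
    finally have YE: "(\<integral>\<^sup>+\<eta>. Y \<eta> \<partial>Ico T) = E" .
    have XY: "X \<eta> \<le> ennreal Cu * Y \<eta>" "Y \<eta> \<le> ennreal Cl * X \<eta>" for \<eta>
    proof -
      have "(norm (b \<eta> p))\<^sup>2 = (norm (fourier f (\<eta> + of_int p * T)))\<^sup>2" for p by (simp add: b_def)
      thus "X \<eta> \<le> ennreal Cu * Y \<eta>" "Y \<eta> \<le> ennreal Cl * X \<eta>"
        using Cu(2)[OF bb[of \<eta>], of \<eta>] Cl(2)[OF bb[of \<eta>], of \<eta>] unfolding X_def Y_def by simp_all
    qed
    have "(\<integral>\<^sup>+\<eta>. X \<eta> \<partial>Ico T) \<le> (\<integral>\<^sup>+\<eta>. ennreal Cu * Y \<eta> \<partial>Ico T)" by (intro nn_integral_mono XY)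
    also have "\<dots> = ennreal Cu * E" using Ym by (simp add: nn_integral_cmult YE)
    finally have up: "frame_sum g \<alpha> 1 f \<le> ennreal (T * Cu) * E"
      using T Cu(1) unfolding S by (simp add: ennreal_mult mult.assoc mult_left_mono)
    have Xm: "X \<in> borel_measurable (Ico T)"
    proof -
      interpret sigma_finite_measure "count_int" by (rule sigma_finite_measure_count_space_countable) auto
      have s: "(\<lambda>\<eta>. dual_samples \<eta> (b \<eta>) n) \<in> borel_measurable borel" for n
        unfolding dual_samples_def b_def by (intro measurable_count_space_integral) measurable
      have "case_prod (\<lambda>\<eta> n. ennreal ((norm (dual_samples \<eta> (b \<eta>) n))\<^sup>2)) \<in> borel_measurable (borel \<Otimes>\<^sub>M count_space UNIV)"
        unfolding case_prod_unfold
        by (rule measurable_compose_countable[where f = "\<lambda>n z. ennreal ((norm (dual_samples (fst z) (b (fst z)) n))\<^sup>2)" and g = snd])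
          (use s in \<open>auto intro!: measurable_compose[OF measurable_fst] measurable_compose[OF _ measurable_ennreal]\<close>)
      hence "X \<in> borel_measurable borel" unfolding X_def by (rule borel_measurable_nn_integral)
      thus ?thesis by (intro measurable_restrict_space1) simp
    qed
    have "E \<le> (\<integral>\<^sup>+\<eta>. ennreal Cl * X \<eta> \<partial>Ico T)" unfolding YE[symmetric] by (intro nn_integral_mono XY)
    also have "\<dots> = ennreal Cl * (\<integral>\<^sup>+\<eta>. X \<eta> \<partial>Ico T)" using Xm by (rule nn_integral_cmult)
    finally have "ennreal A * E \<le> ennreal A * (ennreal Cl * (\<integral>\<^sup>+\<eta>. X \<eta> \<partial>Ico T))" by (rule mult_left_mono) simp
    also have "\<dots> = ennreal (A * Cl) * (\<integral>\<^sup>+\<eta>. X \<eta> \<partial>Ico T)" using A Cl(1) by (simp add: ennreal_mult mult.assoc)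
    also have "\<dots> \<le> ennreal T * (\<integral>\<^sup>+\<eta>. X \<eta> \<partial>Ico T)"
    proof (intro mult_right_mono ennreal_leI)
      have "A * Cl \<le> A * (Cl + 1)" using A by simp
      thus "A * Cl \<le> T" using Cl(1) by (simp add: A_def)
    qed simp
    finally show ?thesis using up by (simp add: S E_def)
  qed
  moreover have "T * Cu \<ge> 0" using T(2) Cu(1) by simp
  ultimately show ?thesis using A by blast
qed

end

text \<open>Under the substitution s = \<beta> t the coefficients and the energy of f are both
  multiplied by \<beta>. The squared coefficients gain \<beta>^2, so one factor 1/\<beta> remains in
  the bounds.\<close>

lemma frame_bounds_rescale:
  assumes \<beta>: "\<beta> > 0" and A: "A > 0" and B: "B \<ge> 0"
    and bounds: "\<And>f. test_function f \<Longrightarrow>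
     ennreal A * sq_nn lborel f \<le> frame_sum (\<lambda>s. h (s / \<beta>)) (\<alpha> * \<beta>) 1 f \<and>
     frame_sum (\<lambda>s. h (s / \<beta>)) (\<alpha> * \<beta>) 1 f \<le> ennreal B * sq_nn lborel f"
    and f: "test_function f"
  shows "ennreal (A / \<beta>) * sq_nn lborel f \<le> frame_sum h \<alpha> \<beta> f"
    and "frame_sum h \<alpha> \<beta> f \<le> ennreal (B / \<beta>) * sq_nn lborel f"
proof -
  have [measurable]: "f \<in> borel_measurable borel" using f by (simp add: test_function_def)
  define f' where "f' s = f (s / \<beta>)" for s
  have f'test_function: "test_function f'"
  proof -
    obtain C R where C: "\<And>t. norm (f t) \<le> C" and R: "R > 0" "\<And>t. R \<le> \<bar>t\<bar> \<Longrightarrow> f t = 0"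
      using f by (auto simp: test_function_def)
    have "f' s = 0" if "R * \<beta> \<le> \<bar>s\<bar>" for s
      using that \<beta> unfolding f'_def by (intro R) (simp add: abs_divide field_simps)
    moreover have "f' \<in> borel_measurable borel" unfolding f'_def by measurable
    ultimately show ?thesis using C R(1) \<beta> unfolding test_function_def
      by (intro conjI exI[of _ C] exI[of _ "R * \<beta>"]) (auto simp: f'_def)
  qed
  have en: "sq_nn lborel f' = ennreal \<beta> * sq_nn lborel f"
    using \<beta> unfolding f'_def by (subst nn_integral_real_affine[where c = \<beta> and t = 0]) auto
  have inner: "L2_inner f' (gabor_atom (\<lambda>s. h (s / \<beta>)) (\<alpha> * \<beta>) 1 m n) = \<beta> *\<^sub>R L2_inner f (gabor_atom h \<alpha> \<beta> m n)" for m n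
  proof -
    have "L2_inner f' (gabor_atom (\<lambda>s. h (s / \<beta>)) (\<alpha> * \<beta>) 1 m n) =
       \<beta> *\<^sub>R (\<integral>t. f' (0 + \<beta> * t) * cnj (gabor_atom (\<lambda>s. h (s / \<beta>)) (\<alpha> * \<beta>) 1 m n (0 + \<beta> * t)) \<partial>lborel)"
      unfolding L2_inner_def using \<beta> by (subst lborel_integral_real_affine[where c = \<beta> and t = 0]) auto
    also have "(\<lambda>t. f' (0 + \<beta> * t) * cnj (gabor_atom (\<lambda>s. h (s / \<beta>)) (\<alpha> * \<beta>) 1 m n (0 + \<beta> * t))) =
       (\<lambda>t. f t * cnj (gabor_atom h \<alpha> \<beta> m n t))"
    proof
      fix t
      have "(\<beta> * t - \<alpha> * \<beta> * of_int m) / \<beta> = t - \<alpha> * of_int m" using \<beta> by (simp add: field_simps)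
      thus "f' (0 + \<beta> * t) * cnj (gabor_atom (\<lambda>s. h (s / \<beta>)) (\<alpha> * \<beta>) 1 m n (0 + \<beta> * t)) = f t * cnj (gabor_atom h \<alpha> \<beta> m n t)"
        using \<beta> by (simp add: f'_def gabor_atom_def mult_ac)
    qed
    finally show ?thesis by (simp add: L2_inner_def)
  qed
  have fs: "frame_sum (\<lambda>s. h (s / \<beta>)) (\<alpha> * \<beta>) 1 f' = ennreal (\<beta>\<^sup>2) * frame_sum h \<alpha> \<beta> f"
    unfolding frame_sum_def inner
    by (subst nn_integral_cmult[symmetric]) (auto simp: power_mult_distrib ennreal_mult)
  have cancel: "ennreal (1 / \<beta>\<^sup>2) * (ennreal (\<beta>\<^sup>2) * x) = x" for x
    using \<beta> by (simp add: mult.assoc[symmetric] ennreal_mult[symmetric])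
  have c2: "ennreal (1 / \<beta>\<^sup>2) * (ennreal D * (ennreal \<beta> * x)) = ennreal (D / \<beta>) * x" if "D \<ge> 0" for D x
    using \<beta> that by (simp add: mult.assoc[symmetric] ennreal_mult[symmetric] power2_eq_square)
  note b = bounds[OF f'test_function, unfolded en fs]
  show "ennreal (A / \<beta>) * sq_nn lborel f \<le> frame_sum h \<alpha> \<beta> f"
    using mult_left_mono[OF conjunct1[OF b], of "ennreal (1 / \<beta>\<^sup>2)"] A by (simp add: cancel c2)
  show "frame_sum h \<alpha> \<beta> f \<le> ennreal (B / \<beta>) * sq_nn lborel f"
    using mult_left_mono[OF conjunct2[OF b], of "ennreal (1 / \<beta>\<^sup>2)"] B by (simp add: cancel c2)
qed

section \<open>From test functions to all of L2\<close>

lemma L2_add: assumes "f \<in> L2" "h \<in> L2" shows "(\<lambda>t. f t + h t) \<in> L2"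
proof -
  have [measurable]: "f \<in> borel_measurable borel" "h \<in> borel_measurable borel" using assms by (auto simp: L2_def)
  have "integrable lborel (\<lambda>t. 2 * (norm (f t))\<^sup>2 + 2 * (norm (h t))\<^sup>2)" using assms by (auto simp: L2_def)
  hence "integrable lborel (\<lambda>t. (norm (f t + h t))\<^sup>2)"
  proof (rule Bochner_Integration.integrable_bound)
    show "AE t in lborel. norm ((norm (f t + h t))\<^sup>2) \<le> norm (2 * (norm (f t))\<^sup>2 + 2 * (norm (h t))\<^sup>2)"
    proof (rule AE_I2)
      fix t
      have "(norm (f t + h t))\<^sup>2 \<le> (norm (f t) + norm (h t))\<^sup>2" by (intro power_mono norm_triangle_ineq) auto
      also have "\<dots> \<le> 2 * (norm (f t))\<^sup>2 + 2 * (norm (h t))\<^sup>2"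
        using zero_le_power2[of "norm (f t) - norm (h t)"] by (simp add: power2_eq_square algebra_simps)
      finally show "norm ((norm (f t + h t))\<^sup>2) \<le> norm (2 * (norm (f t))\<^sup>2 + 2 * (norm (h t))\<^sup>2)" by simp
    qed
  qed measurable
  thus ?thesis by (simp add: L2_def)
qed

lemma L2_inner_integrable:
  assumes "f \<in> L2" "h \<in> L2"
  shows "integrable lborel (\<lambda>t. f t * cnj (h t))"
    and "norm (f t * cnj (h t)) \<le> (norm (f t))\<^sup>2 + (norm (h t))\<^sup>2"
proof -
  have [measurable]: "f \<in> borel_measurable borel" "h \<in> borel_measurable borel" using assms by (auto simp: L2_def)
  have le: "norm (f t * cnj (h t)) \<le> (norm (f t))\<^sup>2 + (norm (h t))\<^sup>2" for t
  proof -
    have "2 * (norm (f t) * norm (h t)) \<le> (norm (f t))\<^sup>2 + (norm (h t))\<^sup>2"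
      using sum_squares_bound[of "norm (f t)" "norm (h t)"] by (simp add: mult.assoc)
    moreover have "0 \<le> norm (f t) * norm (h t)" by simp
    ultimately show ?thesis unfolding norm_mult complex_mod_cnj by linarith
  qed
  have "integrable lborel (\<lambda>t. (norm (f t))\<^sup>2 + (norm (h t))\<^sup>2)" using assms by (auto simp: L2_def)
  thus "integrable lborel (\<lambda>t. f t * cnj (h t))"
    by (rule Bochner_Integration.integrable_bound) (use le in \<open>auto intro!: AE_I2 simp: order_trans[OF le]\<close>)
  show "norm (f t * cnj (h t)) \<le> (norm (f t))\<^sup>2 + (norm (h t))\<^sup>2" by (rule le)
qed

lemma gabor_atom_L2:
  assumes "h \<in> L2"
  shows "gabor_atom h \<alpha> \<beta> m n \<in> L2"
proof -
  have [measurable]: "h \<in> borel_measurable borel" using assms by (auto simp: L2_def)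
  have "integrable lborel (\<lambda>t. (norm (h (- (\<alpha> * of_int m) + 1 * t)))\<^sup>2)"
    using assms by (intro lborel_integrable_real_affine[where f = "\<lambda>t. (norm (h t))\<^sup>2"]) (auto simp: L2_def)
  moreover have "norm (gabor_atom h \<alpha> \<beta> m n t) = norm (h (- (\<alpha> * of_int m) + 1 * t))" for t
    by (simp add: gabor_atom_def norm_mult)
  moreover have "gabor_atom h \<alpha> \<beta> m n \<in> borel_measurable lborel" unfolding gabor_atom_def by measurable
  ultimately show ?thesis by (simp add: L2_def)
qed

lemma nn_integral_L2: "f \<in> L2 \<Longrightarrow> (sq_nn lborel f) = ennreal (L2_normsq f)"
  unfolding L2_normsq_def L2_def by (intro nn_integral_eq_integral) auto

text \<open>Approximation by truncation. The upper bound passes to the limit by Fatou's lemma, which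
  has the wrong direction for the lower bound; there f is compared with its truncation, and the
  upper bound, already known on L2, controls the difference.\<close>

lemma gabor_frame_of_bounds:
  assumes h: "h \<in> L2" and A: "A > 0" and B: "B \<ge> 0"
    and lower: "\<And>f. test_function f \<Longrightarrow> ennreal A * sq_nn lborel f \<le> frame_sum h \<alpha> \<beta> f"
    and upper: "\<And>f. test_function f \<Longrightarrow> frame_sum h \<alpha> \<beta> f \<le> ennreal B * sq_nn lborel f"
  shows "gabor_frame h \<alpha> \<beta>"
proof -
  \<comment> \<open>Cutting both the range of t and the height gives a test function, dominated
    pointwise by f.\<close>
  define cut where "cut f R t = (if \<bar>t\<bar> < real R \<and> norm (f t) \<le> real R then f t else 0)" for f :: "real \<Rightarrow> complex" and R :: nat and t
  have cut_le: "norm (cut f R t) \<le> norm (f t)" for f R t by (simp add: cut_def)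
  have cut_test_function: "test_function (cut f R)" if f: "f \<in> L2" for f R
  proof -
    have [measurable]: "f \<in> borel_measurable borel" using f by (simp add: L2_def)
    have "cut f R \<in> borel_measurable borel" unfolding cut_def by measurable
    thus ?thesis unfolding test_function_def
      by (intro conjI exI[of _ "real R"] exI[of _ "real R + 1"]) (auto simp: cut_def)
  qed
  have cut_L2: "cut f R \<in> L2" if f: "f \<in> L2" for f R
  proof -
    have [measurable]: "cut f R \<in> borel_measurable borel" using cut_test_function[OF f] by (simp add: test_function_def)
    have "integrable lborel (\<lambda>t. (norm (f t))\<^sup>2)" using f by (simp add: L2_def)
    hence "integrable lborel (\<lambda>t. (norm (cut f R t))\<^sup>2)"
      by (rule Bochner_Integration.integrable_bound) (auto simp: cut_le power_mono)
    thus ?thesis by (simp add: L2_def)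
  qed
  have cut_tends: "(\<lambda>R. cut f R t) \<longlonglongrightarrow> f t" for f t
  proof (rule tendsto_eventually)
    have "eventually (\<lambda>R. \<bar>t\<bar> < real R \<and> norm (f t) \<le> real R) sequentially"
      by (intro eventually_conj) real_asymp+
    thus "eventually (\<lambda>R. cut f R t = f t) sequentially" by eventually_elim (simp add: cut_def)
  qed
  have normsq_cut: "(\<lambda>R. L2_normsq (cut f R)) \<longlonglongrightarrow> L2_normsq f" if f: "f \<in> L2" for f
  proof -
    have [measurable]: "f \<in> borel_measurable borel" "\<And>R. cut f R \<in> borel_measurable borel" using f cut_L2[OF f] by (auto simp: L2_def)
    show ?thesis unfolding L2_normsq_def
    proof (rule integral_dominated_convergence[where w = "\<lambda>t. (norm (f t))\<^sup>2"])
      show "integrable lborel (\<lambda>t. (norm (f t))\<^sup>2)" using f by (simp add: L2_def)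
      show "AE t in lborel. (\<lambda>R. (norm (cut f R t))\<^sup>2) \<longlonglongrightarrow> (norm (f t))\<^sup>2"
        by (intro AE_I2 tendsto_intros cut_tends)
      show "AE t in lborel. norm ((norm (cut f R t))\<^sup>2) \<le> (norm (f t))\<^sup>2" for R
        by (rule AE_I2) (simp add: cut_le power_mono)
    qed measurable
  qed
  have normsq_diff: "(\<lambda>R. L2_normsq (\<lambda>t. cut f R t - f t)) \<longlonglongrightarrow> 0" if f: "f \<in> L2" for f
  proof -
    have [measurable]: "f \<in> borel_measurable borel" "\<And>R. cut f R \<in> borel_measurable borel" using f cut_L2[OF f] by (auto simp: L2_def)
    have "(\<lambda>R. L2_normsq (\<lambda>t. cut f R t - f t)) \<longlonglongrightarrow> (\<integral>t. 0 \<partial>(lborel :: real measure))"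
      unfolding L2_normsq_def
    proof (rule integral_dominated_convergence[where w = "\<lambda>t. (norm (f t))\<^sup>2"])
      show "integrable lborel (\<lambda>t. (norm (f t))\<^sup>2)" using f by (simp add: L2_def)
      have "(\<lambda>R. (norm (cut f R t - f t))\<^sup>2) \<longlonglongrightarrow> (norm (f t - f t))\<^sup>2" for t
        by (intro tendsto_intros cut_tends)
      thus "AE t in lborel. (\<lambda>R. (norm (cut f R t - f t))\<^sup>2) \<longlonglongrightarrow> 0" by simp
      show "AE t in lborel. norm ((norm (cut f R t - f t))\<^sup>2) \<le> (norm (f t))\<^sup>2" for R
        by (rule AE_I2) (simp add: cut_def)
    qed measurable
    thus ?thesis by simp
  qed
  define coef where "coef f mn = L2_inner f (gabor_atom h \<alpha> \<beta> (fst mn) (snd mn))" for f mn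
  have S: "frame_sum h \<alpha> \<beta> f = sq_nn (count_space UNIV) (coef f)" for f
    by (simp add: frame_sum_def coef_def)
  have coef_cut: "(\<lambda>R. coef (cut f R) mn) \<longlonglongrightarrow> coef f mn" if f: "f \<in> L2" for f mn
  proof -
    define k where "k = gabor_atom h \<alpha> \<beta> (fst mn) (snd mn)"
    have k: "k \<in> L2" unfolding k_def by (rule gabor_atom_L2[OF h])
    have [measurable]: "f \<in> borel_measurable borel" "k \<in> borel_measurable borel" "\<And>R. cut f R \<in> borel_measurable borel"
      using f k cut_L2[OF f] by (auto simp: L2_def)
    show ?thesis unfolding coef_def L2_inner_def k_def[symmetric]
    proof (rule integral_dominated_convergence[where w = "\<lambda>t. (norm (f t))\<^sup>2 + (norm (k t))\<^sup>2"])
      show "integrable lborel (\<lambda>t. (norm (f t))\<^sup>2 + (norm (k t))\<^sup>2)" using f k by (simp add: L2_def)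
      show "AE t in lborel. (\<lambda>R. cut f R t * cnj (k t)) \<longlonglongrightarrow> f t * cnj (k t)"
        by (intro AE_I2 tendsto_intros cut_tends)
      show "AE t in lborel. norm (cut f R t * cnj (k t)) \<le> (norm (f t))\<^sup>2 + (norm (k t))\<^sup>2" for R
      proof (rule AE_I2)
        fix t
        have "norm (cut f R t * cnj (k t)) \<le> (norm (cut f R t))\<^sup>2 + (norm (k t))\<^sup>2" by (rule L2_inner_integrable(2)[OF cut_L2[OF f] k])
        also have "\<dots> \<le> (norm (f t))\<^sup>2 + (norm (k t))\<^sup>2" by (simp add: cut_le power_mono)
        finally show "norm (cut f R t * cnj (k t)) \<le> (norm (f t))\<^sup>2 + (norm (k t))\<^sup>2" .
      qed
    qed measurable
  qed
  have up: "frame_sum h \<alpha> \<beta> f \<le> ennreal (B * L2_normsq f)" if f: "f \<in> L2" for f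
  proof -
    have n0: "L2_normsq f \<ge> 0" by (simp add: L2_normsq_def)
    have "frame_sum h \<alpha> \<beta> f = (\<integral>\<^sup>+mn. liminf (\<lambda>R. ennreal ((norm (coef (cut f R) mn))\<^sup>2)) \<partial>count_space UNIV)"
      unfolding S
      by (intro nn_integral_cong lim_imp_Liminf[symmetric] tendsto_ennrealI tendsto_intros coef_cut[OF f]) simp
    also have "\<dots> \<le> liminf (\<lambda>R. frame_sum h \<alpha> \<beta> (cut f R))"
      unfolding S by (rule nn_integral_liminf) simp
    also have "\<dots> \<le> ennreal (B * L2_normsq f)"
    proof (rule order_trans[OF Liminf_le_Limsup Limsup_bounded[OF always_eventually[OF allI]]])
      fix R
      have "frame_sum h \<alpha> \<beta> (cut f R) \<le> ennreal B * sq_nn lborel (cut f R)"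
        by (rule upper[OF cut_test_function[OF f]])
      also have "\<dots> \<le> ennreal B * sq_nn lborel f"
        by (intro mult_left_mono nn_integral_mono ennreal_leI power_mono cut_le) auto
      finally show "frame_sum h \<alpha> \<beta> (cut f R) \<le> ennreal (B * L2_normsq f)"
        using B n0 by (simp add: nn_integral_L2[OF f] ennreal_mult)
    qed simp
    finally show ?thesis .
  qed
  have main: "(\<lambda>mn. (norm (coef f mn))\<^sup>2) summable_on UNIV \<and> A / 2 * L2_normsq f \<le> (\<Sum>\<^sub>\<infinity>mn\<in>UNIV. (norm (coef f mn))\<^sup>2) \<and>
      (\<Sum>\<^sub>\<infinity>mn\<in>UNIV. (norm (coef f mn))\<^sup>2) \<le> B * L2_normsq f" if f: "f \<in> L2" for f
  proof -
    define v where "v mn = (norm (coef f mn))\<^sup>2" for mn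
    have n0: "L2_normsq f' \<ge> 0" for f' by (simp add: L2_normsq_def)
    have "integrable (count_space UNIV) v"
      using up[OF f] unfolding S v_def by (intro integrableI_bounded) (auto simp: less_top[symmetric] top_unique)
    hence av: "Infinite_Set_Sum.abs_summable_on v UNIV" by (simp add: abs_summable_on_def)
    hence sm: "v summable_on UNIV" using abs_summable_summable abs_summable_equivalent by blast
    define s where "s = infsum v UNIV"
    have Ss: "frame_sum h \<alpha> \<beta> f = ennreal s"
      unfolding S s_def v_def[symmetric] infsetsum_infsum[OF av, symmetric]
      by (rule nn_integral_conv_infsetsum[OF av]) (simp add: v_def)
    have s0: "s \<ge> 0" unfolding s_def by (intro infsum_nonneg) (simp add: v_def)
    have sB: "s \<le> B * L2_normsq f" using up[OF f] B n0 unfolding Ss by (simp add: mult_nonneg_nonneg)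
    \<comment> \<open>From (x + y)^2 <= 2 x^2 + 2 y^2 for the truncation written as f plus an error.
      The error term vanishes as R grows, and the 2 in front of s halves the lower frame
      bound.\<close>
    have fin: "A * L2_normsq (cut f R) \<le> 2 * s + 2 * (B * L2_normsq (\<lambda>t. cut f R t - f t))" for R
    proof -
      define e where "e t = cut f R t - f t" for t
      have eL2: "e \<in> L2"
      proof -
        have "(\<lambda>t. - f t) \<in> L2" using f by (simp add: L2_def)
        from L2_add[OF cut_L2[OF f, of R] this] show ?thesis by (simp add: e_def[abs_def])
      qed
      have split: "coef (cut f R) mn = coef f mn + coef e mn" for mn
      proof -
        define k where "k = gabor_atom h \<alpha> \<beta> (fst mn) (snd mn)"
        have k: "k \<in> L2" unfolding k_def by (rule gabor_atom_L2[OF h])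
        show ?thesis unfolding coef_def L2_inner_def k_def[symmetric]
          by (subst Bochner_Integration.integral_add[symmetric, OF L2_inner_integrable(1)[OF f k] L2_inner_integrable(1)[OF eL2 k]])
            (simp add: e_def algebra_simps)
      qed
      have "ennreal (A * L2_normsq (cut f R)) = ennreal A * sq_nn lborel (cut f R)"
        using A n0 by (simp add: nn_integral_L2[OF cut_L2[OF f]] ennreal_mult)
      also have "\<dots> \<le> frame_sum h \<alpha> \<beta> (cut f R)" by (rule lower[OF cut_test_function[OF f]])
      also have "\<dots> \<le> (\<integral>\<^sup>+mn. ennreal 2 * ennreal ((norm (coef f mn))\<^sup>2) + ennreal 2 * ennreal ((norm (coef e mn))\<^sup>2) \<partial>count_space UNIV)"
        unfolding S
      proof (rule nn_integral_mono)
        fix mn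
        have "(norm (coef (cut f R) mn))\<^sup>2 \<le> (norm (coef f mn) + norm (coef e mn))\<^sup>2"
          unfolding split by (intro power_mono norm_triangle_ineq) auto
        also have "\<dots> \<le> 2 * (norm (coef f mn))\<^sup>2 + 2 * (norm (coef e mn))\<^sup>2"
          using zero_le_power2[of "norm (coef f mn) - norm (coef e mn)"] by (simp add: power2_eq_square algebra_simps)
        finally have "ennreal ((norm (coef (cut f R) mn))\<^sup>2) \<le> ennreal (2 * (norm (coef f mn))\<^sup>2 + 2 * (norm (coef e mn))\<^sup>2)"
          by (rule ennreal_leI)
        also have "\<dots> = ennreal 2 * ennreal ((norm (coef f mn))\<^sup>2) + ennreal 2 * ennreal ((norm (coef e mn))\<^sup>2)"
          by (simp only: ennreal_plus ennreal_mult zero_le_power2 zero_le_numeral mult_nonneg_nonneg)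
        finally show "ennreal ((norm (coef (cut f R) mn))\<^sup>2) \<le> ennreal 2 * ennreal ((norm (coef f mn))\<^sup>2) + ennreal 2 * ennreal ((norm (coef e mn))\<^sup>2)" .
      qed
      also have "\<dots> = ennreal 2 * frame_sum h \<alpha> \<beta> f + ennreal 2 * frame_sum h \<alpha> \<beta> e"
        unfolding S by (subst nn_integral_add) (auto simp: nn_integral_cmult)
      also have "\<dots> \<le> ennreal 2 * ennreal s + ennreal 2 * ennreal (B * L2_normsq e)"
        using up[OF eL2] by (intro add_mono mult_left_mono) (auto simp: Ss)
      also have "\<dots> = ennreal (2 * s + 2 * (B * L2_normsq e))"
        using s0 B n0[of e] by (simp only: ennreal_plus ennreal_mult zero_le_numeral mult_nonneg_nonneg)
      finally have "ennreal (A * L2_normsq (cut f R)) \<le> ennreal (2 * s + 2 * (B * L2_normsq e))" .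
      moreover have "0 \<le> 2 * s + 2 * (B * L2_normsq e)" using s0 B n0[of e] by simp
      ultimately show ?thesis unfolding e_def[abs_def] by (simp only: ennreal_le_iff)
    qed
    have "A * L2_normsq f \<le> 2 * s + 2 * (B * 0)"
    proof (rule LIMSEQ_le)
      show "(\<lambda>R. A * L2_normsq (cut f R)) \<longlonglongrightarrow> A * L2_normsq f" by (intro tendsto_intros normsq_cut f)
      show "(\<lambda>R. 2 * s + 2 * (B * L2_normsq (\<lambda>t. cut f R t - f t))) \<longlonglongrightarrow> 2 * s + 2 * (B * 0)"
        by (intro tendsto_intros normsq_diff f)
      show "\<exists>N. \<forall>R\<ge>N. A * L2_normsq (cut f R) \<le> 2 * s + 2 * (B * L2_normsq (\<lambda>t. cut f R t - f t))" using fin by blast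
    qed
    hence "A / 2 * L2_normsq f \<le> s" by simp
    thus ?thesis using sm sB unfolding s_def v_def by blast
  qed
  have conv: "(\<lambda>(m, n). (cmod (L2_inner f (gabor_atom h \<alpha> \<beta> m n)))\<^sup>2) = (\<lambda>mn. (norm (coef f mn))\<^sup>2)" for f
    by (auto simp: coef_def)
  \<comment> \<open>Ensures that the upper bound is at least the lower bound A/2, as
    \<open>gabor_frame\<close> demands.\<close>
  define B' where "B' = max B (A / 2)"
  have "(\<Sum>\<^sub>\<infinity>mn\<in>UNIV. (norm (coef f mn))\<^sup>2) \<le> B' * L2_normsq f" if "f \<in> L2" for f
  proof -
    have "B * L2_normsq f \<le> B' * L2_normsq f" by (intro mult_right_mono) (auto simp: B'_def L2_normsq_def)
    thus ?thesis using main[OF that] by linarith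
  qed
  thus ?thesis unfolding gabor_frame_def conv using main A
    by (intro exI[of _ "A / 2"] exI[of _ B']) (auto simp: B'_def)
qed

text \<open>The squared modulus of the denominator is (Re w)^2 + (t + Im w)^2, so the claim is an
  affine change of variable in the integral of 1 / (1 + x^2).\<close>

lemma cauchy_kernel_L2:
  assumes w: "Re w \<noteq> 0"
  shows "(\<lambda>t. c / (complex_of_real t - \<i> * w)) \<in> L2"
proof -
  have "integrable lborel (\<lambda>x::real. inverse (1 + x\<^sup>2))"
    using integrable_inverse_1_plus_square by (simp add: set_integrable_def)
  from lborel_integrable_real_affine[OF this, of "1 / Re w" "Im w / Re w"] w
  have i: "integrable lborel (\<lambda>t. (norm c / Re w)\<^sup>2 * inverse (1 + (Im w / Re w + 1 / Re w * t)\<^sup>2))"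
    by simp
  have "(norm (c / (complex_of_real t - \<i> * w)))\<^sup>2 = (norm c / Re w)\<^sup>2 * inverse (1 + (Im w / Re w + 1 / Re w * t)\<^sup>2)" for t
  proof -
    have "(norm (complex_of_real t - \<i> * w))\<^sup>2 = (Re w)\<^sup>2 * (1 + (Im w / Re w + 1 / Re w * t)\<^sup>2)"
      using w unfolding cmod_power2 by (simp add: power2_eq_square field_simps)
    thus ?thesis unfolding norm_divide power_divide by (simp only: divide_inverse inverse_mult_distrib mult_ac)
  qed
  hence "integrable lborel (\<lambda>t. (norm (c / (complex_of_real t - \<i> * w)))\<^sup>2)" using i by simp
  moreover have "(\<lambda>t. c / (complex_of_real t - \<i> * w)) \<in> borel_measurable lborel" by measurable
  ultimately show ?thesis by (simp add: L2_def)
qed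

theorem theorem1p2:
  fixes N :: nat and a w :: "nat \<Rightarrow> complex" and \<alpha> \<beta> :: real
  assumes a_nz: "\<And>k. k < N \<Longrightarrow> a k \<noteq> 0"
    and w_re: "\<And>k. k < N \<Longrightarrow> Re (w k) \<noteq> 0"
    and w_distinct: "\<And>k l. k < N \<Longrightarrow> l < N \<Longrightarrow> k \<noteq> l \<Longrightarrow> Re (w k) \<noteq> Re (w l)"
    and m0: "\<And>\<xi>::real. \<xi> > 0 \<Longrightarrow> (\<Sum>k<N. a k * exp (2 * pi * complex_of_real \<xi> * w k)) \<noteq> 0"
    and \<alpha>: "\<alpha> > 0" and \<beta>: "\<beta> > 0"
    and ab1: "\<alpha> * \<beta> < 1" and irr: "\<alpha> * \<beta> \<notin> \<rat>"
  shows "gabor_frame (\<lambda>t. \<Sum>k<N. a k / (complex_of_real t - \<i> * w k)) \<alpha> \<beta>"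
proof -
  define h where "h t = (\<Sum>k<N. a k / (complex_of_real t - \<i> * w k))" for t
  \<comment> \<open>The window s -> h (s / \<beta>) has the same form with all a and w multiplied by
    \<beta>; its m0 is \<beta> times the old one at \<beta> \<xi>, which is still a positive
    argument.\<close>
  interpret W: rational_window N "\<lambda>k. of_real \<beta> * a k" "\<lambda>k. of_real \<beta> * w k" "\<alpha> * \<beta>"
  proof
    fix \<xi> :: real assume "\<xi> > 0"
    hence "(\<Sum>k<N. a k * exp (2 * pi * complex_of_real (\<beta> * \<xi>) * w k)) \<noteq> 0" using \<beta> by (intro m0) simp
    moreover have "(\<Sum>k<N. of_real \<beta> * a k * exp (2 * pi * complex_of_real \<xi> * (of_real \<beta> * w k))) =
       of_real \<beta> * (\<Sum>k<N. a k * exp (2 * pi * complex_of_real (\<beta> * \<xi>) * w k))"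
      by (simp add: sum_distrib_left mult_ac)
    ultimately show "(\<Sum>k<N. of_real \<beta> * a k * exp (2 * pi * complex_of_real \<xi> * (of_real \<beta> * w k))) \<noteq> 0"
      using \<beta> by simp
  qed (use assms in auto)
  have Wg: "W.g = (\<lambda>s. h (s / \<beta>))"
  proof
    fix s
    have "of_real \<beta> * a k / (of_real s - \<i> * (of_real \<beta> * w k)) = a k / (complex_of_real (s / \<beta>) - \<i> * w k)" for k
    proof -
      have "of_real s - \<i> * (of_real \<beta> * w k) = of_real \<beta> * (complex_of_real (s / \<beta>) - \<i> * w k)"
        using \<beta> by (simp add: algebra_simps)
      thus ?thesis using \<beta> by simp
    qed
    thus "W.g s = h (s / \<beta>)" by (simp add: W.g_def h_def)
  qed
  obtain A B where A: "A > 0" and B: "B \<ge> 0" and bounds: "\<And>f. test_function f \<Longrightarrow>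
     ennreal A * sq_nn lborel f \<le> frame_sum (\<lambda>s. h (s / \<beta>)) (\<alpha> * \<beta>) 1 f \<and>
     frame_sum (\<lambda>s. h (s / \<beta>)) (\<alpha> * \<beta>) 1 f \<le> ennreal B * sq_nn lborel f"
    using W.frame_bounds_test_function unfolding Wg by blast
  have hL2: "h \<in> L2"
  proof -
    have "(\<lambda>t. \<Sum>k<n. a k / (complex_of_real t - \<i> * w k)) \<in> L2" if "n \<le> N" for n
      using that
    proof (induction n)
      case (Suc n)
      thus ?case using L2_add[OF Suc.IH cauchy_kernel_L2[OF w_re[of n], of "a n"]] by simp
    qed (simp add: L2_def)
    thus ?thesis by (simp add: h_def[abs_def])
  qed
  have "gabor_frame h \<alpha> \<beta>"
  proof (rule gabor_frame_of_bounds[OF hL2])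
    show "A / \<beta> > 0" "B / \<beta> \<ge> 0" using A B \<beta> by auto
  qed (rule frame_bounds_rescale[OF \<beta> A B bounds]; assumption)+
  thus ?thesis by (simp add: h_def[abs_def])
qed

end
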